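(* Let $\mathbf{W}_N$ ($N\in\mathbb{N}$) be Wigner matrices of the following form. For each $N$, let $(X_{j,k}^{(N)})_{1\le j\le k\le N}$ be a family of independent random variables, with real-valued diagonal entries ($j=k$) and with off-diagonal entries ($j<k$) either all real-valued (case $\beta=1$) or complex-valued (case $\beta=2$). Let $s^2\ge 0$, $\sigma^2>0$, $\alpha$ be constants independent of $N$, and assume: (1) $\mathbb{E}[X_{j,j}^{(N)}]=0$ and $\mathbb{E}[|X_{j,j}^{(N)}|^2]=s^2$ for all $j\in[N]$; (2) $\mathbb{E}[X_{j,k}^{(N)}]=0$, $\mathbb{E}[|X_{j,k}^{(N)}|^2]=\sigma^2$ and $\mathbb{E}[|X_{j,k}^{(N)}|^4]=\alpha$ for all $j<k\in[N]$; (3) in the case $\beta=2$, additionally $\mathbb{E}[(X_{j,k}^{(N)})^2]=0$ for all $j<k\in[N]$; (4) $\sup_{N\in\mathbb{N}}\sup_{j\le k\in[N]}\mathbb{E}[|X_{j,k}^{(N)}|^\ell]<\infty$ for all $\ell\in\mathbb{N}$. Let $\mathbf{W}_N$ be the self-adjoint $N\times N$ matrix with $\mathbf{W}_N(j,k)=\frac{1}{\sqrt N}X_{j,k}^{(N)}$ for $j\le k$. Then for any fixed $N_0\in\mathbb{N}$, the three families $\{\mathbf{W}_N\}$, $(\mathbf{E}_N^{(j,k)})_{j,k\in[N_0]}$ and $\{\frac1N\mathbf{J}_N\}$ are asymptotically infinitesimally free, where $\mathbf{E}_N^{(j,k)}$ is the $N\times N$ matrix unit with a $1$ in coordinate $(j,k)$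 and $\mathbf{J}_N$ is the $N\times N$ all-ones matrix.
   Context: $[N]=\{1,\dots,N\}$. Random matrices live in the algebra of $N\times N$ matrices with entries having finite absolute moments of all orders, with the tracial unital functional $\frac1N\mathbb{E}[\mathrm{Tr}(\cdot)]$. An infinitesimal non-commutative (NC) probability space $(\mathcal{A},\varphi,\varphi')$ is a unital complex algebra $\mathcal{A}$ with a unital linear functional $\varphi$ and a linear functional $\varphi'$ with $\varphi'(1)=0$. Unital subalgebras $(\mathcal{A}_i)_{i\in I}$ are infinitesimally free if for all $k\ge2$, all consecutively distinct indices $i(1)\ne i(2)\ne\cdots\ne i(k)$ and all $a_j\in\mathcal{A}_{i(j)}$ with $\varphi(a_j)=0$: (i) $\varphi(a_1\cdots a_k)=0$; (ii) $\varphi'(a_1\cdots a_k)=\sum_{j=1}^k\varphi'(a_j)\,\varphi(a_1\cdots a_{j-1}a_{j+1}\cdots a_k)$. Collections of elements are infinitesimally free if the unital subalgebras they generate are. For a family $\mathcal{A}_N=(\mathbf{A}_N^{(i)})_{i\in I}$ of random matrices and non-commuting indeterminates $\mathbf{x}=(x_i)_{i\in I}$, put $\mu_{\mathcal{A}_N}(P)=\frac1N\mathbb{E}[\mathrm{Tr}(P(\mathcal{A}_N))]$ for $P\in\mathbb{C}\langle\mathbf{x}\rangle$. If $\mu_{\mathbf{x}}(P)=\lim_N\mu_{\mathcal{A}_N}(P)$ and $\nu_{\mathbf{x}}(P)=\lim_N N(\mu_{\mathcal{A}_N}(P)-\mu_{\mathbf{x}}(P))$ exist (finite) for all $P$, then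 $\nu_{\mathbf{x}}$ is called the infinitesimal distribution of $\mathcal{A}_N$. Families of random matrices are asymptotically infinitesimally free if their union has such limits $(\mu_{\mathbf{x}},\nu_{\mathbf{x}})$ and the corresponding collections of indeterminates are infinitesimally free in $(\mathbb{C}\langle\mathbf{x}\rangle,\mu_{\mathbf{x}},\nu_{\mathbf{x}})$. *)

theory Defs
  imports "HOL-Probability.Probability" "HOL-Library.Poly_Mapping" "Jordan_Normal_Form.Matrix"
begin

hide_const (open) Finite_Cartesian_Product.mat Determinants.trace

section \<open>Infinitesimal non-commutative probability spaces\<close>

locale complex_algebra_1 = vector_space scale
  for scale :: "complex \<Rightarrow> 'a::ring_1 \<Rightarrow> 'a" +
  assumes scale_mult_left: "scale c x * y = scale c (x * y)"
    and scale_mult_right: "x * scale c y = scale c (x * y)"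
begin

definition unital_subalgebra :: "'a set \<Rightarrow> bool" where
  "unital_subalgebra B \<longleftrightarrow> subspace B \<and> 1 \<in> B \<and> (\<forall>x\<in>B. \<forall>y\<in>B. x * y \<in> B)"

definition generated :: "'a set \<Rightarrow> 'a set" where
  "generated S = unital_subalgebra hull S"

definition linear_functional_on :: "'a set \<Rightarrow> ('a \<Rightarrow> complex) \<Rightarrow> bool" where
  "linear_functional_on A f \<longleftrightarrow>
     (\<forall>x\<in>A. \<forall>y\<in>A. f (x + y) = f x + f y) \<and> (\<forall>c. \<forall>x\<in>A. f (scale c x) = c * f x)"

end

text \<open>
  The algebra of the space is a carrier set \<open>A\<close> inside an ambient complex algebra;
  the functionals are only constrained on \<open>A\<close>.
\<close>

locale infinitesimal_nc_space = complex_algebra_1 scale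
  for scale :: "complex \<Rightarrow> 'a::ring_1 \<Rightarrow> 'a" +
  fixes A :: "'a set" and \<phi> \<phi>' :: "'a \<Rightarrow> complex"
  assumes algebra: "unital_subalgebra A"
    and linear: "linear_functional_on A \<phi>" and linear': "linear_functional_on A \<phi>'"
    and unit: "\<phi> 1 = 1" and unit': "\<phi>' 1 = 0"
begin

text \<open>
  In the condition below a product \<open>a\<^sub>1 \<cdots> a\<^sub>k\<close> is \<open>prod_list (map a [0..<k])\<close>, with factors
  numbered from 0; \<open>[0..<j] @ [Suc j..<k]\<close> omits the factor number \<open>j\<close>.
\<close>

definition infinitesimally_free :: "'l set \<Rightarrow> ('l \<Rightarrow> 'a set) \<Rightarrow> bool" where
  "infinitesimally_free L B \<longleftrightarrow>
     (\<forall>l\<in>L. unital_subalgebra (B l) \<and> B l \<subseteq> A) \<and>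
     (\<forall>k (i :: nat \<Rightarrow> 'l) (a :: nat \<Rightarrow> 'a).
        k \<ge> 2 \<and>
        (\<forall>j<k. i j \<in> L \<and> a j \<in> B (i j) \<and> \<phi> (a j) = 0) \<and>
        (\<forall>j. Suc j < k \<longrightarrow> i j \<noteq> i (Suc j)) \<longrightarrow>
        \<phi> (prod_list (map a [0..<k])) = 0 \<and>
        \<phi>' (prod_list (map a [0..<k])) =
          (\<Sum>j<k. \<phi>' (a j) * \<phi> (prod_list (map a ([0..<j] @ [Suc j..<k])))))"

definition infinitesimally_free_collections :: "'l set \<Rightarrow> ('l \<Rightarrow> 'a set) \<Rightarrow> bool" where
  "infinitesimally_free_collections L S \<longleftrightarrow> infinitesimally_free L (\<lambda>l. generated (S l))"

end

section \<open>Non-commutative polynomials\<close>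

text \<open>
  The free monoid over \<open>'i\<close>, written additively: this is what the convolution product of
  \<open>\<Rightarrow>\<^sub>0\<close> expects, so that \<open>'i ncword \<Rightarrow>\<^sub>0 complex\<close> is the ring of non-commutative
  polynomials in indeterminates indexed by \<open>'i\<close>.
\<close>

datatype 'i ncword = NCWord (letters: "'i list")

instantiation ncword :: (type) monoid_add
begin

definition zero_ncword :: "'a ncword" where
  "0 = NCWord []"

definition plus_ncword :: "'a ncword \<Rightarrow> 'a ncword \<Rightarrow> 'a ncword" where
  "u + v = NCWord (letters u @ letters v)"

instance
  by standard (simp_all add: zero_ncword_def plus_ncword_def)

end

type_synonym 'i ncpoly = "'i ncword \<Rightarrow>\<^sub>0 complex"

definition nc_scale :: "complex \<Rightarrow> 'i ncpoly \<Rightarrow> 'i ncpoly" where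
  "nc_scale c P = Poly_Mapping.map ((*) c) P"

definition nc_var :: "'i \<Rightarrow> 'i ncpoly" where
  "nc_var i = Poly_Mapping.single (NCWord [i]) 1"

definition nc_polys :: "'i set \<Rightarrow> 'i ncpoly set" where
  "nc_polys I = {P. \<forall>w\<in>Poly_Mapping.keys P. set (letters w) \<subseteq> I}"

lemma lookup_nc_scale [simp]: "Poly_Mapping.lookup (nc_scale c P) w = c * Poly_Mapping.lookup P w"
  unfolding nc_scale_def by (simp add: Poly_Mapping.map.rep_eq when_def)

lemma nc_scale_single: "nc_scale c (Poly_Mapping.single w b) = Poly_Mapping.single w (c * b)"
  by (rule poly_mapping_eqI) (simp add: lookup_single when_def)

lemma nc_poly_induct [case_names zero add]:
  fixes P :: "'i ncpoly"
  assumes "Q 0" and "\<And>w b P. Q P \<Longrightarrow> Q (Poly_Mapping.single w b + P)"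
  shows "Q P"
proof (induction "card (Poly_Mapping.keys P)" arbitrary: P)
  case 0
  then show ?case using assms(1) by simp
next
  case (Suc n)
  then obtain w where w: "w \<in> Poly_Mapping.keys P" by fastforce
  define R where "R = Poly_Mapping.update w 0 P"
  have "Poly_Mapping.keys R = Poly_Mapping.keys P - {w}"
    by (auto simp: R_def keys_update)
  then have "Q R" using Suc w by simp
  moreover have "P = Poly_Mapping.single w (Poly_Mapping.lookup P w) + R"
    by (rule poly_mapping_eqI) (simp add: R_def lookup_add lookup_single update.rep_eq when_def)
  ultimately show ?case using assms(2) by metis
qed

lemma nc_scale_add: "nc_scale c (P + R) = nc_scale c P + nc_scale c R"
  by (rule poly_mapping_eqI) (simp add: lookup_add algebra_simps)

lemma nc_scale_zero: "nc_scale c 0 = 0"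
  by (rule poly_mapping_eqI) simp

lemma nc_scale_left: "nc_scale c P * R = nc_scale c (P * R)"
proof (induction P rule: nc_poly_induct)
  case (add w b P)
  have "nc_scale c (Poly_Mapping.single w b) * R = nc_scale c (Poly_Mapping.single w b * R)"
    by (induction R rule: nc_poly_induct)
      (simp_all add: nc_scale_zero nc_scale_add distrib_left mult_single nc_scale_single mult.assoc)
  with add show ?case by (simp add: nc_scale_add distrib_right)
qed (simp add: nc_scale_zero)

lemma nc_scale_right: "P * nc_scale c R = nc_scale c (P * R)"
proof (induction P rule: nc_poly_induct)
  case (add w b P)
  have "Poly_Mapping.single w b * nc_scale c R = nc_scale c (Poly_Mapping.single w b * R)"
    by (induction R rule: nc_poly_induct)
      (simp_all add: nc_scale_zero nc_scale_add distrib_left mult_single nc_scale_single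
        mult.left_commute)
  with add show ?case by (simp add: nc_scale_add distrib_right)
qed (simp add: nc_scale_zero)

global_interpretation nc: complex_algebra_1 nc_scale
proof
  fix a b :: complex and P R :: "'i ncpoly"
  show "nc_scale a (P + R) = nc_scale a P + nc_scale a R" by (rule nc_scale_add)
  show "nc_scale (a + b) P = nc_scale a P + nc_scale b P"
    by (rule poly_mapping_eqI) (simp add: lookup_add algebra_simps)
  show "nc_scale a (nc_scale b P) = nc_scale (a * b) P"
    by (rule poly_mapping_eqI) simp
  show "nc_scale 1 P = P"
    by (rule poly_mapping_eqI) simp
  show "nc_scale a P * R = nc_scale a (P * R)" by (rule nc_scale_left)
  show "P * nc_scale a R = nc_scale a (P * R)" by (rule nc_scale_right)
qed

section \<open>Random matrices\<close>

text \<open>Rows and columns of \<open>N \<times> N\<close> matrices are numbered \<open>0, \<dots>, N - 1\<close>.\<close>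

definition mat_trace :: "complex mat \<Rightarrow> complex" where
  "mat_trace A = (\<Sum>j<dim_row A. A $$ (j, j))"

definition random_matrix :: "'w measure \<Rightarrow> nat \<Rightarrow> ('w \<Rightarrow> complex mat) \<Rightarrow> bool" where
  "random_matrix M N A \<longleftrightarrow>
     (\<forall>\<omega>\<in>space M. A \<omega> \<in> carrier_mat N N) \<and>
     (\<forall>j<N. \<forall>k<N. (\<lambda>\<omega>. A \<omega> $$ (j, k)) \<in> borel_measurable M \<and>
        (\<forall>p::nat. integrable M (\<lambda>\<omega>. cmod (A \<omega> $$ (j, k)) ^ p)))"

definition eval_word :: "nat \<Rightarrow> ('i \<Rightarrow> complex mat) \<Rightarrow> 'i ncword \<Rightarrow> complex mat" where
  "eval_word N A w = foldr (\<lambda>i B. A i * B) (letters w) (1\<^sub>m N)"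

definition eval_nc :: "nat \<Rightarrow> ('i \<Rightarrow> complex mat) \<Rightarrow> 'i ncpoly \<Rightarrow> complex mat" where
  "eval_nc N A P = mat N N (\<lambda>jk.
     \<Sum>w\<in>Poly_Mapping.keys P. Poly_Mapping.lookup P w * eval_word N A w $$ jk)"

text \<open>
  A family of random matrices is \<open>A i N\<close>, with \<open>i\<close> the index in the family and \<open>N\<close> the
  dimension; the probability space \<open>M N\<close> may depend on \<open>N\<close>.
\<close>

definition mean_distribution ::
  "(nat \<Rightarrow> 'w measure) \<Rightarrow> ('i \<Rightarrow> nat \<Rightarrow> 'w \<Rightarrow> complex mat) \<Rightarrow> nat \<Rightarrow> 'i ncpoly \<Rightarrow> complex" where
  "mean_distribution M A N P =
     1 / of_nat N * (\<integral>\<omega>. mat_trace (eval_nc N (\<lambda>i. A i N \<omega>) P) \<partial>M N)"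

definition has_infinitesimal_distribution ::
  "(nat \<Rightarrow> 'w measure) \<Rightarrow> 'i set \<Rightarrow> ('i \<Rightarrow> nat \<Rightarrow> 'w \<Rightarrow> complex mat) \<Rightarrow>
   ('i ncpoly \<Rightarrow> complex) \<Rightarrow> ('i ncpoly \<Rightarrow> complex) \<Rightarrow> bool" where
  "has_infinitesimal_distribution M I A \<mu> \<nu> \<longleftrightarrow>
     (\<forall>P\<in>nc_polys I.
        (\<lambda>N. mean_distribution M A N P) \<longlonglongrightarrow> \<mu> P \<and>
        (\<lambda>N. of_nat N * (mean_distribution M A N P - \<mu> P)) \<longlonglongrightarrow> \<nu> P)"

text \<open>
  The families are \<open>(A i)\<^bsub>i \<in> S l\<^esub>\<close> for \<open>l \<in> L\<close>, so that their union is indexed by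
  \<open>\<Union>l\<in>L. S l\<close>.
\<close>

definition asymptotically_infinitesimally_free ::
  "(nat \<Rightarrow> 'w measure) \<Rightarrow> 'l set \<Rightarrow> ('l \<Rightarrow> 'i set) \<Rightarrow> ('i \<Rightarrow> nat \<Rightarrow> 'w \<Rightarrow> complex mat) \<Rightarrow> bool"
  where
  "asymptotically_infinitesimally_free M L S A \<longleftrightarrow>
     (\<forall>i\<in>(\<Union>l\<in>L. S l). \<forall>N\<ge>1. random_matrix (M N) N (A i N)) \<and>
     (\<exists>\<mu> \<nu>. has_infinitesimal_distribution M (\<Union>l\<in>L. S l) A \<mu> \<nu> \<and>
        infinitesimal_nc_space nc_scale (nc_polys (\<Union>l\<in>L. S l)) \<mu> \<nu> \<and>
        infinitesimal_nc_space.infinitesimally_free_collections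
          nc_scale (nc_polys (\<Union>l\<in>L. S l)) \<mu> \<nu> L (\<lambda>l. nc_var ` S l))"

section \<open>The three ensembles\<close>

text \<open>\<open>X j k\<close> is only used for \<open>j \<le> k\<close>.\<close>

definition wigner_matrix :: "nat \<Rightarrow> (nat \<Rightarrow> nat \<Rightarrow> complex) \<Rightarrow> complex mat" where
  "wigner_matrix N X = mat N N (\<lambda>(j, k).
     if j \<le> k then X j k / of_real (sqrt (real N)) else cnj (X k j) / of_real (sqrt (real N)))"

text \<open>This is the zero matrix in the dimensions \<open>N\<close> that are too small for the coordinate \<open>(j, k)\<close>.\<close>

definition matrix_unit :: "nat \<Rightarrow> nat \<Rightarrow> nat \<Rightarrow> complex mat" where
  "matrix_unit N j k = mat N N (\<lambda>p. if p = (j, k) then 1 else 0)"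

definition all_ones :: "nat \<Rightarrow> complex mat" where
  "all_ones N = mat N N (\<lambda>_. 1)"

datatype ensemble_index = Wigner | MatUnit nat nat | Ones

primrec ensemble ::
  "(nat \<Rightarrow> nat \<Rightarrow> nat \<Rightarrow> 'w \<Rightarrow> complex) \<Rightarrow> ensemble_index \<Rightarrow> nat \<Rightarrow> 'w \<Rightarrow> complex mat" where
  "ensemble X Wigner = (\<lambda>N \<omega>. wigner_matrix N (\<lambda>j k. X N j k \<omega>))"
| "ensemble X (MatUnit j k) = (\<lambda>N \<omega>. matrix_unit N j k)"
| "ensemble X Ones = (\<lambda>N \<omega>. (1 / of_nat N) \<cdot>\<^sub>m all_ones N)"

end

theory Submission
  imports Defs "HOL-Real_Asymp.Real_Asymp"
begin

text \<open>
  The matrix units and \<open>J / N\<close> are rank one matrices \<open>x y\<^sup>T\<close> with \<open>x\<close> and \<open>y\<close> among the basis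
  vectors and the normalised all-ones vector. The trace of a word with at least one such letter
  is thus a product of bilinear forms \<open>\<langle>y, W\<^sup>k x\<rangle>\<close>, read off cyclically. Each form converges in
  all \<open>L\<^sup>p\<close> to \<open>m\<^sub>k\<close> if \<open>x = y\<close> and to \<open>0\<close> otherwise, where \<open>m\<^sub>k\<close> is the limit of the normalised
  trace of \<open>W\<^sup>k\<close>. Second moments are sums over pairs of walks: an edge used exactly once makes the
  expectation vanish, and a connected graph has at most one vertex more than it has edges. So the
  trace of such a word converges without normalisation to a product of moments \<open>m\<^sub>k\<close>, and
  infinitesimal freeness becomes a computation with these products. For the powers of \<open>W\<close> alone,
  only the existence of the next order is needed: in the two leading orders the expectation
  attached to a walk depends only on its shape, and shapes are counted by binomial coefficients.
\<close>

section \<open>Walks and their graphs\<close>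

text \<open>The assumptions fix the means, the absolute second moments, E X^2 and, off the diagonal,
  E |X|^4; all other moments are merely bounded and may vary with the entry and with N. The second
  order of the trace of W^k converges nevertheless, because a closed walk of 2m steps with m or m +
  1 vertices that contributes uses each edge twice, or four times with two crossings in each
  direction: no other moment enters. Odd powers have diagonal means of order N^(-3/2) and so affect
  neither order. Words with a rank one letter need less precision but joint control: their trace is
  a product of dependent forms, and convergence of means alone does not pass to products. Variance
  estimates give L^2 only; the passage to every L^p rests on |<x, W^k y>|^2 <= <x, W^(2k) x> for y
  of norm at most 1, which bounds high moments by means already known to converge. The m_k and their
  corrections enter as abstract numbers, of which freeness uses the values 1 and 0 at k = 0.\<close>

fun steps :: "'a list \<Rightarrow> ('a \<times> 'a) list" where
  "steps (a # b # r) = (a, b) # steps (b # r)"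
| "steps _ = []"

text \<open>The order of the steps is kept and each is turned around: this is what complex
  conjugation does to a product of entries of a self-adjoint matrix along a walk.\<close>

abbreviation back_steps :: "'a list \<Rightarrow> ('a \<times> 'a) list" where
  "back_steps p \<equiv> map prod.swap (steps p)"

text \<open>An undirected edge is encoded by its ordered pair of ends, so that it is at the same
  time the index of the independent variable that the edge carries.\<close>

definition ed :: "nat \<times> nat \<Rightarrow> nat \<times> nat" where
  "ed s = (min (fst s) (snd s), max (fst s) (snd s))"

definition edges :: "(nat \<times> nat) list \<Rightarrow> (nat \<times> nat) set" where
  "edges S = ed ` set S"

definition edge_mult :: "(nat \<times> nat) list \<Rightarrow> nat \<times> nat \<Rightarrow> nat" where
  "edge_mult S e = count_list (map ed S) e"

lemma ed_swap [simp]: "ed (prod.swap s) = ed s"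
  by (simp add: ed_def min.commute max.commute)

lemma ed_eq_iff: "ed (a, b) = ed (c, d) \<longleftrightarrow> (a = c \<and> b = d) \<or> (a = d \<and> b = c)"
  by (auto simp: ed_def min_def max_def split: if_splits)

lemma ed_id: "fst e \<le> snd e \<Longrightarrow> ed e = e"
  by (simp add: ed_def)

lemma edges_ordered: "e \<in> edges S \<Longrightarrow> fst e \<le> snd e"
  by (auto simp: edges_def ed_def)

lemma finite_edges [simp]: "finite (edges S)"
  by (simp add: edges_def)

lemma edges_append [simp]: "edges (S @ T) = edges S \<union> edges T"
  by (simp add: edges_def image_Un)

lemma edges_map_swap [simp]: "edges (map prod.swap S) = edges S"
  by (simp add: edges_def image_image)

lemma edge_mult_append [simp]: "edge_mult (S @ T) e = edge_mult S e + edge_mult T e"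
  by (simp add: edge_mult_def)

lemma edge_mult_map_swap [simp]: "edge_mult (map prod.swap S) e = edge_mult S e"
  by (simp add: edge_mult_def comp_def)

lemma edge_mult_pos_iff: "0 < edge_mult S e \<longleftrightarrow> e \<in> edges S"
  unfolding edge_mult_def edges_def using count_list_0_iff[of "map ed S" e] by auto

lemma sum_mult: "(\<Sum>e\<in>edges S. edge_mult S e) = length S"
  using sum_count_set[of "map ed S" "edges S"] by (simp add: edge_mult_def edges_def)

lemma edge_mult_eq_count:
  assumes "u \<noteq> v"
  shows "edge_mult S (ed (u, v)) = count_list S (u, v) + count_list S (v, u)"
  by (induction S) (use assms in \<open>auto simp: edge_mult_def ed_eq_iff\<close>)

lemma length_steps [simp]: "length (steps p) = length p - 1"
  by (induction p rule: steps.induct) auto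

lemma set_steps: "(u, v) \<in> set (steps p) \<Longrightarrow> u \<in> set p \<and> v \<in> set p"
  by (induction p rule: steps.induct) auto

lemma steps_append: "steps (p @ [a] @ q) = steps (p @ [a]) @ steps (a # q)"
  by (induction p rule: steps.induct) auto

lemma steps_rev: "steps (rev p) = rev (back_steps p)"
proof (induction p rule: steps.induct)
  case (1 a b r)
  have "steps (rev (a # b # r)) = steps (rev r @ [b] @ [a])" by simp
  also have "\<dots> = steps (rev r @ [b]) @ [(b, a)]" by (subst steps_append) simp
  finally show ?case using 1 by simp
qed auto

lemma steps_map: "steps (map h p) = map (map_prod h h) (steps p)"
  by (induction p rule: steps.induct) auto

text \<open>The end \<open>v\<close> may be new or old, so cycles and loops arise as well. Growing
  by one edge at a time makes \<open>conn_card\<close> immediate: a new vertex brings a new edge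
  with it.\<close>

inductive conn :: "nat set \<Rightarrow> (nat \<times> nat) set \<Rightarrow> bool" where
  conn_singleton: "conn {v} {}"
| conn_step: "conn V E \<Longrightarrow> u \<in> V \<Longrightarrow> conn (insert v V) (insert (ed (u, v)) E)"

lemma conn_walk_from:
  assumes "conn V E" "p \<noteq> []" "hd p \<in> V"
  shows "conn (V \<union> set p) (E \<union> edges (steps p))"
  using assms
proof (induction p arbitrary: V E rule: steps.induct)
  case (1 a b r)
  have "conn (insert b V) (insert (ed (a, b)) E)" using 1 by (auto intro: conn_step)
  then have "conn (insert b V \<union> set (b # r)) (insert (ed (a, b)) E \<union> edges (steps (b # r)))"
    by (rule 1) auto
  moreover have "insert b V \<union> set (b # r) = V \<union> set (a # b # r)" using 1 by auto
  moreover have "insert (ed (a, b)) E \<union> edges (steps (b # r)) = E \<union> edges (steps (a # b # r))"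
    by (auto simp: edges_def)
  ultimately show ?case by simp
qed (auto simp: edges_def insert_absorb)

text \<open>The walk is split at the common vertex \<open>w\<close>; its first half is traversed
  backwards from \<open>w\<close>, which has the same undirected edges, and its second half
  forwards.\<close>

lemma conn_walk_through:
  assumes "conn V E" "w \<in> V" "w \<in> set p"
  shows "conn (V \<union> set p) (E \<union> edges (steps p))"
proof -
  obtain q r where p: "p = q @ [w] @ r" using assms(3) by (auto dest: split_list)
  let ?q = "w # rev q"
  have "conn (V \<union> set ?q) (E \<union> edges (steps ?q))"
    by (rule conn_walk_from) (use assms in auto)
  then have "conn (V \<union> set ?q \<union> set (w # r)) (E \<union> edges (steps ?q) \<union> edges (steps (w # r)))"
    by (rule conn_walk_from) auto
  moreover have "edges (steps ?q) = edges (steps (q @ [w]))"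
    using steps_rev[of "q @ [w]"] by (simp add: edges_def image_image)
  moreover have "edges (steps p) = edges (steps (q @ [w])) \<union> edges (steps (w # r))"
    by (simp only: p steps_append edges_append)
  ultimately show ?thesis using assms p by (simp add: Un_assoc insert_absorb Un_commute Un_left_commute)
qed

lemma conn_walk: "p \<noteq> [] \<Longrightarrow> conn (set p) (edges (steps p))"
  using conn_walk_from[OF conn_singleton, of p "hd p"] by (simp add: insert_absorb)

lemma conn_finite: "conn V E \<Longrightarrow> finite V \<and> finite E"
  by (induction rule: conn.induct) auto

lemma conn_edge_subset: "conn V E \<Longrightarrow> ed (u, v) \<in> E \<Longrightarrow> u \<in> V \<and> v \<in> V"
  by (induction rule: conn.induct) (auto simp: ed_eq_iff)

lemma conn_card: "conn V E \<Longrightarrow> card V \<le> card E + 1"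
proof (induction rule: conn.induct)
  case (conn_step V E u v)
  show ?case
  proof (cases "v \<in> V")
    case True
    then show ?thesis using conn_step conn_finite[of V E] by (simp add: insert_absorb card_insert_if)
  next
    case False
    then have "ed (u, v) \<notin> E" using conn_step conn_edge_subset by blast
    then show ?thesis using False conn_step conn_finite[of V E] by simp
  qed
qed auto

text \<open>
  On a tree every antisymmetric function of directed edges is a gradient. Its sum along a closed
  walk vanishes, so that such a walk crosses each edge equally often in both directions.
\<close>

lemma conn_tree:
  assumes "conn V E" "card V = card E + 1"
  shows conn_tree_no_loop: "ed (u, u) \<notin> E"
    and conn_tree_potential: "(\<And>u v. g u v = - g v u) \<Longrightarrow>
      \<exists>f :: nat \<Rightarrow> int. \<forall>u v. ed (u, v) \<in> E \<longrightarrow> f v - f u = g u v"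
proof -
  have "(\<forall>u. ed (u, u) \<notin> E) \<and> ((\<forall>u v. g u v = - g v u) \<longrightarrow>
      (\<exists>f :: nat \<Rightarrow> int. \<forall>u v. ed (u, v) \<in> E \<longrightarrow> f v - f u = g u v))"
    using assms
  proof (induction rule: conn.induct)
    case (conn_step V E u v)
    have fin: "finite V" "finite E" using conn_finite[OF conn_step.hyps(1)] by auto
    have le: "card V \<le> card E + 1" by (rule conn_card[OF conn_step.hyps(1)])
    show ?case
    proof (cases "v \<in> V")
      case True
      then have "insert v V = V" by auto
      \<comment> \<open>A new edge without a new vertex would violate \<open>conn_card\<close> for
        the smaller graph.\<close>
      then have "ed (u, v) \<in> E"
        using conn_step.prems le fin by (auto simp: card_insert_if split: if_splits)
      then have ins: "insert (ed (u, v)) E = E" by auto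
      have "card V = card E + 1"
        using conn_step.prems by (simp only: ins \<open>insert v V = V\<close>)
      then show ?thesis unfolding ins by (rule conn_step.IH)
    next
      case False
      then have new: "ed (u, v) \<notin> E" using conn_step.hyps conn_edge_subset by blast
      have uv: "u \<noteq> v" using False conn_step.hyps by auto
      have eq: "card V = card E + 1"
        using conn_step.prems unfolding card_insert_disjoint[OF fin(1) False]
          card_insert_disjoint[OF fin(2) new] by linarith
      note IH = conn_step.IH[OF eq]
      have "\<exists>f :: nat \<Rightarrow> int. \<forall>x y. ed (x, y) \<in> insert (ed (u, v)) E \<longrightarrow> f y - f x = g x y"
        if g: "\<forall>u v. g u v = - g v u"
      proof -
        obtain f :: "nat \<Rightarrow> int" where f: "\<forall>x y. ed (x, y) \<in> E \<longrightarrow> f y - f x = g x y"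
          using IH g by blast
        \<comment> \<open>\<open>v\<close> is a leaf, so the single edge from \<open>u\<close>
          prescribes its potential and the old values stay.\<close>
        define f' where "f' = f(v := f u + g u v)"
        have "f' y - f' x = g x y" if "ed (x, y) \<in> insert (ed (u, v)) E" for x y
        proof (cases "ed (x, y) \<in> E")
          case True
          then have "x \<noteq> v" "y \<noteq> v" using conn_edge_subset conn_step.hyps False by blast+
          then show ?thesis using f True by (simp add: f'_def)
        next
          case False
          then have "x = u \<and> y = v \<or> x = v \<and> y = u" using that by (simp add: ed_eq_iff)
          then show ?thesis using uv spec[OF spec[OF g, of u], of v] by (auto simp: f'_def)
        qed
        then show ?thesis by blast
      qed
      moreover have "\<forall>x. ed (x, x) \<notin> insert (ed (u, v)) E"
        using conjunct1[OF IH] uv by (auto simp: ed_eq_iff)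
      ultimately show ?thesis by blast
    qed
  next
    case (conn_singleton v)
    show ?case by blast
  qed
  note * = this
  show "ed (u, u) \<notin> E" using conjunct1[OF *] by blast
  show "\<exists>f :: nat \<Rightarrow> int. \<forall>u v. ed (u, v) \<in> E \<longrightarrow> f v - f u = g u v"
    if "\<And>u v. g u v = - g v u"
    by (rule mp[OF conjunct2[OF *]]) (intro allI that)
qed

lemma sum_list_steps_telescope:
  fixes f :: "'a \<Rightarrow> int"
  shows "p \<noteq> [] \<Longrightarrow> (\<Sum>(u, v)\<leftarrow>steps p. f v - f u) = f (last p) - f (hd p)"
  by (induction p rule: steps.induct) auto

lemma closed_walk_balanced:
  assumes "conn V E" "card V = card E + 1" "p \<noteq> []" "hd p = last p" "edges (steps p) \<subseteq> E"
  shows "count_list (steps p) (a, b) = count_list (steps p) (b, a)"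
proof (cases "a = b")
  case False
  \<comment> \<open>Along a walk \<open>g\<close> adds up to the crossings from \<open>a\<close> to
    \<open>b\<close> minus those from \<open>b\<close> to \<open>a\<close>.\<close>
  define g :: "nat \<Rightarrow> nat \<Rightarrow> int" where
    "g u v = of_bool ((u, v) = (a, b)) - of_bool ((u, v) = (b, a))" for u v
  obtain f :: "nat \<Rightarrow> int" where f: "\<And>u v. ed (u, v) \<in> E \<Longrightarrow> f v - f u = g u v"
  proof -
    have "g u v = - g v u" for u v by (simp add: g_def conj_commute)
    from conn_tree_potential[OF assms(1,2), of g, OF this] show ?thesis using that by blast
  qed
  have "(\<Sum>(u, v)\<leftarrow>steps p. g u v) = (\<Sum>(u, v)\<leftarrow>steps p. f v - f u)"
    by (intro arg_cong[of _ _ sum_list] map_cong refl) (use assms(5) f in \<open>force simp: edges_def\<close>)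
  also have "\<dots> = 0" using sum_list_steps_telescope[OF assms(3), of f] assms(4) by simp
  finally have "(\<Sum>(u, v)\<leftarrow>steps p. g u v) = 0" .
  moreover have "(\<Sum>(u, v)\<leftarrow>S. g u v) = int (count_list S (a, b)) - int (count_list S (b, a))" for S
    by (induction S) (use False in \<open>auto simp: g_def\<close>)
  ultimately show ?thesis by simp
qed simp

text \<open>Parity of the degree of the last vertex. With \<open>f\<close> its indicator, the sum of
  \<open>f\<close> over both ends of all steps is even since each edge is used an even number of
  times; modulo 2 it equals the telescoping sum with value
  \<open>f (last p) - f (hd p)\<close>.\<close>

lemma even_multiplicities_closed:
  assumes "p \<noteq> []" "\<And>e. e \<in> edges (steps p) \<Longrightarrow> even (edge_mult (steps p) e)"
  shows "hd p = last p"
proof -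
  define f :: "nat \<Rightarrow> nat" where "f v = of_bool (v = last p)" for v
  let ?S = "steps p"
  let ?h = "\<lambda>s. f (fst s) + f (snd s)"
  have h_ed: "?h (ed s) = ?h s" for s by (auto simp: ed_def min_def max_def)
  have "(\<Sum>s\<leftarrow>?S. ?h s) = sum_list (map ?h (map ed ?S))"
    by (simp only: map_map comp_def h_ed)
  also have "\<dots> = (\<Sum>e\<in>edges ?S. edge_mult ?S e * ?h e)"
    by (subst sum_list_map_eq_sum_count) (simp add: edges_def edge_mult_def)
  also have "even \<dots>" by (rule dvd_sum) (use assms(2) in auto)
  finally have "even (\<Sum>s\<leftarrow>?S. ?h s)" .
  moreover have "even (\<Sum>s\<leftarrow>S. ?h s) \<longleftrightarrow> even (\<Sum>(u, v)\<leftarrow>S. int (f v) - int (f u))" for S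
    by (induction S) (auto simp: case_prod_beta)
  ultimately have "even (int (f (last p)) - int (f (hd p)))"
    using sum_list_steps_telescope[OF assms(1), of "\<lambda>v. int (f v)"] by simp
  then show ?thesis by (auto simp: f_def)
qed

section \<open>Vertex counts from edge multiplicities\<close>

lemma twice_card_edges_le:
  assumes "\<And>e. e \<in> edges S \<Longrightarrow> edge_mult S e \<noteq> 1"
  shows "2 * card (edges S) \<le> length S"
proof -
  have "2 * card (edges S) = (\<Sum>e\<in>edges S. 2)" by simp
  also have "\<dots> \<le> (\<Sum>e\<in>edges S. edge_mult S e)"
  proof (rule sum_mono)
    fix e assume "e \<in> edges S"
    then show "2 \<le> edge_mult S e" using assms[of e] edge_mult_pos_iff[of S e] by auto
  qed
  finally show ?thesis by (simp add: sum_mult)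
qed

lemma sum_excess:
  assumes "\<And>e. e \<in> edges S \<Longrightarrow> edge_mult S e \<noteq> 1"
  shows "(\<Sum>e\<in>edges S. edge_mult S e - 2) = length S - 2 * card (edges S)"
proof -
  have "2 \<le> edge_mult S e" if "e \<in> edges S" for e using assms[of e] edge_mult_pos_iff[of S e] that by auto
  then have "(\<Sum>e\<in>edges S. edge_mult S e - 2) = (\<Sum>e\<in>edges S. edge_mult S e) - (\<Sum>e\<in>edges S. 2)"
    by (intro sum_subtractf_nat)
  then show ?thesis by (simp add: sum_mult)
qed

text \<open>Two uses per edge are spent in any case; the remaining
  \<open>length S - 2 * card (edges S)\<close> steps are all that is available for higher
  multiplicities.\<close>

lemma edge_mult_le_excess:
  assumes "\<And>e. e \<in> edges S \<Longrightarrow> edge_mult S e \<noteq> 1" "e \<in> edges S"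
  shows "edge_mult S e - 2 \<le> length S - 2 * card (edges S)"
proof -
  have "edge_mult S e - 2 \<le> (\<Sum>e\<in>edges S. edge_mult S e - 2)"
    using assms(2) by (intro member_le_sum) auto
  then show ?thesis using sum_excess[of S] assms(1) by simp
qed

lemma edge_mult_eq_2:
  assumes "\<And>e. e \<in> edges S \<Longrightarrow> edge_mult S e \<noteq> 1" "2 * card (edges S) = length S" "e \<in> edges S"
  shows "edge_mult S e = 2"
proof -
  have "edge_mult S e - 2 \<le> length S - 2 * card (edges S)"
    by (rule edge_mult_le_excess) (use assms in auto)
  then show ?thesis using assms(1)[OF assms(3)] assms(2,3) edge_mult_pos_iff[of S e] by auto
qed

text \<open>The multiplicities for which the assumed moments determine the expectation of the product.\<close>

definition admissible :: "(nat \<times> nat) list \<Rightarrow> bool" where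
  "admissible S \<longleftrightarrow> (\<forall>e\<in>edges S. edge_mult S e = 2 \<or>
     (edge_mult S e = 4 \<and> fst e \<noteq> snd e \<and> count_list S e = count_list S (prod.swap e)))"

text \<open>In a tree there are no loops and a closed walk crosses an edge equally often in both
  directions.\<close>

lemma closed_walk_tree_even:
  assumes "conn V E" "card V = card E + 1" "p \<noteq> []" "hd p = last p" "edges (steps p) \<subseteq> E"
  shows "even (edge_mult (steps p) e)"
proof (cases "e \<in> edges (steps p)")
  case True
  obtain u v where e: "e = ed (u, v)" using True by (force simp: edges_def)
  have "u \<noteq> v" using conn_tree_no_loop[OF assms(1,2), of v] True e assms(5) by auto
  then show ?thesis
    using closed_walk_balanced[OF assms, of u v] by (simp add: e edge_mult_eq_count)
qed (use edge_mult_pos_iff[of "steps p" e] in auto)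

text \<open>Everything rests on card V <= card E + 1 and 2 card E <= number of steps. In 2m + 1
  steps, m + 1 vertices would force a tree, where all multiplicities are even although their sum is
  odd. In 2m steps with at least m vertices, either there are m edges, each used exactly twice, or a
  tree with m - 1 edges. Then the excess is 2, and by evenness one edge has multiplicity 4, crossed
  twice each way.\<close>

lemma closed_walk_card:
  assumes "p \<noteq> []" "hd p = last p" "\<And>e. e \<in> edges (steps p) \<Longrightarrow> edge_mult (steps p) e \<noteq> 1"
  shows closed_walk_card_even: "length p = Suc (2 * m) \<Longrightarrow> card (set p) \<le> m + 1"
    and closed_walk_card_odd: "length p = Suc (2 * m + 1) \<Longrightarrow> card (set p) \<le> m"
    and closed_walk_admissible: "length p = Suc (2 * m) \<Longrightarrow> m \<le> card (set p) \<Longrightarrow> admissible (steps p)"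
proof -
  let ?S = "steps p"
  have c: "conn (set p) (edges ?S)" by (rule conn_walk) fact
  have cV: "card (set p) \<le> card (edges ?S) + 1" by (rule conn_card) fact
  have cE: "2 * card (edges ?S) \<le> length ?S" by (rule twice_card_edges_le) fact
  show "card (set p) \<le> m + 1" if "length p = Suc (2 * m)"
    using that cV cE by simp
  show "card (set p) \<le> m" if l: "length p = Suc (2 * m + 1)"
  proof (rule ccontr)
    assume "\<not> card (set p) \<le> m"
    then have "card (set p) = card (edges ?S) + 1" using cV cE l by simp
    then have "even (\<Sum>e\<in>edges ?S. edge_mult ?S e)"
      by (intro dvd_sum closed_walk_tree_even[OF c _ assms(1,2)]) auto
    then show False using l by (simp add: sum_mult)
  qed
  show "admissible ?S" if l: "length p = Suc (2 * m)" and m: "m \<le> card (set p)"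
  proof (cases "card (edges ?S) = m")
    case True
    then show ?thesis using edge_mult_eq_2[OF assms(3)] l by (auto simp: admissible_def)
  next
    case False
    then have *: "card (set p) = card (edges ?S) + 1" "m = card (edges ?S) + 1"
      using cV cE l m by auto
    show ?thesis unfolding admissible_def
    proof
      fix e assume e: "e \<in> edges ?S"
      have "edge_mult ?S e - 2 \<le> 2" using edge_mult_le_excess[OF assms(3) e] l * by simp
      moreover have "even (edge_mult ?S e)" by (rule closed_walk_tree_even[OF c *(1) assms(1,2)]) simp
      moreover have "edge_mult ?S e > 0" using e edge_mult_pos_iff by blast
      ultimately have "edge_mult ?S e = 2 \<or> edge_mult ?S e = 4" by presburger
      moreover have "fst e \<noteq> snd e"
        using conn_tree_no_loop[OF c *(1), of "fst e"] e by (cases e) (auto simp: ed_def)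
      moreover have "count_list ?S e = count_list ?S (prod.swap e)"
        using closed_walk_balanced[OF c *(1) assms(1,2), of "fst e" "snd e"] by (cases e) simp
      ultimately show "edge_mult ?S e = 2 \<or> (edge_mult ?S e = 4 \<and> fst e \<noteq> snd e \<and>
        count_list ?S e = count_list ?S (prod.swap e))" by blast
    qed
  qed
qed

text \<open>If every edge were used exactly twice, parity would close the walk. So at least one step
  is left over, which lowers the bound 2 card E + 2 on twice the number of vertices to
  \<open>length p\<close>.\<close>

lemma open_walk_card:
  assumes "p \<noteq> []" "hd p \<noteq> last p" "\<And>e. e \<in> edges (steps p) \<Longrightarrow> edge_mult (steps p) e \<noteq> 1"
  shows "2 * card (set p) \<le> length p"
proof -
  let ?S = "steps p"
  have cV: "card (set p) \<le> card (edges ?S) + 1" by (rule conn_card[OF conn_walk]) fact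
  have cE: "2 * card (edges ?S) \<le> length ?S" by (rule twice_card_edges_le) fact
  have "2 * card (edges ?S) \<noteq> length ?S"
  proof
    assume "2 * card (edges ?S) = length ?S"
    then have "even (edge_mult ?S e)" if "e \<in> edges ?S" for e
      using edge_mult_eq_2[OF assms(3)] that by simp
    then show False using even_multiplicities_closed[OF assms(1)] assms(2) by blast
  qed
  then show ?thesis using cV cE by simp
qed

text \<open>The common vertex makes the union connected, with 2k steps in total. For two closed
  walks, k + 1 vertices would mean a tree with every edge used exactly twice; but a shared edge is
  crossed by each walk a positive even number of times, hence at least four times.\<close>

lemma walk_pair_card:
  assumes "length p = Suc k" "length q = Suc k" "set p \<inter> set q \<noteq> {}"
    and "S = steps p @ back_steps q" "\<And>e. e \<in> edges S \<Longrightarrow> edge_mult S e \<noteq> 1"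
  shows "card (set p \<union> set q) \<le> k + 1"
    and "hd p = last p \<Longrightarrow> hd q = last q \<Longrightarrow> edges (steps p) \<inter> edges (steps q) \<noteq> {} \<Longrightarrow>
      card (set p \<union> set q) \<le> k"
proof -
  have ne: "p \<noteq> []" "q \<noteq> []" using assms by auto
  have E: "edges S = edges (steps p) \<union> edges (steps q)" using assms by simp
  obtain w where "w \<in> set p" "w \<in> set q" using assms by auto
  then have c: "conn (set p \<union> set q) (edges S)"
    unfolding E using conn_walk_through conn_walk[OF ne(1)] by blast
  have cE: "2 * card (edges S) \<le> 2 * k"
    using twice_card_edges_le[OF assms(5)] assms by simp
  show le: "card (set p \<union> set q) \<le> k + 1" using conn_card[OF c] cE by simp
  show "card (set p \<union> set q) \<le> k" if cl: "hd p = last p" "hd q = last q"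
    and ne': "edges (steps p) \<inter> edges (steps q) \<noteq> {}"
  proof (rule ccontr)
    obtain e where e: "e \<in> edges (steps p)" "e \<in> edges (steps q)" using ne' by blast
    assume "\<not> card (set p \<union> set q) \<le> k"
    then have *: "card (set p \<union> set q) = card (edges S) + 1" "2 * card (edges S) = length S"
      using conn_card[OF c] cE le assms by auto
    have "edge_mult S e = 2" using edge_mult_eq_2[OF assms(5) *(2)] e E by blast
    moreover have "edge_mult S e = edge_mult (steps p) e + edge_mult (steps q) e" using assms by simp
    moreover have "even (edge_mult (steps p) e)" "even (edge_mult (steps q) e)"
      using closed_walk_tree_even[OF c *(1)] ne cl E by auto
    moreover have "0 < edge_mult (steps p) e" "0 < edge_mult (steps q) e" using e edge_mult_pos_iff by auto
    ultimately show False by (auto elim!: evenE)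
  qed
qed

section \<open>Relabelling and counting walks\<close>

lemma count_list_map_inj_on:
  assumes "inj_on f (insert x (set xs))"
  shows "count_list (map f xs) (f x) = count_list xs x"
  using assms by (induction xs) (auto simp: inj_on_def)

text \<open>
  The arguments of \<open>g\<close> say whether the edge is a loop, how often it is used, and whether it is
  used equally often in both directions. All three are invariant under relabelling the vertices.
\<close>

definition walk_weight :: "(bool \<Rightarrow> nat \<Rightarrow> bool \<Rightarrow> complex) \<Rightarrow> (nat \<times> nat) list \<Rightarrow> complex" where
  "walk_weight g S = (if \<forall>e\<in>edges S. edge_mult S e \<noteq> 1 then
     \<Prod>e\<in>edges S. g (fst e = snd e) (edge_mult S e) (count_list S e = count_list S (prod.swap e)) else 0)"

lemma walk_weight_relabel:
  assumes h: "inj_on h V" and S: "set S \<subseteq> V \<times> V"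
  shows "walk_weight g (map (map_prod h h) S) = walk_weight g S"
proof -
  let ?T = "map (map_prod h h) S"
  define H where "H e = ed (map_prod h h e)" for e
  have ed_H: "ed (map_prod h h s) = H (ed s)" for s
    by (cases s) (auto simp: H_def ed_def min_def max_def)
  have V: "fst e \<in> V" "snd e \<in> V" if "e \<in> edges S" for e
    using that S by (auto simp: edges_def ed_def min_def max_def)
  have inj: "inj_on H (edges S)"
  proof (rule inj_onI)
    fix e e' assume e: "e \<in> edges S" "e' \<in> edges S" "H e = H e'"
    obtain a b c d where *: "e = (a, b)" "e' = (c, d)" by fastforce
    have "a \<in> V" "b \<in> V" "c \<in> V" "d \<in> V" using V[OF e(1)] V[OF e(2)] * by auto
    then have "ed (a, b) = ed (c, d)"
      using e(3) h by (auto simp: * H_def ed_eq_iff inj_on_eq_iff)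
    then show "e = e'" using edges_ordered e(1,2) * by (metis ed_id)
  qed
  have E: "edges ?T = H ` edges S"
    by (simp add: edges_def image_image ed_H)
  have m: "edge_mult ?T (H e) = edge_mult S e" if "e \<in> edges S" for e
  proof -
    have "map ed ?T = map H (map ed S)" by (simp add: ed_H)
    moreover have "inj_on H (insert e (set (map ed S)))"
      by (rule inj_on_subset[OF inj]) (use that in \<open>auto simp: edges_def\<close>)
    ultimately show ?thesis unfolding edge_mult_def by (simp only: count_list_map_inj_on)
  qed
  have l: "fst (H e) = snd (H e) \<longleftrightarrow> fst e = snd e" if "e \<in> edges S" for e
    using inj_on_eq_iff[OF h V[OF that]] by (auto simp: H_def ed_def min_def max_def)
  have c: "count_list ?T (map_prod h h e) = count_list S e" if "fst e \<in> V" "snd e \<in> V" for e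
  proof (rule count_list_map_inj_on)
    have "inj_on (map_prod h h) (V \<times> V)" by (rule map_prod_inj_on[OF h h])
    then show "inj_on (map_prod h h) (insert e (set S))"
      by (rule inj_on_subset) (use that S in \<open>cases e; auto\<close>)
  qed
  have b: "count_list ?T (H e) = count_list ?T (prod.swap (H e)) \<longleftrightarrow>
      count_list S e = count_list S (prod.swap e)" if "e \<in> edges S" for e
  proof -
    \<comment> \<open>Relabelling may reverse the order of the two ends and so exchange the directed
      counts. For this reason the weight records only whether they agree.\<close>
    have "H e = map_prod h h e \<or> H e = map_prod h h (prod.swap e)"
      by (cases e) (auto simp: H_def ed_def min_def max_def)
    moreover have "prod.swap (map_prod h h e) = map_prod h h (prod.swap e)"
      "prod.swap (map_prod h h (prod.swap e)) = map_prod h h e" by (cases e; simp)+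
    moreover have "count_list ?T (map_prod h h (prod.swap e)) = count_list S (prod.swap e)"
      "count_list ?T (map_prod h h e) = count_list S e"
      using V[OF that] by (auto intro!: c)
    ultimately show ?thesis by metis
  qed
  show ?thesis
    unfolding walk_weight_def E
    by (simp add: m l b prod.reindex[OF inj] cong: prod.cong)
qed

text \<open>The walks visit all of \<open>B\<close>, so that sorting closed walks by their vertex
  set is a partition.\<close>

definition closed_walks :: "nat \<Rightarrow> nat set \<Rightarrow> nat \<Rightarrow> nat list set" where
  "closed_walks k B j = {p. length p = Suc k \<and> set p = B \<and> hd p = j \<and> last p = j}"

text \<open>
  Since only the number of vertices matters, the walks through \<open>j\<close> with \<open>b\<close> vertices contribute
  a constant times the number of vertex sets, a polynomial in the dimension.
\<close>

lemma sum_closed_walks_card: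
  assumes "finite B" "j \<in> B"
  shows "(\<Sum>p\<in>closed_walks k B j. walk_weight g (steps p)) =
         (\<Sum>p\<in>closed_walks k {..<card B} 0. walk_weight g (steps p))"
proof -
  have pos: "0 < card B" using assms by (auto simp: card_gt_0_iff)
  have "card (B - {j}) = card ({..<card B} - {0})"
    using assms pos by (simp add: card_Diff_singleton)
  then obtain h0 where h0: "bij_betw h0 (B - {j}) ({..<card B} - {0})"
    using finite_same_card_bij[of "B - {j}" "{..<card B} - {0}"] assms by auto
  define h where "h = h0(j := 0)"
  have hj: "h j = 0" by (simp add: h_def)
  have "bij_betw h (B - {j}) ({..<card B} - {0})"
    by (rule bij_betw_cong[THEN iffD1, OF _ h0]) (auto simp: h_def)
  then have "bij_betw h ((B - {j}) \<union> {j}) (({..<card B} - {0}) \<union> {h j})"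
    by (intro notIn_Un_bij_betw) (auto simp: hj)
  then have h: "bij_betw h B {..<card B}"
    using assms pos by (simp add: hj insert_absorb)
  let ?i = "inv_into B h"
  have ih: "?i (h x) = x" if "x \<in> B" for x using h that by (simp add: bij_betw_def)
  have hi: "h (?i x) = x" if "x < card B" for x
    using h that by (simp add: bij_betw_def f_inv_into_f)
  have img: "h ` B = {..<card B}" "?i ` {..<card B} = B"
    using h bij_betw_inv_into[OF h] by (auto simp: bij_betw_def)
  have bij: "bij_betw (map h) (closed_walks k B j) (closed_walks k {..<card B} 0)"
  proof (rule bij_betw_byWitness[where f' = "map ?i"])
    show "\<forall>p\<in>closed_walks k B j. map ?i (map h p) = p"
      unfolding map_map by (intro ballI map_idI) (simp add: closed_walks_def ih)
    show "\<forall>p\<in>closed_walks k {..<card B} 0. map h (map ?i p) = p"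
      unfolding map_map by (intro ballI map_idI) (simp add: closed_walks_def hi)
    show "map h ` closed_walks k B j \<subseteq> closed_walks k {..<card B} 0"
    proof
      fix q assume "q \<in> map h ` closed_walks k B j"
      then obtain p where p: "q = map h p" "length p = Suc k" "set p = B" "hd p = j" "last p = j"
        by (auto simp: closed_walks_def)
      then have "p \<noteq> []" by auto
      then show "q \<in> closed_walks k {..<card B} 0"
        using p img(1) hj by (simp add: closed_walks_def hd_map last_map)
    qed
    have i0: "?i 0 = j" using ih[OF assms(2)] hj by simp
    show "map ?i ` closed_walks k {..<card B} 0 \<subseteq> closed_walks k B j"
    proof
      fix q assume "q \<in> map ?i ` closed_walks k {..<card B} 0"
      then obtain p where q: "q = map ?i p" and p': "p \<in> closed_walks k {..<card B} 0" by blast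
      then have p: "length p = Suc k" "set p = {..<card B}" "hd p = 0" "last p = 0"
        unfolding closed_walks_def by blast+
      have "p \<noteq> []" using p(1) by auto
      then show "q \<in> closed_walks k B j"
        unfolding closed_walks_def q using p(1,3,4) i0 img(2)
        by (simp add: hd_map last_map p(2))
    qed
  qed
  have "walk_weight g (steps (map h p)) = walk_weight g (steps p)" if "p \<in> closed_walks k B j" for p
    unfolding steps_map using h that
    by (intro walk_weight_relabel[of h B]) (auto simp: bij_betw_def closed_walks_def dest: set_steps)
  then show ?thesis
    using sum.reindex_bij_betw[OF bij, of "\<lambda>p. walk_weight g (steps p)"] by (simp cong: sum.cong)
qed

definition walks :: "nat \<Rightarrow> nat \<Rightarrow> nat list set" where
  "walks N k = {p. set p \<subseteq> {..<N} \<and> length p = Suc k}"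

lemma finite_walks [simp]: "finite (walks N k)"
  by (simp add: walks_def finite_lists_length_eq)

text \<open>The base point \<open>j\<close> belongs to the vertex set; the other
  \<open>b - 1\<close> vertices are chosen among \<open>N - 1\<close>, and every choice contributes
  the same sum by relabelling.\<close>

lemma sum_walks_of_card:
  assumes "j < N" "0 < b"
  shows "(\<Sum>p\<in>{p \<in> walks N k. hd p = j \<and> last p = j \<and> card (set p) = b}. walk_weight g (steps p)) =
    of_nat ((N - 1) choose (b - 1)) * (\<Sum>p\<in>closed_walks k {..<b} 0. walk_weight g (steps p))"
proof -
  let ?G = "\<Sum>p\<in>closed_walks k {..<b} 0. walk_weight g (steps p)"
  let ?P = "{B. B \<subseteq> {..<N} \<and> j \<in> B \<and> card B = b}"
  have fin: "finite ?P" by (rule finite_subset[of _ "Pow {..<N}"]) auto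
  have P: "?P = insert j ` {C. C \<subseteq> {..<N} - {j} \<and> card C = b - 1}"
  proof (intro equalityI subsetI)
    fix B assume B: "B \<in> ?P"
    then have "finite B" using finite_subset by blast
    then have "B = insert j (B - {j})" "card (B - {j}) = b - 1" using B by auto
    then show "B \<in> insert j ` {C. C \<subseteq> {..<N} - {j} \<and> card C = b - 1}" using B by blast
  next
    fix B assume "B \<in> insert j ` {C. C \<subseteq> {..<N} - {j} \<and> card C = b - 1}"
    then obtain C where C: "B = insert j C" "C \<subseteq> {..<N} - {j}" "card C = b - 1" by auto
    then have "finite C" "j \<notin> C" using finite_subset by auto
    then show "B \<in> ?P" using C assms by auto
  qed
  have "inj_on (insert j) {C. C \<subseteq> {..<N} - {j} \<and> card C = b - 1}"
  proof (rule inj_onI)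
    fix C D assume "C \<in> {C. C \<subseteq> {..<N} - {j} \<and> card C = b - 1}"
      "D \<in> {C. C \<subseteq> {..<N} - {j} \<and> card C = b - 1}" "insert j C = insert j D"
    then show "C = D" using insert_ident[of j C D] by blast
  qed
  then have "card ?P = card {C. C \<subseteq> {..<N} - {j} \<and> card C = b - 1}"
    unfolding P by (rule card_image)
  also have "\<dots> = (N - 1) choose (b - 1)" using assms by (subst n_subsets) auto
  finally have cP: "card ?P = (N - 1) choose (b - 1)" .
  have U: "{p \<in> walks N k. hd p = j \<and> last p = j \<and> card (set p) = b} = (\<Union>B\<in>?P. closed_walks k B j)"
  proof (intro equalityI subsetI)
    fix p assume p: "p \<in> {p \<in> walks N k. hd p = j \<and> last p = j \<and> card (set p) = b}"
    then have "hd p \<in> set p" by (intro hd_in_set) (auto simp: walks_def)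
    then show "p \<in> (\<Union>B\<in>?P. closed_walks k B j)"
      using p by (auto simp: walks_def closed_walks_def)
  qed (auto simp: walks_def closed_walks_def)
  have "(\<Sum>p\<in>{p \<in> walks N k. hd p = j \<and> last p = j \<and> card (set p) = b}. walk_weight g (steps p))
      = (\<Sum>B\<in>?P. \<Sum>p\<in>closed_walks k B j. walk_weight g (steps p))"
    unfolding U
  proof (rule sum.UNION_disjoint[OF fin])
    show "\<forall>B\<in>?P. finite (closed_walks k B j)"
    proof
      fix B assume "B \<in> ?P"
      then have "closed_walks k B j \<subseteq> walks N k" by (auto simp: closed_walks_def walks_def)
      then show "finite (closed_walks k B j)" by (rule finite_subset) simp
    qed
  qed (auto simp: closed_walks_def)
  also have "\<dots> = (\<Sum>B\<in>?P. ?G)"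
    by (rule sum.cong[OF refl]) (use sum_closed_walks_card finite_subset in \<open>auto, blast\<close>)
  finally show ?thesis by (simp add: cP)
qed

text \<open>Number of vertex sets to two orders in 1/N. The induction uses that passing from
  \<open>b\<close> to \<open>Suc b\<close> multiplies the quotient by (1 - c/N)/c with c = b +
  1.\<close>

lemma binomial_expansion:
  "\<exists>d D. \<forall>N\<ge>1. \<bar>real ((N - 1) choose b) / real N ^ b - 1 / fact b - d / N\<bar> \<le> D / (real N)\<^sup>2"
proof (induction b)
  case 0
  show ?case by (intro exI[of _ 0]) simp
next
  case (Suc b)
  then obtain d D where *: "\<And>N. N \<ge> 1 \<Longrightarrow>
      \<bar>real ((N - 1) choose b) / real N ^ b - 1 / fact b - d / N\<bar> \<le> D / (real N)\<^sup>2" by blast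
  define c where "c = real (Suc b)"
  have c: "c > 0" by (simp add: c_def)
  \<comment> \<open>The 1/N coefficient of (1/b! + d/N)(1 - c/N)/c. The bound \<open>D'\<close>
    collects the old remainder, its product with c/N, and the term of order N^(-2).\<close>
  define d' where "d' = d / c - 1 / fact b"
  define D' where "D' = (D + (c * D + c * \<bar>d\<bar>)) / c"
  have "\<bar>real ((N - 1) choose Suc b) / real N ^ Suc b - 1 / fact (Suc b) - d' / N\<bar> \<le> D' / (real N)\<^sup>2"
    if N: "N \<ge> 1" for N :: nat
  proof -
    define x where "x = real ((N - 1) choose b) / real N ^ b"
    define r where "r = x - 1 / fact b - d / N"
    have r: "\<bar>r\<bar> \<le> D / (real N)\<^sup>2" using *[OF N] by (simp add: r_def x_def)
    have N0: "real N > 0" using N by simp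
    have "real ((N - 1) choose Suc b) * c = real ((N - 1) choose b) * (real N - c)"
    proof (cases "b \<le> N - 1")
      case True
      have "((N - 1) choose Suc b) * Suc b = ((N - 1) choose b) * (N - 1 - b)"
        by (metis binomial_absorb_comp mult.commute binomial_absorption)
      then have "real ((N - 1) choose Suc b) * c = real ((N - 1) choose b) * real (N - 1 - b)"
        unfolding c_def by (metis of_nat_mult)
      also have "real (N - 1 - b) = real N - c" using True N by (simp add: c_def of_nat_diff)
      finally show ?thesis .
    qed (simp add: binomial_eq_0)
    then have "real ((N - 1) choose Suc b) / real N ^ Suc b = x * (1 - c / N) / c"
      using N0 c by (simp add: x_def field_simps)
    also have "x = r + 1 / fact b + d / N" by (simp add: r_def)
    finally have "real ((N - 1) choose Suc b) / real N ^ Suc b =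
      (r + 1 / fact b + d / N) * (1 - c / N) / c" .
    moreover have "(r + f + d / N) * (1 - c / N) / c - f / c - (d / c - f) / N
        = (r - c * r / N - c * d / (real N)\<^sup>2) / c" for f
      using N0 c by (simp add: field_simps power2_eq_square)
    from this[of "1 / fact b"] have "(r + 1 / fact b + d / N) * (1 - c / N) / c - 1 / fact (Suc b) - d' / N
        = (r - c * r / N - c * d / (real N)\<^sup>2) / c"
      by (simp add: d'_def c_def mult.commute)
    ultimately have eq: "real ((N - 1) choose Suc b) / real N ^ Suc b - 1 / fact (Suc b) - d' / N
        = (r - c * r / N - c * d / (real N)\<^sup>2) / c" by simp
    have 1: "\<bar>c * r / N\<bar> \<le> c * (D / (real N)\<^sup>2)"
    proof -
      have "\<bar>c * r / N\<bar> = c * \<bar>r\<bar> / N" using c N0 by (simp add: abs_mult)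
      also have "\<dots> \<le> c * \<bar>r\<bar> / 1" using N c by (intro divide_left_mono) auto
      also have "\<dots> \<le> c * (D / (real N)\<^sup>2)" unfolding div_by_1 using r c by (intro mult_left_mono) auto
      finally show ?thesis .
    qed
    have 2: "\<bar>c * d / (real N)\<^sup>2\<bar> = c * \<bar>d\<bar> / (real N)\<^sup>2" using c by (simp add: abs_mult)
    have "\<bar>r - c * r / N - c * d / (real N)\<^sup>2\<bar> \<le> D / (real N)\<^sup>2 + c * (D / (real N)\<^sup>2) + c * \<bar>d\<bar> / (real N)\<^sup>2"
      using r 1 2 by linarith
    also have "\<dots> = (D + (c * D + c * \<bar>d\<bar>)) / (real N)\<^sup>2" by (simp add: add_divide_distrib)
    also have "D + (c * D + c * \<bar>d\<bar>) = D' * c" using c by (simp add: D'_def)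
    finally have "\<bar>r - c * r / N - c * d / (real N)\<^sup>2\<bar> / c \<le> D' / (real N)\<^sup>2"
      using c by (simp add: field_simps)
    then show ?thesis unfolding eq using c by simp
  qed
  then show ?case by blast
qed

text \<open>Choose the at most \<open>b - card R\<close> values outside \<open>R\<close>, then a
  word over at most \<open>b\<close> values. Moving \<open>N ^ card R\<close> to the left avoids the
  subtraction in the exponent.\<close>

lemma card_lists_few_values:
  assumes N: "N \<ge> 1"
  shows "card {p. length p = n \<and> set p \<subseteq> {..<N} \<and> R \<subseteq> set p \<and> card (set p) \<le> b} * N ^ card R \<le> b ^ n * N ^ b"
    (is "card ?Q * _ \<le> _")
proof (cases "finite R \<and> card R \<le> b")
  case False
  have empty: "?Q = {}"
  proof -
    have False if "R \<subseteq> set p" "card (set p) \<le> b" for p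
      using that False card_mono[of "set p" R] finite_subset[of R "set p"] by auto
    then show ?thesis by blast
  qed
  show ?thesis by (simp only: empty card.empty)
next
  case True
  let ?Y = "{ys. set ys \<subseteq> {..<N} \<and> length ys = b - card R}"
  let ?P = "\<lambda>ys. {p. set p \<subseteq> R \<union> set ys \<and> length p = n}"
  have "?Q \<subseteq> (\<Union>ys\<in>?Y. ?P ys)"
  proof
    fix p assume "p \<in> ?Q"
    then have p: "length p = n" "set p \<subseteq> {..<N}" "R \<subseteq> set p" "card (set p) \<le> b" by auto
    obtain zs where zs: "set zs = set p - R" "distinct zs"
      using finite_distinct_list[of "set p - R"] by auto
    have "length zs = card (set p - R)" using zs distinct_card by metis
    also have "\<dots> \<le> b - card R" using p True by (simp add: card_Diff_subset)
    finally have l: "length zs \<le> b - card R" .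
    define ys where "ys = zs @ replicate (b - card R - length zs) 0"
    have "ys \<in> ?Y" using l zs p N by (auto simp: ys_def)
    moreover have "p \<in> ?P ys" using zs p by (auto simp: ys_def)
    ultimately show "p \<in> (\<Union>ys\<in>?Y. ?P ys)" by blast
  qed
  then have "card ?Q
      \<le> card (\<Union>ys\<in>?Y. ?P ys)"
    by (rule card_mono[rotated]) (use True in \<open>auto intro!: finite_lists_length_eq\<close>)
  also have "\<dots> \<le> (\<Sum>ys\<in>?Y. card (?P ys))"
    by (rule card_UN_le) (simp add: finite_lists_length_eq)
  also have "\<dots> \<le> (\<Sum>ys\<in>?Y. b ^ n)"
  proof (rule sum_mono)
    fix ys assume ys: "ys \<in> ?Y"
    have "card (R \<union> set ys) \<le> card R + card (set ys)" by (rule card_Un_le)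
    also have "\<dots> \<le> b" using ys card_length[of ys] True by auto
    finally show "card (?P ys) \<le> b ^ n"
      using True by (subst card_lists_length_eq) (auto intro: power_mono)
  qed
  also have "\<dots> = b ^ n * N ^ (b - card R)"
    by (simp add: card_lists_length_eq mult.commute)
  finally have "card ?Q * N ^ card R \<le> b ^ n * N ^ (b - card R) * N ^ card R" by simp
  also have "\<dots> = b ^ n * N ^ b" using True by (simp add: mult.assoc flip: power_add)
  finally show ?thesis .
qed

section \<open>Expectations of products of matrix entries\<close>

definition finite_moments :: "'w measure \<Rightarrow> ('w \<Rightarrow> complex) \<Rightarrow> bool" where
  "finite_moments M f \<longleftrightarrow> f \<in> borel_measurable M \<and> (\<forall>p::nat. integrable M (\<lambda>\<omega>. cmod (f \<omega>) ^ p))"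

lemma finite_moments_measurable: "finite_moments M f \<Longrightarrow> f \<in> borel_measurable M"
  by (simp add: finite_moments_def)

lemma finite_moments_norm_power: "finite_moments M f \<Longrightarrow> integrable M (\<lambda>\<omega>. cmod (f \<omega>) ^ p)"
  by (simp add: finite_moments_def)

lemma finite_moments_integrable:
  assumes "finite_moments M f" shows "integrable M f"
proof -
  have "integrable M (\<lambda>\<omega>. cmod (f \<omega>))"
    using finite_moments_norm_power[OF assms, of 1] by simp
  then show ?thesis
    using finite_moments_measurable[OF assms] integrable_norm_cancel by blast
qed

lemma borel_measurable_cnj: "cnj \<in> borel_measurable borel"
  by (intro borel_measurable_continuous_onI continuous_intros)

lemma finite_moments_cnj: "finite_moments M f \<Longrightarrow> finite_moments M (\<lambda>\<omega>. cnj (f \<omega>))"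
  unfolding finite_moments_def using measurable_compose[OF _ borel_measurable_cnj] by auto

lemma mult_le_sum_squares: "(a::real) * b \<le> a\<^sup>2 + b\<^sup>2"
proof -
  have "2 * (a * b) \<le> a\<^sup>2 + b\<^sup>2" using sum_squares_bound[of a b] by simp
  moreover have "0 \<le> a\<^sup>2 + b\<^sup>2" by simp
  ultimately show ?thesis by linarith
qed

lemma finite_moments_mult:
  assumes "finite_moments M f" "finite_moments M g"
  shows "finite_moments M (\<lambda>\<omega>. f \<omega> * g \<omega>)"
  unfolding finite_moments_def
proof (intro conjI allI)
  have [measurable]: "f \<in> borel_measurable M" "g \<in> borel_measurable M"
    using assms finite_moments_measurable by auto
  show "(\<lambda>\<omega>. f \<omega> * g \<omega>) \<in> borel_measurable M" by measurable
  show "integrable M (\<lambda>\<omega>. cmod (f \<omega> * g \<omega>) ^ p)" for p :: nat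
  proof (rule Bochner_Integration.integrable_bound)
    show "integrable M (\<lambda>\<omega>. cmod (f \<omega>) ^ (p * 2) + cmod (g \<omega>) ^ (p * 2))"
      using assms by (intro Bochner_Integration.integrable_add finite_moments_norm_power)
    show "AE \<omega> in M. norm (cmod (f \<omega> * g \<omega>) ^ p) \<le> norm (cmod (f \<omega>) ^ (p * 2) + cmod (g \<omega>) ^ (p * 2))"
      using mult_le_sum_squares by (auto simp: norm_mult power_mult_distrib power_mult)
  qed measurable
qed

lemma add_power_le:
  fixes a b :: real
  assumes "0 \<le> a" "0 \<le> b"
  shows "(a + b) ^ p \<le> 2 ^ p * (a ^ p + b ^ p)"
proof -
  have "(a + b) ^ p \<le> (2 * max a b) ^ p" using assms by (intro power_mono) auto
  also have "\<dots> = 2 ^ p * (max a b) ^ p" by (simp add: power_mult_distrib)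
  also have "\<dots> \<le> 2 ^ p * (a ^ p + b ^ p)"
    using assms by (intro mult_left_mono) (auto simp: max_def)
  finally show ?thesis .
qed

lemma finite_moments_add:
  assumes "finite_moments M f" "finite_moments M g"
  shows "finite_moments M (\<lambda>\<omega>. f \<omega> + g \<omega>)"
  unfolding finite_moments_def
proof (intro conjI allI)
  have [measurable]: "f \<in> borel_measurable M" "g \<in> borel_measurable M"
    using assms finite_moments_measurable by auto
  show "(\<lambda>\<omega>. f \<omega> + g \<omega>) \<in> borel_measurable M" by measurable
  show "integrable M (\<lambda>\<omega>. cmod (f \<omega> + g \<omega>) ^ p)" for p :: nat
  proof (rule Bochner_Integration.integrable_bound)
    show "integrable M (\<lambda>\<omega>. 2 ^ p * (cmod (f \<omega>) ^ p + cmod (g \<omega>) ^ p))"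
      using assms by (intro integrable_mult_right Bochner_Integration.integrable_add finite_moments_norm_power)
    have "cmod (f \<omega> + g \<omega>) ^ p \<le> 2 ^ p * (cmod (f \<omega>) ^ p + cmod (g \<omega>) ^ p)" for \<omega>
      using add_power_le[of "cmod (f \<omega>)" "cmod (g \<omega>)" p]
        power_mono[OF norm_triangle_ineq[of "f \<omega>" "g \<omega>"], of p] by simp
    then show "AE \<omega> in M. norm (cmod (f \<omega> + g \<omega>) ^ p) \<le> norm (2 ^ p * (cmod (f \<omega>) ^ p + cmod (g \<omega>) ^ p))"
      by (auto intro: order_trans)
  qed measurable
qed

context prob_space begin

lemma finite_moments_const: "finite_moments M (\<lambda>_. c)"
  by (simp add: finite_moments_def)

lemma finite_moments_sum:
  "(\<And>i. i \<in> A \<Longrightarrow> finite_moments M (f i)) \<Longrightarrow> finite_moments M (\<lambda>\<omega>. \<Sum>i\<in>A. f i \<omega>)"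
  by (induction A rule: infinite_finite_induct) (auto intro: finite_moments_const finite_moments_add)

lemma finite_moments_prod_list:
  "(\<And>i. i \<in> set A \<Longrightarrow> finite_moments M (f i)) \<Longrightarrow> finite_moments M (\<lambda>\<omega>. \<Prod>i\<leftarrow>A. f i \<omega>)"
  by (induction A) (auto intro: finite_moments_const finite_moments_mult)

lemma finite_moments_cmult: "finite_moments M f \<Longrightarrow> finite_moments M (\<lambda>\<omega>. c * f \<omega>)"
  by (intro finite_moments_mult finite_moments_const)

lemma finite_moments_diff_const: "finite_moments M f \<Longrightarrow> finite_moments M (\<lambda>\<omega>. f \<omega> - c)"
  using finite_moments_add[OF _ finite_moments_const[of "- c"]] by simp

end

lemma prod_list_group:
  fixes f :: "'a \<Rightarrow> 'b::comm_monoid_mult"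
  assumes "finite A" "g ` set xs \<subseteq> A"
  shows "(\<Prod>x\<leftarrow>xs. f x) = (\<Prod>e\<in>A. \<Prod>x\<leftarrow>filter (\<lambda>x. g x = e) xs. f x)"
  using assms(2)
proof (induction xs)
  case (Cons x xs)
  have "(\<Prod>e\<in>A. \<Prod>x\<leftarrow>filter (\<lambda>x. g x = e) (x # xs). f x) =
      (\<Prod>e\<in>A. (if g x = e then f x else 1) * (\<Prod>x\<leftarrow>filter (\<lambda>x. g x = e) xs. f x))"
    by (rule prod.cong) auto
  also have "\<dots> = f x * (\<Prod>e\<in>A. \<Prod>x\<leftarrow>filter (\<lambda>x. g x = e) xs. f x)"
    using Cons.prems assms(1) by (simp add: prod.distrib prod.delta')
  finally show ?case using Cons by simp
qed simp

lemma length_filter_eq_count_list: "length (filter (\<lambda>x. g x = e) xs) = count_list (map g xs) e"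
  by (induction xs) auto

abbreviation uses :: "nat \<times> nat \<Rightarrow> (nat \<times> nat) list \<Rightarrow> (nat \<times> nat) list" where
  "uses e \<equiv> filter (\<lambda>s. ed s = e)"

text \<open>The product is at most a power of its largest factor. This reduces the mean of a product
  of dependent entries to moments of single entries.\<close>

lemma prod_list_le_sum_power:
  fixes a :: "'a \<Rightarrow> real"
  assumes "\<And>x. x \<in> set xs \<Longrightarrow> 0 \<le> a x" "xs \<noteq> []"
  shows "(\<Prod>x\<leftarrow>xs. a x) \<le> (\<Sum>x\<leftarrow>xs. a x ^ length xs)"
proof -
  define m where "m = Max (a ` set xs)"
  have m: "a x \<le> m" if "x \<in> set xs" for x using that by (auto simp: m_def)
  have "m \<in> a ` set xs" unfolding m_def using assms by (intro Max_in) auto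
  then obtain y where y: "y \<in> set xs" "m = a y" by auto
  have "(\<Prod>x\<leftarrow>ys. a x) \<le> m ^ length ys" if "set ys \<subseteq> set xs" for ys
    using that
  proof (induction ys)
    case (Cons x ys)
    moreover have "0 \<le> (\<Prod>x\<leftarrow>ys. a x)"
      by (rule prod_list_nonneg) (use Cons.prems assms(1) in auto)
    ultimately show ?case
      using m[of x] assms(1) y by (auto intro!: mult_mono)
  qed simp
  then have "(\<Prod>x\<leftarrow>xs. a x) \<le> m ^ length xs" by simp
  also have "\<dots> \<le> (\<Sum>x\<leftarrow>xs. a x ^ length xs)"
  proof (rule member_le_sum_list)
    show "m ^ length xs \<in> set (map (\<lambda>x. a x ^ length xs) xs)" using y by auto
  qed (use assms in auto)
  finally show ?thesis .
qed

locale wigner_ensemble =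
  fixes M :: "nat \<Rightarrow> 'w measure"
    and X :: "nat \<Rightarrow> nat \<Rightarrow> nat \<Rightarrow> 'w \<Rightarrow> complex"
    and s\<^sub>0 \<sigma> \<alpha> :: real and \<beta> :: nat
  assumes prob: "\<And>N. N \<ge> 1 \<Longrightarrow> prob_space (M N)"
    and indep: "\<And>N. N \<ge> 1 \<Longrightarrow>
      prob_space.indep_vars (M N) (\<lambda>_. borel) (\<lambda>(j, k). X N j k) {(j, k). j \<le> k \<and> k < N}"
    and diag_real: "\<And>N j \<omega>. j < N \<Longrightarrow> \<omega> \<in> space (M N) \<Longrightarrow> X N j j \<omega> \<in> \<real>"
    and beta: "\<beta> \<in> {1, 2}"
    and off_diag_real: "\<And>N j k \<omega>. \<beta> = 1 \<Longrightarrow> j < k \<Longrightarrow> k < N \<Longrightarrow> \<omega> \<in> space (M N) \<Longrightarrow> X N j k \<omega> \<in> \<real>"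
    and diag_mean: "\<And>N j. j < N \<Longrightarrow> (\<integral>\<omega>. X N j j \<omega> \<partial>M N) = 0"
    and diag_var: "\<And>N j. j < N \<Longrightarrow> (\<integral>\<omega>. (cmod (X N j j \<omega>))\<^sup>2 \<partial>M N) = s\<^sub>0\<^sup>2"
    and off_diag_mean: "\<And>N j k. j < k \<Longrightarrow> k < N \<Longrightarrow> (\<integral>\<omega>. X N j k \<omega> \<partial>M N) = 0"
    and off_diag_var: "\<And>N j k. j < k \<Longrightarrow> k < N \<Longrightarrow> (\<integral>\<omega>. (cmod (X N j k \<omega>))\<^sup>2 \<partial>M N) = \<sigma>\<^sup>2"
    and off_diag_fourth: "\<And>N j k. j < k \<Longrightarrow> k < N \<Longrightarrow> (\<integral>\<omega>. cmod (X N j k \<omega>) ^ 4 \<partial>M N) = \<alpha>"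
    and off_diag_square: "\<And>N j k. \<beta> = 2 \<Longrightarrow> j < k \<Longrightarrow> k < N \<Longrightarrow> (\<integral>\<omega>. (X N j k \<omega>)\<^sup>2 \<partial>M N) = 0"
    and moments: "\<And>l::nat.
      (SUP N\<in>{1..}. SUP (j, k)\<in>{(j, k). j \<le> k \<and> k < N}.
         \<integral>\<^sup>+\<omega>. ennreal (cmod (X N j k \<omega>) ^ l) \<partial>M N) < \<infinity>"
begin

text \<open>These are the entries of sqrt N times the Wigner matrix; the scaling is kept outside as
  a power of \<open>rsqrt N\<close>.\<close>

definition entry :: "nat \<Rightarrow> 'w \<Rightarrow> nat \<times> nat \<Rightarrow> complex" where
  "entry N \<omega> s = (if fst s \<le> snd s then X N (fst s) (snd s) \<omega> else cnj (X N (snd s) (fst s) \<omega>))"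

definition step_prod :: "nat \<Rightarrow> 'w \<Rightarrow> (nat \<times> nat) list \<Rightarrow> complex" where
  "step_prod N \<omega> S = (\<Prod>s\<leftarrow>S. entry N \<omega> s)"

definition step_mean :: "nat \<Rightarrow> (nat \<times> nat) list \<Rightarrow> complex" where
  "step_mean N S = (\<integral>\<omega>. step_prod N \<omega> S \<partial>M N)"

definition moment_bound :: "nat \<Rightarrow> real" where
  "moment_bound l = enn2real (SUP N\<in>{1..}. SUP (j, k)\<in>{(j, k). j \<le> k \<and> k < N}.
         \<integral>\<^sup>+\<omega>. ennreal (cmod (X N j k \<omega>) ^ l) \<partial>M N)"

lemma X_measurable:
  assumes "j \<le> k" "k < N"
  shows "X N j k \<in> borel_measurable (M N)"
proof -
  interpret prob_space "M N" by (rule prob) (use assms in simp)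
  have "\<forall>i\<in>{(j, k). j \<le> k \<and> k < N}. (case i of (j, k) \<Rightarrow> X N j k) \<in> borel_measurable (M N)"
    using indep[of N] assms unfolding indep_vars_def by simp
  then show ?thesis using assms by auto
qed

lemma X_moment:
  assumes "j \<le> k" "k < N"
  shows X_moment_integrable: "integrable (M N) (\<lambda>\<omega>. cmod (X N j k \<omega>) ^ l)"
    and X_moment_le: "(\<integral>\<omega>. cmod (X N j k \<omega>) ^ l \<partial>M N) \<le> moment_bound l"
proof -
  note [measurable] = X_measurable[OF assms]
  let ?S = "SUP N\<in>{1..}. SUP (j, k)\<in>{(j, k). j \<le> k \<and> k < N}.
         \<integral>\<^sup>+\<omega>. ennreal (cmod (X N j k \<omega>) ^ l) \<partial>M N"
  have le: "(\<integral>\<^sup>+\<omega>. ennreal (cmod (X N j k \<omega>) ^ l) \<partial>M N) \<le> ?S"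
    by (rule SUP_upper2[of N], use assms in simp, rule SUP_upper2[of "(j, k)"]) (use assms in auto)
  have fin: "?S < \<infinity>" by (rule moments)
  show "integrable (M N) (\<lambda>\<omega>. cmod (X N j k \<omega>) ^ l)"
    by (rule integrableI_bounded) (use le fin in \<open>auto simp: norm_power\<close>)
  have "(\<integral>\<omega>. cmod (X N j k \<omega>) ^ l \<partial>M N) = enn2real (\<integral>\<^sup>+\<omega>. ennreal (cmod (X N j k \<omega>) ^ l) \<partial>M N)"
    by (rule integral_eq_nn_integral) auto
  also have "\<dots> \<le> moment_bound l"
    unfolding moment_bound_def using le fin by (intro enn2real_mono) (auto simp: top_unique)
  finally show "(\<integral>\<omega>. cmod (X N j k \<omega>) ^ l \<partial>M N) \<le> moment_bound l" .
qed

lemma finite_moments_X: "j \<le> k \<Longrightarrow> k < N \<Longrightarrow> finite_moments (M N) (X N j k)"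
  by (simp add: finite_moments_def X_measurable X_moment_integrable)

lemma finite_moments_entry:
  assumes "fst s < N" "snd s < N"
  shows "finite_moments (M N) (\<lambda>\<omega>. entry N \<omega> s)"
proof (cases "fst s \<le> snd s")
  case True
  then show ?thesis using finite_moments_X[OF True assms(2)] by (simp add: entry_def)
next
  case False
  then show ?thesis
    using finite_moments_cnj[OF finite_moments_X[of "snd s" "fst s" N]] assms by (simp add: entry_def)
qed

lemma finite_moments_step_prod:
  assumes "N \<ge> 1" "set S \<subseteq> {..<N} \<times> {..<N}"
  shows "finite_moments (M N) (\<lambda>\<omega>. step_prod N \<omega> S)"
proof -
  interpret prob_space "M N" by (rule prob) fact
  show ?thesis unfolding step_prod_def
    by (rule finite_moments_prod_list) (use assms in \<open>auto intro!: finite_moments_entry\<close>)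
qed

lemma cmod_entry_moment_le:
  assumes "fst s < N" "snd s < N"
  shows "(\<integral>\<omega>. cmod (entry N \<omega> s) ^ l \<partial>M N) \<le> moment_bound l"
  using assms X_moment_le[of "fst s" "snd s" N l] X_moment_le[of "snd s" "fst s" N l]
  by (cases "fst s \<le> snd s") (auto simp: entry_def)

text \<open>The bound depends on \<open>S\<close> only through its length and not on
  \<open>N\<close>. The summand 1 covers the empty product.\<close>

lemma step_mean_bounded:
  assumes "N \<ge> 1" "set S \<subseteq> {..<N} \<times> {..<N}"
  shows "cmod (step_mean N S) \<le> 1 + real (length S) * moment_bound (length S)"
proof -
  interpret prob_space "M N" by (rule prob) fact
  have fm: "finite_moments (M N) (\<lambda>\<omega>. entry N \<omega> s)" if "s \<in> set S" for s
    using that assms by (intro finite_moments_entry) auto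
  show ?thesis
  proof (cases "S = []")
    case True
    then show ?thesis by (simp add: step_mean_def step_prod_def prob_space)
  next
    case False
    have "cmod (step_mean N S) \<le> (\<integral>\<omega>. cmod (step_prod N \<omega> S) \<partial>M N)"
      unfolding step_mean_def by simp
    also have "\<dots> \<le> (\<integral>\<omega>. (\<Sum>s\<leftarrow>S. cmod (entry N \<omega> s) ^ length S) \<partial>M N)"
    proof (rule integral_mono)
      show "integrable (M N) (\<lambda>\<omega>. cmod (step_prod N \<omega> S))"
        using finite_moments_integrable[OF finite_moments_step_prod[OF assms]] by simp
      show "integrable (M N) (\<lambda>\<omega>. \<Sum>s\<leftarrow>S. cmod (entry N \<omega> s) ^ length S)"
        unfolding sum_list_sum_nth using fm
        by (auto intro!: Bochner_Integration.integrable_sum finite_moments_norm_power fm[OF nth_mem])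
      fix \<omega>
      have "cmod (step_prod N \<omega> S) = (\<Prod>s\<leftarrow>S. cmod (entry N \<omega> s))"
        unfolding step_prod_def by (induction S) (auto simp: norm_mult)
      then show "cmod (step_prod N \<omega> S) \<le> (\<Sum>s\<leftarrow>S. cmod (entry N \<omega> s) ^ length S)"
        using prod_list_le_sum_power[OF _ False, of "\<lambda>s. cmod (entry N \<omega> s)"] by simp
    qed
    also have "\<dots> = (\<Sum>i<length S. \<integral>\<omega>. cmod (entry N \<omega> (S ! i)) ^ length S \<partial>M N)"
    proof -
      have "(\<Sum>s\<leftarrow>S. cmod (entry N \<omega> s) ^ length S) = (\<Sum>i<length S. cmod (entry N \<omega> (S ! i)) ^ length S)" for \<omega>
        by (simp add: sum_list_sum_nth atLeast0LessThan)
      then show ?thesis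
        by (simp only:) (rule Bochner_Integration.integral_sum, auto intro!: finite_moments_norm_power fm[OF nth_mem])
    qed
    also have "\<dots> \<le> (\<Sum>i<length S. moment_bound (length S))"
    proof (rule sum_mono)
      fix i assume "i \<in> {..<length S}"
      then have "S ! i \<in> {..<N} \<times> {..<N}" using assms nth_mem by blast
      then show "(\<integral>\<omega>. cmod (entry N \<omega> (S ! i)) ^ length S \<partial>M N) \<le> moment_bound (length S)"
        by (intro cmod_entry_moment_le) auto
    qed
    finally show ?thesis by simp
  qed
qed

text \<open>All uses of one edge involve the same variable or its conjugate, so each group of
  factors is a Borel function of a single member of the independent family.\<close>

lemma step_mean_factor:
  assumes "N \<ge> 1" "set S \<subseteq> {..<N} \<times> {..<N}"
  shows "step_mean N S = (\<Prod>e\<in>edges S. step_mean N (uses e S))"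
proof -
  interpret prob_space "M N" by (rule prob) fact
  define g where "g e z = (\<Prod>s\<leftarrow>uses e S. if fst s \<le> snd s then z else cnj z)"
    for e and z :: complex
  have sub: "edges S \<subseteq> {(j, k). j \<le> k \<and> k < N}"
    using assms(2) by (auto simp: edges_def ed_def min_def max_def)
  have g: "g e (X N (fst e) (snd e) \<omega>) = step_prod N \<omega> (uses e S)" for e \<omega>
    unfolding g_def step_prod_def
    by (intro arg_cong[of _ _ prod_list] map_cong refl) (auto simp: entry_def ed_def)
  note [measurable] = borel_measurable_cnj
  have "(\<lambda>z. \<Prod>s\<leftarrow>T. if fst s \<le> snd s then z else cnj z) \<in> borel_measurable borel" for T :: "(nat \<times> nat) list"
    by (induction T) auto
  then have "g e \<in> borel_measurable borel" for e
    unfolding g_def .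
  then have "indep_vars (\<lambda>_. borel) (\<lambda>e \<omega>. g e ((case e of (j, k) \<Rightarrow> X N j k) \<omega>)) (edges S)"
    by (intro indep_vars_compose2[OF indep_vars_subset[OF indep[OF assms(1)] sub]])
  then have iv: "indep_vars (\<lambda>_. borel) (\<lambda>e \<omega>. step_prod N \<omega> (uses e S)) (edges S)"
    by (simp add: case_prod_beta g)
  have "step_prod N \<omega> S = (\<Prod>e\<in>edges S. step_prod N \<omega> (uses e S))" for \<omega>
    unfolding step_prod_def by (rule prod_list_group) (auto simp: edges_def)
  then have "step_mean N S = (\<integral>\<omega>. (\<Prod>e\<in>edges S. step_prod N \<omega> (uses e S)) \<partial>M N)"
    by (simp add: step_mean_def)
  also have "\<dots> = (\<Prod>e\<in>edges S. \<integral>\<omega>. step_prod N \<omega> (uses e S) \<partial>M N)"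
    using assms by (intro indep_vars_lebesgue_integral iv finite_moments_integrable finite_moments_step_prod) auto
  finally show ?thesis by (simp add: step_mean_def)
qed

lemma step_mean_single:
  assumes "fst s < N" "snd s < N"
  shows "step_mean N [s] = 0"
proof -
  have "(\<integral>\<omega>. X N j k \<omega> \<partial>M N) = 0" if "j \<le> k" "k < N" for j k
    using that diag_mean off_diag_mean by (cases "j = k") auto
  then show ?thesis
    using assms by (cases "fst s \<le> snd s") (auto simp: step_mean_def step_prod_def entry_def)
qed

lemma step_mean_eq_0:
  assumes "N \<ge> 1" "set S \<subseteq> {..<N} \<times> {..<N}" "e \<in> edges S" "edge_mult S e = 1"
  shows "step_mean N S = 0"
proof -
  have "length (uses e S) = 1"
    using assms(4) by (simp add: length_filter_eq_count_list edge_mult_def)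
  then obtain s where s: "uses e S = [s]" by (auto simp: length_Suc_conv)
  then have "s \<in> set S" using filter_is_subset[of "\<lambda>s. ed s = e" S] by auto
  then have "step_mean N (uses e S) = 0"
    unfolding s using assms(2) by (intro step_mean_single) auto
  then show ?thesis
    using assms(3) by (subst step_mean_factor[OF assms(1,2)]) auto
qed

lemma step_mean_append:
  assumes "N \<ge> 1" "set S \<subseteq> {..<N} \<times> {..<N}" "set T \<subseteq> {..<N} \<times> {..<N}" "edges S \<inter> edges T = {}"
  shows "step_mean N (S @ T) = step_mean N S * step_mean N T"
proof -
  have "uses e (S @ T) = uses e S" if "e \<in> edges S" for e
    using that assms(4) by (auto simp: edges_def filter_empty_conv)
  moreover have "uses e (S @ T) = uses e T" if "e \<in> edges T" for e
    using that assms(4) by (auto simp: edges_def filter_empty_conv)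
  ultimately show ?thesis
    using assms by (simp add: step_mean_factor[of N "S @ T"] step_mean_factor[of N S]
        step_mean_factor[of N T] prod.union_disjoint del: filter_append cong: prod.cong)
qed

text \<open>On the multiplicities that \<open>admissible\<close> allows, this is the expectation
  carried by an edge. The last alternative is E X^2, for an edge crossed twice in the same
  direction: here the real and the complex case differ.\<close>

definition edge_moment :: "bool \<Rightarrow> nat \<Rightarrow> bool \<Rightarrow> complex" where
  "edge_moment loop m balanced =
     (if loop then s\<^sub>0\<^sup>2 else if m = 4 then \<alpha> else if balanced then \<sigma>\<^sup>2
      else if \<beta> = 1 then \<sigma>\<^sup>2 else 0)"

lemma step_prod_filter:
  assumes "u < v"
  shows "step_prod N \<omega> (filter (\<lambda>s. ed s = (u, v)) S) =
    X N u v \<omega> ^ count_list S (u, v) * cnj (X N u v \<omega>) ^ count_list S (v, u)"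
proof (induction S)
  case (Cons t S)
  have "ed t = (u, v) \<longleftrightarrow> t = (u, v) \<or> t = (v, u)"
    using assms by (cases t) (auto simp: ed_def min_def max_def)
  then show ?case using Cons assms by (auto simp: step_prod_def entry_def)
qed (simp add: step_prod_def)

lemma real_square_mean:
  assumes "\<And>\<omega>. \<omega> \<in> space (M N) \<Longrightarrow> X N u v \<omega> \<in> \<real>"
  shows "(\<integral>\<omega>. (X N u v \<omega>)\<^sup>2 \<partial>M N) = of_real (\<integral>\<omega>. (cmod (X N u v \<omega>))\<^sup>2 \<partial>M N)"
proof -
  have "(X N u v \<omega>)\<^sup>2 = of_real ((cmod (X N u v \<omega>))\<^sup>2)" if "\<omega> \<in> space (M N)" for \<omega>
    using assms[OF that] by (auto elim!: Reals_cases simp: power2_abs simp flip: of_real_power)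
  then show ?thesis
    unfolding integral_complex_of_real[symmetric] by (intro Bochner_Integration.integral_cong refl)
qed

lemma off_diag_square_mean:
  assumes "u < v" "v < N"
  shows "(\<integral>\<omega>. (X N u v \<omega>)\<^sup>2 \<partial>M N) = (if \<beta> = 1 then \<sigma>\<^sup>2 else 0)"
proof (cases "\<beta> = 1")
  case True
  then show ?thesis using real_square_mean[of N u v] off_diag_real assms off_diag_var[OF assms] by simp
next
  case False
  then show ?thesis using off_diag_square[OF _ assms] beta by auto
qed

lemma step_mean_admissible:
  assumes "N \<ge> 1" "set S \<subseteq> {..<N} \<times> {..<N}" "admissible S"
  shows "step_mean N S = walk_weight edge_moment S"
proof -
  have "step_mean N (uses e S) =
      edge_moment (fst e = snd e) (edge_mult S e) (count_list S e = count_list S (prod.swap e))"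
    if e: "e \<in> edges S" for e
  proof -
    obtain u v where uv: "e = (u, v)" by fastforce
    have le: "u \<le> v" using edges_ordered[OF e] uv by simp
    have lt: "v < N" using e assms(2) by (auto simp: uv edges_def ed_def min_def max_def)
    have ad: "edge_mult S e = 2 \<or> (edge_mult S e = 4 \<and> u \<noteq> v \<and> count_list S (u, v) = count_list S (v, u))"
      using assms(3) e uv unfolding admissible_def by auto
    show ?thesis
    proof (cases "u = v")
      case True
      then have "length (uses e S) = 2"
        using ad by (simp add: length_filter_eq_count_list edge_mult_def)
      moreover have "\<forall>s\<in>set (uses e S). s = (v, v)"
        by (auto simp: uv True ed_def min_def max_def split: if_splits)
      ultimately have "uses e S = [(v, v), (v, v)]"
        by (cases "uses e S" rule: remdups_adj.cases) auto
      then have "step_mean N (uses e S) = (\<integral>\<omega>. (X N v v \<omega>)\<^sup>2 \<partial>M N)"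
        by (simp add: step_mean_def step_prod_def entry_def power2_eq_square)
      also have "\<dots> = s\<^sub>0\<^sup>2" using real_square_mean[of N v v] diag_real[OF lt] diag_var[OF lt] by simp
      finally show ?thesis using True uv by (simp add: edge_moment_def)
    next
      case False
      then have uv': "u < v" using le by simp
      define a b where "a = count_list S (u, v)" and "b = count_list S (v, u)"
      have m: "edge_mult S e = a + b"
        using edge_mult_eq_count[OF False, of S] uv le by (simp add: ed_id a_def b_def)
      have mean: "step_mean N (uses e S) = (\<integral>\<omega>. X N u v \<omega> ^ a * cnj (X N u v \<omega>) ^ b \<partial>M N)"
        by (simp add: uv step_mean_def step_prod_filter[OF uv'] a_def b_def)
      have sq: "X N u v \<omega> ^ n * cnj (X N u v \<omega>) ^ n = of_real (cmod (X N u v \<omega>) ^ (2 * n))" for n \<omega>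
        by (simp add: power_mult_distrib[symmetric] complex_norm_square[symmetric] power_mult)
      \<comment> \<open>Multiplicity 4 occurs only balanced, so mixed moments such as that of X^3
        times the conjugate of X, which the assumptions leave open, do not appear.\<close>
      have ab: "a + b = 2 \<or> (a = 2 \<and> b = 2)" using ad m a_def b_def by auto
      then consider "a = 1" "b = 1" | "a = 2" "b = 0" | "a = 0" "b = 2" | "a = 2" "b = 2" by linarith
      then show ?thesis
      proof cases
        case 1
        then show ?thesis
          using m uv' uv mean off_diag_var[OF uv' lt] sq[of _ 1]
          by (simp add: edge_moment_def a_def[symmetric] b_def[symmetric] integral_of_real del: of_real_power)
      next
        case 2
        then show ?thesis
          using m uv' uv mean off_diag_square_mean[OF uv' lt]
          by (simp add: edge_moment_def a_def[symmetric] b_def[symmetric])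
      next
        case 3
        have "(\<integral>\<omega>. cnj ((X N u v \<omega>)\<^sup>2) \<partial>M N) = cnj (if \<beta> = 1 then \<sigma>\<^sup>2 else 0)"
          unfolding Bochner_Integration.integral_cnj off_diag_square_mean[OF uv' lt] ..
        then show ?thesis
          using m uv' uv mean 3
          by (simp add: edge_moment_def a_def[symmetric] b_def[symmetric])
      next
        case 4
        then show ?thesis
          using m uv' uv mean off_diag_fourth[OF uv' lt] sq[of _ 2]
          by (simp add: edge_moment_def a_def[symmetric] b_def[symmetric] integral_of_real del: of_real_power)
      qed
    qed
  qed
  moreover have "\<forall>e\<in>edges S. edge_mult S e \<noteq> 1"
    using assms(3) by (auto simp: admissible_def)
  ultimately show ?thesis
    by (simp add: step_mean_factor[OF assms(1,2)] walk_weight_def cong: prod.cong)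
qed

end

section \<open>Expansion of the diagonal entries of powers\<close>

lemma sum_walks_0: "(\<Sum>p\<in>walks N 0. f p) = (\<Sum>a<N. f [a])"
proof -
  have "walks N 0 = (\<lambda>a. [a]) ` {..<N}" by (auto simp: walks_def length_Suc_conv)
  then show ?thesis by (simp add: sum.reindex inj_on_def)
qed

lemma sum_walks_Suc: "(\<Sum>p\<in>walks N (Suc k). f p) = (\<Sum>a<N. \<Sum>p\<in>walks N k. f (a # p))"
proof -
  have "walks N (Suc k) = (\<lambda>(a, p). a # p) ` ({..<N} \<times> walks N k)"
    by (force simp: walks_def length_Suc_conv)
  then have "(\<Sum>p\<in>walks N (Suc k). f p) = (\<Sum>x\<in>{..<N} \<times> walks N k. f (case x of (a, p) \<Rightarrow> a # p))"
    by (simp add: sum.reindex inj_on_def comp_def case_prod_beta)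
  also have "\<dots> = (\<Sum>a<N. \<Sum>p\<in>walks N k. f (a # p))"
    by (simp add: sum.cartesian_product case_prod_beta)
  finally show ?thesis .
qed

lemma walks_steps: "p \<in> walks N k \<Longrightarrow> set (steps p) \<subseteq> {..<N} \<times> {..<N}"
  by (auto simp: walks_def dest: set_steps)

lemma walks_nonempty: "p \<in> walks N k \<Longrightarrow> p \<noteq> []"
  by (auto simp: walks_def)

abbreviation rsqrt :: "nat \<Rightarrow> complex" where
  "rsqrt N \<equiv> 1 / of_real (sqrt (real N))"

text \<open>\<open>Some j\<close> is the basis vector \<open>e\<^sub>j\<close> and \<open>None\<close> the normalised all-ones vector.\<close>

definition tvec :: "nat \<Rightarrow> nat option \<Rightarrow> nat \<Rightarrow> complex" where
  "tvec N r a = (case r of Some j \<Rightarrow> of_bool (a = j) | None \<Rightarrow> rsqrt N)"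

abbreviation tvec_ends :: "nat \<Rightarrow> nat option \<Rightarrow> nat option \<Rightarrow> nat list \<Rightarrow> complex" where
  "tvec_ends N r v p \<equiv> tvec N r (hd p) * tvec N v (last p)"

lemma cnj_tvec [simp]: "cnj (tvec N r a) = tvec N r a"
  by (simp add: tvec_def split: option.split)

text \<open>Only an inequality, because the basis vector with index \<open>j\<close> vanishes in the
  dimensions \<open>N <= j\<close>.\<close>

lemma sum_tvec_square_le: "(\<Sum>a<N. (cmod (tvec N r a))\<^sup>2) \<le> 1"
proof (cases r)
  case None
  then show ?thesis by (simp add: tvec_def norm_divide power_divide)
next
  case (Some j)
  have "(\<Sum>a<N. (cmod (tvec N r a))\<^sup>2) = (\<Sum>a<N. if a = j then 1 else 0)"
    by (rule sum.cong) (auto simp: tvec_def Some)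
  then show ?thesis by simp
qed

context wigner_ensemble begin

text \<open>With at least \<open>m\<close> vertices the mean depends only on the shape of the walk:
  either some edge is used once and both sides vanish, or the walk is admissible.\<close>

lemma step_mean_eq_walk_weight:
  assumes "N \<ge> 1" "p \<in> walks N (2 * m)" "hd p = last p" "m \<le> card (set p)"
  shows "step_mean N (steps p) = walk_weight edge_moment (steps p)"
proof (cases "\<forall>e\<in>edges (steps p). edge_mult (steps p) e \<noteq> 1")
  case True
  have "admissible (steps p)"
    using closed_walk_admissible[of p m] True assms walks_nonempty[OF assms(2)] by (auto simp: walks_def)
  then show ?thesis using assms walks_steps by (intro step_mean_admissible)
next
  case False
  then show ?thesis using step_mean_eq_0[OF assms(1) walks_steps[OF assms(2)]]
    by (auto simp: walk_weight_def)
qed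

text \<open>Contributing walks have uniformly bounded means and are counted by
  \<open>card_lists_few_values\<close>; each prescribed vertex in \<open>R\<close> saves a factor
  N.\<close>

lemma sum_step_mean_le:
  assumes "N \<ge> 1" "P \<subseteq> walks N k"
    and "\<And>p. p \<in> P \<Longrightarrow> step_mean N (steps p) \<noteq> 0 \<Longrightarrow> R \<subseteq> set p \<and> card (set p) \<le> b"
  shows "cmod (\<Sum>p\<in>P. step_mean N (steps p)) * real N ^ card R
    \<le> (1 + real k * moment_bound k) * real b ^ Suc k * real N ^ b"
proof -
  let ?Q = "{p. length p = Suc k \<and> set p \<subseteq> {..<N} \<and> R \<subseteq> set p \<and> card (set p) \<le> b}"
  let ?C = "1 + real k * moment_bound k"
  have C: "0 \<le> ?C" unfolding moment_bound_def by simp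
  have fin: "finite P" using assms(2) finite_walks by (rule finite_subset)
  have "cmod (\<Sum>p\<in>P. step_mean N (steps p)) = cmod (\<Sum>p\<in>P \<inter> ?Q. step_mean N (steps p))"
    using assms(2,3) by (intro arg_cong[of _ _ cmod] sum.mono_neutral_right fin) (auto simp: walks_def)
  also have "\<dots> \<le> (\<Sum>p\<in>P \<inter> ?Q. ?C)"
  proof (rule sum_norm_le)
    fix p assume "p \<in> P \<inter> ?Q"
    then have p: "p \<in> walks N k" using assms(2) by auto
    have "length (steps p) = k" using p by (simp add: walks_def)
    then show "cmod (step_mean N (steps p)) \<le> ?C"
      using step_mean_bounded[OF assms(1) walks_steps[OF p]] by simp
  qed
  also have "\<dots> = ?C * real (card (P \<inter> ?Q))" by simp
  also have "\<dots> \<le> ?C * real (card ?Q)"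
  proof -
    have "finite ?Q" by (rule finite_subset[OF _ finite_walks[of N k]]) (auto simp: walks_def)
    then show ?thesis using C by (intro mult_left_mono) (auto intro: card_mono)
  qed
  finally have "cmod (\<Sum>p\<in>P. step_mean N (steps p)) * real N ^ card R \<le> ?C * (real (card ?Q) * real N ^ card R)"
    by (simp add: mult_right_mono flip: mult.assoc)
  also have "real (card ?Q) * real N ^ card R \<le> real b ^ Suc k * real N ^ b"
    using card_lists_few_values[OF assms(1), of "Suc k" R b]
    unfolding of_nat_mult[symmetric] of_nat_power[symmetric] of_nat_le_iff .
  then have "?C * (real (card ?Q) * real N ^ card R) \<le> ?C * (real b ^ Suc k * real N ^ b)"
    using C by (rule mult_left_mono)
  finally show ?thesis by (simp add: mult.assoc)
qed

text \<open>The mean of the diagonal entry \<open>(j, j)\<close> of the \<open>k\<close>-th power of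
  the Wigner matrix, cf. \<open>mean_wform_diag\<close>.\<close>

definition closed_mean :: "nat \<Rightarrow> nat \<Rightarrow> nat \<Rightarrow> complex" where
  "closed_mean N k j = (rsqrt N) ^ k *
     (\<Sum>p\<in>{p \<in> walks N k. hd p = j \<and> last p = j}. step_mean N (steps p))"

abbreviation closed_average :: "nat \<Rightarrow> nat \<Rightarrow> complex" where
  "closed_average N k \<equiv> 1 / of_nat N * (\<Sum>j<N. closed_mean N k j)"

lemma inverse_sqrt_power_even: "(rsqrt N) ^ (2 * m) = 1 / of_real (real N ^ m)"
proof -
  have "(complex_of_real (sqrt (real N)))\<^sup>2 = of_nat N" by (simp flip: of_real_power)
  then show ?thesis by (simp add: power_mult power_divide)
qed

text \<open>A contributing walk has at most m vertices, one of them fixed: at most of order N^(m -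
  1) walks against the factor N^(-m - 1/2).\<close>

lemma closed_mean_odd:
  assumes N: "N \<ge> 1"
  shows "cmod (closed_mean N (2 * m + 1) j) \<le>
    ((1 + real (2 * m + 1) * moment_bound (2 * m + 1)) * real m ^ Suc (2 * m + 1)) / (real N * sqrt (real N))"
    (is "_ \<le> ?C / _")
proof -
  let ?k = "2 * m + 1"
  let ?P = "{p \<in> walks N ?k. hd p = j \<and> last p = j}"
  have "cmod (\<Sum>p\<in>?P. step_mean N (steps p)) * real N ^ card {j} \<le> ?C * real N ^ m"
  proof (rule sum_step_mean_le[OF N])
    fix p assume p: "p \<in> ?P" "step_mean N (steps p) \<noteq> 0"
    then have "\<And>e. e \<in> edges (steps p) \<Longrightarrow> edge_mult (steps p) e \<noteq> 1"
      using step_mean_eq_0[OF N walks_steps[of p N ?k]] by auto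
    then have "card (set p) \<le> m"
      using p by (intro closed_walk_card_odd) (auto simp: walks_def)
    moreover have "j \<in> set p" using p walks_nonempty[of p N ?k] hd_in_set[of p] by auto
    ultimately show "{j} \<subseteq> set p \<and> card (set p) \<le> m" by simp
  qed auto
  then have *: "cmod (\<Sum>p\<in>?P. step_mean N (steps p)) * real N \<le> ?C * real N ^ m" by simp
  have "cmod (closed_mean N ?k j) = cmod (\<Sum>p\<in>?P. step_mean N (steps p)) / (sqrt (real N) ^ ?k)"
    using N by (simp add: closed_mean_def norm_mult norm_divide norm_power power_divide)
  also have "\<dots> = cmod (\<Sum>p\<in>?P. step_mean N (steps p)) * real N / (real N ^ m * (real N * sqrt (real N)))"
    using N by (simp add: power_mult)
  also have "\<dots> \<le> ?C * real N ^ m / (real N ^ m * (real N * sqrt (real N)))"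
    using * N by (intro divide_right_mono) auto
  also have "\<dots> = ?C / (real N * sqrt (real N))" using N by simp
  finally show ?thesis .
qed

text \<open>Walks with m + 1 and with m vertices produce the orders 1 and 1/N. All other
  contributing walks have at most m - 1 vertices, one of them fixed, and are of order N^(m - 2) in
  number against \<open>N ^ m\<close>.\<close>

lemma closed_mean_even:
  assumes m: "m \<ge> 1"
  shows "\<exists>a b C. \<forall>N\<ge>1. \<forall>j<N. cmod (closed_mean N (2 * m) j - a - b / of_nat N) \<le> C / (real N)\<^sup>2"
proof -
  let ?k = "2 * m"
  define G where "G b = (\<Sum>p\<in>closed_walks ?k {..<b} 0. walk_weight edge_moment (steps p))" for b
  obtain d1 D1 where 1: "\<And>N. N \<ge> 1 \<Longrightarrow>
      \<bar>real ((N - 1) choose m) / real N ^ m - 1 / fact m - d1 / N\<bar> \<le> D1 / (real N)\<^sup>2"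
    using binomial_expansion[of m] by blast
  obtain d2 D2 where 2: "\<And>N. N \<ge> 1 \<Longrightarrow>
      \<bar>real ((N - 1) choose (m - 1)) / real N ^ (m - 1) - 1 / fact (m - 1) - d2 / N\<bar> \<le> D2 / (real N)\<^sup>2"
    using binomial_expansion[of "m - 1"] by blast
  define K where "K = (1 + real ?k * moment_bound ?k) * real (m - 1) ^ Suc ?k"
  have K: "K \<ge> 0" unfolding K_def moment_bound_def by simp
  \<comment> \<open>\<open>1 / fact m\<close> is the limit of the number of vertex choices over
    \<open>N ^ m\<close>. The order 1/N has two sources: the correction \<open>d1\<close> for walks
    with m + 1 vertices, and walks with m vertices at leading order.\<close>
  define a where "a = G (m + 1) * of_real (1 / fact m)"
  define b where "b = G (m + 1) * of_real d1 + G m * of_real (1 / fact (m - 1))"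
  define C where "C = cmod (G (m + 1)) * D1 + cmod (G m) * (\<bar>d2\<bar> + D2) + K"
  have "cmod (closed_mean N ?k j - a - b / of_nat N) \<le> C / (real N)\<^sup>2" if N: "N \<ge> 1" and j: "j < N" for N j
  proof -
    let ?P = "{p \<in> walks N ?k. hd p = j \<and> last p = j}"
    let ?Pc = "\<lambda>b. {p \<in> walks N ?k. hd p = j \<and> last p = j \<and> card (set p) = b}"
    let ?R = "{p \<in> ?P. card (set p) \<noteq> m \<and> card (set p) \<noteq> m + 1}"
    define R where "R = (\<Sum>p\<in>?R. step_mean N (steps p))"
    have fin: "finite ?P" by simp
    have "(\<Sum>p\<in>?P. step_mean N (steps p)) =
        (\<Sum>p\<in>?Pc (m + 1) \<union> ?Pc m \<union> ?R. step_mean N (steps p))"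
      by (rule sum.cong) auto
    also have "\<dots> = (\<Sum>p\<in>?Pc (m + 1). step_mean N (steps p)) + (\<Sum>p\<in>?Pc m. step_mean N (steps p)) + R"
      unfolding R_def by (subst sum.union_disjoint; (subst sum.union_disjoint)?; auto)
    also have "(\<Sum>p\<in>?Pc (m + 1). step_mean N (steps p)) = (\<Sum>p\<in>?Pc (m + 1). walk_weight edge_moment (steps p))"
      using N by (intro sum.cong refl step_mean_eq_walk_weight) auto
    also have "\<dots> = of_nat ((N - 1) choose m) * G (m + 1)"
      unfolding G_def using sum_walks_of_card[OF j, where b = "m + 1" and k = "?k" and g = edge_moment] by simp
    also have "(\<Sum>p\<in>?Pc m. step_mean N (steps p)) = (\<Sum>p\<in>?Pc m. walk_weight edge_moment (steps p))"
      using N by (intro sum.cong refl step_mean_eq_walk_weight) auto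
    also have "\<dots> = of_nat ((N - 1) choose (m - 1)) * G m"
      unfolding G_def using sum_walks_of_card[OF j, where b = m and k = "?k" and g = edge_moment] m by simp
    finally have sum: "(\<Sum>p\<in>?P. step_mean N (steps p)) =
      of_nat ((N - 1) choose m) * G (m + 1) + of_nat ((N - 1) choose (m - 1)) * G m + R" .
    have "cmod R * real N ^ card {j} \<le> K * real N ^ (m - 1)"
      unfolding R_def K_def
    proof (rule sum_step_mean_le[OF N])
      fix p assume p: "p \<in> ?R" "step_mean N (steps p) \<noteq> 0"
      then have "\<And>e. e \<in> edges (steps p) \<Longrightarrow> edge_mult (steps p) e \<noteq> 1"
        using step_mean_eq_0[OF N walks_steps[of p N ?k]] by auto
      then have "card (set p) \<le> m + 1"
        using p by (intro closed_walk_card_even) (auto simp: walks_def)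
      moreover have "j \<in> set p" using p walks_nonempty[of p N ?k] hd_in_set[of p] by auto
      ultimately show "{j} \<subseteq> set p \<and> card (set p) \<le> m - 1" using p by auto
    qed auto
    then have "cmod R * real N * real N \<le> K * real N ^ (m - 1) * real N"
      by (intro mult_right_mono) auto
    also have "\<dots> = K * real N ^ m" using m by (cases m) auto
    finally have R: "cmod (R / of_real (real N ^ m)) \<le> K / (real N)\<^sup>2"
      using N by (simp add: norm_divide norm_power field_simps power2_eq_square)
    define x1 where "x1 = real ((N - 1) choose m) / real N ^ m"
    define x2 where "x2 = real ((N - 1) choose (m - 1)) / real N ^ (m - 1)"
    have x2: "real ((N - 1) choose (m - 1)) / real N ^ m = x2 / N"
      using m N by (cases m) (auto simp: x2_def)
    have "closed_mean N ?k j = G (m + 1) * of_real x1 + G m * of_real (x2 / N) + R / of_real (real N ^ m)"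
      unfolding closed_mean_def inverse_sqrt_power_even sum x2[symmetric] x1_def
      by (simp add: add_divide_distrib mult.commute)
    then have "closed_mean N ?k j - a - b / of_nat N = G (m + 1) * of_real (x1 - 1 / fact m - d1 / N)
        + G m * of_real ((x2 - 1 / fact (m - 1)) / N) + R / of_real (real N ^ m)"
      by (simp add: a_def b_def algebra_simps add_divide_distrib diff_divide_distrib)
    also have "cmod \<dots> \<le> cmod (G (m + 1)) * \<bar>x1 - 1 / fact m - d1 / N\<bar>
        + cmod (G m) * \<bar>(x2 - 1 / fact (m - 1)) / N\<bar> + cmod (R / of_real (real N ^ m))"
      by (intro norm_triangle_le add_mono) (auto simp only: norm_mult norm_of_real)
    also have "\<dots> \<le> cmod (G (m + 1)) * (D1 / (real N)\<^sup>2)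
        + cmod (G m) * ((\<bar>d2\<bar> + D2) / (real N)\<^sup>2) + K / (real N)\<^sup>2"
    proof (intro add_mono mult_left_mono R)
      show "\<bar>x1 - 1 / fact m - d1 / N\<bar> \<le> D1 / (real N)\<^sup>2" unfolding x1_def by (rule 1[OF N])
      have "\<bar>x2 - 1 / fact (m - 1) - d2 / N\<bar> \<le> D2 / (real N)\<^sup>2" unfolding x2_def by (rule 2[OF N])
      moreover have "0 \<le> D2 / (real N)\<^sup>2" using calculation by linarith
      then have "0 \<le> D2" using N by (simp add: zero_le_divide_iff)
      then have "D2 / (real N)\<^sup>2 \<le> D2 / N" using N by (intro divide_left_mono) (auto simp: power2_eq_square)
      moreover have "\<bar>d2 / N\<bar> = \<bar>d2\<bar> / N" by simp
      ultimately have "\<bar>x2 - 1 / fact (m - 1)\<bar> \<le> \<bar>d2\<bar> / N + D2 / N" by linarith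
      then have "\<bar>x2 - 1 / fact (m - 1)\<bar> / N \<le> (\<bar>d2\<bar> / N + D2 / N) / N" by (rule divide_right_mono) simp
      then show "\<bar>(x2 - 1 / fact (m - 1)) / N\<bar> \<le> (\<bar>d2\<bar> + D2) / (real N)\<^sup>2"
        by (simp add: power2_eq_square add_divide_distrib)
    qed auto
    also have "\<dots> = C / (real N)\<^sup>2"
      by (simp only: C_def add_divide_distrib times_divide_eq_right distrib_left)
    finally show ?thesis .
  qed
  then show ?thesis by blast
qed

text \<open>The error N^(-3/2) is dictated by odd powers. It is uniform in \<open>j\<close>, so the
  sum over all N diagonal entries still has an error of order N^(-1/2).\<close>

lemma closed_mean_expansion:
  "\<exists>a b C. \<forall>N\<ge>1. \<forall>j<N. cmod (closed_mean N k j - a - b / of_nat N) \<le> C / (real N * sqrt (real N))"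
proof (cases "even k")
  case False
  then obtain m where k: "k = 2 * m + 1" by (auto elim: oddE)
  have "cmod (closed_mean N k j - 0 - 0 / of_nat N) \<le>
    ((1 + real (2 * m + 1) * moment_bound (2 * m + 1)) * real m ^ Suc (2 * m + 1)) / (real N * sqrt (real N))"
    if "N \<ge> 1" for N j
    using closed_mean_odd[OF that, of m j] unfolding k by simp
  then show ?thesis by blast
next
  case True
  then obtain m where k: "k = 2 * m" by auto
  show ?thesis
  proof (cases "m = 0")
    case True
    have "cmod (closed_mean N k j - 1 - 0 / of_nat N) \<le> 0 / (real N * sqrt (real N))" if "N \<ge> 1" "j < N" for N j
    proof -
      interpret prob_space "M N" by (rule prob) fact
      have "{p \<in> walks N k. hd p = j \<and> last p = j} = {[j]}"
        using that k True by (auto simp: walks_def length_Suc_conv)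
      then show ?thesis using k True by (simp add: closed_mean_def step_mean_def step_prod_def prob_space)
    qed
    then show ?thesis by blast
  next
    case False
    then have "m \<ge> 1" by simp
    from closed_mean_even[OF this, folded k]
    obtain a b C where *: "\<And>N j. N \<ge> 1 \<Longrightarrow> j < N \<Longrightarrow>
        cmod (closed_mean N k j - a - b / of_nat N) \<le> C / (real N)\<^sup>2"
      by blast
    have "cmod (closed_mean N k j - a - b / of_nat N) \<le> \<bar>C\<bar> / (real N * sqrt (real N))"
      if N: "N \<ge> 1" "j < N" for N j
    proof -
      have "sqrt (real N) \<le> real N" using N by (intro real_le_lsqrt) (auto simp: power2_eq_square)
      then have le: "real N * sqrt (real N) \<le> (real N)\<^sup>2" by (simp add: power2_eq_square mult_left_mono)
      have "C / (real N)\<^sup>2 \<le> \<bar>C\<bar> / (real N)\<^sup>2" by (intro divide_right_mono) auto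
      also have "\<dots> \<le> \<bar>C\<bar> / (real N * sqrt (real N))" using le N by (intro divide_left_mono) auto
      finally show ?thesis using *[OF N] by linarith
    qed
    then show ?thesis by blast
  qed
qed

definition is_expansion :: "nat \<Rightarrow> complex \<Rightarrow> complex \<Rightarrow> bool" where
  "is_expansion k a b \<longleftrightarrow> (\<exists>C. \<forall>N\<ge>1. \<forall>j<N.
     cmod (closed_mean N k j - a - b / of_nat N) \<le> C / (real N * sqrt (real N)))"

text \<open>The coefficients are picked from the existence statement
  \<open>closed_mean_expansion\<close>; only their values at \<open>k = 0\<close> are computed
  later.\<close>

definition lim_moment :: "nat \<Rightarrow> complex" where
  "lim_moment k = (SOME a. \<exists>b. is_expansion k a b)"

text \<open>Chosen for the fixed \<open>lim_moment k\<close>, so that both coefficients belong to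
  one common expansion.\<close>

definition inf_moment :: "nat \<Rightarrow> complex" where
  "inf_moment k = (SOME b. is_expansion k (lim_moment k) b)"

lemma is_expansion_moments: "is_expansion k (lim_moment k) (inf_moment k)"
proof -
  have "\<exists>a b. is_expansion k a b" unfolding is_expansion_def using closed_mean_expansion by blast
  then have "\<exists>b. is_expansion k (lim_moment k) b" unfolding lim_moment_def by (rule someI_ex)
  then show ?thesis unfolding inf_moment_def by (rule someI_ex)
qed

lemma closed_mean_tendsto:
  shows "(\<lambda>N. closed_mean N k j) \<longlonglongrightarrow> lim_moment k"
    and closed_mean_average_expansion:
      "(\<lambda>N. of_nat N * (closed_average N k - lim_moment k)) \<longlonglongrightarrow> inf_moment k"
    and closed_mean_average_tendsto:
      "(\<lambda>N. closed_average N k) \<longlonglongrightarrow> lim_moment k"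
proof -
  obtain C where C: "\<And>N j. N \<ge> 1 \<Longrightarrow> j < N \<Longrightarrow>
      cmod (closed_mean N k j - lim_moment k - inf_moment k / of_nat N) \<le> C / (real N * sqrt (real N))"
    using is_expansion_moments[of k] unfolding is_expansion_def by blast
  have t1: "(\<lambda>N. C / (real N * sqrt (real N))) \<longlonglongrightarrow> 0" by real_asymp
  have t2: "(\<lambda>N. C / sqrt (real N)) \<longlonglongrightarrow> 0" by real_asymp
  have t3: "(\<lambda>N. inf_moment k / of_nat N) \<longlonglongrightarrow> 0" by (rule lim_const_over_n)
  have "(\<lambda>N. closed_mean N k j - lim_moment k - inf_moment k / of_nat N) \<longlonglongrightarrow> 0"
    by (rule Lim_null_comparison[OF _ t1]) (use C[of _ j] in \<open>auto intro!: eventually_sequentiallyI[of "Suc j"]\<close>)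
  from tendsto_add[OF this tendsto_add[OF tendsto_const[of "lim_moment k"] t3]]
  show "(\<lambda>N. closed_mean N k j) \<longlonglongrightarrow> lim_moment k" by simp
  have bound: "cmod (of_nat N * (closed_average N k - lim_moment k) - inf_moment k)
      \<le> C / sqrt (real N)" if N: "N \<ge> 1" for N
  proof -
    \<comment> \<open>The deviation of the average, magnified by N, is the sum of the N remainders
      of the diagonal entries.\<close>
    have eq: "of_nat N * (closed_average N k - lim_moment k) - inf_moment k =
      (\<Sum>j<N. closed_mean N k j - lim_moment k - inf_moment k / of_nat N)"
      using N by (simp add: sum_subtractf right_diff_distrib)
    have "cmod (of_nat N * (closed_average N k - lim_moment k) - inf_moment k)
        \<le> (\<Sum>j<N. C / (real N * sqrt (real N)))"
      unfolding eq by (rule sum_norm_le) (use C N in auto)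
    also have "\<dots> = C / sqrt (real N)" using N by simp
    finally show ?thesis .
  qed
  have "(\<lambda>N. of_nat N * (closed_average N k - lim_moment k) - inf_moment k) \<longlonglongrightarrow> 0"
    by (rule Lim_null_comparison[OF _ t2]) (use bound in \<open>auto intro!: eventually_sequentiallyI[of 1]\<close>)
  then show *: "(\<lambda>N. of_nat N * (closed_average N k - lim_moment k)) \<longlonglongrightarrow> inf_moment k"
    by (simp add: LIM_zero_iff)
  have "(\<lambda>N. 1 / of_nat N * (of_nat N * (closed_average N k - lim_moment k))) \<longlonglongrightarrow> 0 * inf_moment k"
    by (intro tendsto_mult * lim_const_over_n)
  then have **: "(\<lambda>N. 1 / of_nat N * (of_nat N * (closed_average N k - lim_moment k))) \<longlonglongrightarrow> 0"
    by simp
  have "(\<lambda>N. closed_average N k - lim_moment k) \<longlonglongrightarrow> 0"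
    by (rule Lim_transform_eventually[OF **], rule eventually_sequentiallyI[of 1]) simp
  then show "(\<lambda>N. closed_average N k) \<longlonglongrightarrow> lim_moment k"
    by (simp add: LIM_zero_iff)
qed

text \<open>The off-diagonal part of the form of the normalised all-ones vector. Contributing open
  walks have at most (k + 1)/2 vertices, so the sum is of order N^((k + 1)/2) against N^(1 +
  k/2).\<close>

lemma open_mean_tendsto:
  "(\<lambda>N. 1 / of_nat N * (rsqrt N) ^ k *
     (\<Sum>p\<in>{p \<in> walks N k. hd p \<noteq> last p}. step_mean N (steps p))) \<longlonglongrightarrow> 0"
proof -
  define b where "b = Suc k div 2"
  define K where "K = (1 + real k * moment_bound k) * real b ^ Suc k"
  have K: "K \<ge> 0" unfolding K_def moment_bound_def by simp
  have t: "(\<lambda>N. K / sqrt (real N)) \<longlonglongrightarrow> 0" by real_asymp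
  have "cmod (1 / of_nat N * (rsqrt N) ^ k *
     (\<Sum>p\<in>{p \<in> walks N k. hd p \<noteq> last p}. step_mean N (steps p))) \<le> K / sqrt (real N)" if N: "N \<ge> 1" for N
  proof -
    let ?P = "{p \<in> walks N k. hd p \<noteq> last p}"
    let ?r = "sqrt (real N)"
    have r: "?r \<ge> 1" "?r * ?r = real N" using N by auto
    have "cmod (\<Sum>p\<in>?P. step_mean N (steps p)) * real N ^ card ({} :: nat set) \<le> K * real N ^ b"
      unfolding K_def
    proof (rule sum_step_mean_le[OF N])
      fix p assume p: "p \<in> ?P" "step_mean N (steps p) \<noteq> 0"
      then have "\<And>e. e \<in> edges (steps p) \<Longrightarrow> edge_mult (steps p) e \<noteq> 1"
        using step_mean_eq_0[OF N walks_steps[of p N k]] by auto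
      then have "2 * card (set p) \<le> length p"
        using p walks_nonempty[of p N k] by (intro open_walk_card) auto
      then show "{} \<subseteq> set p \<and> card (set p) \<le> b" using p by (auto simp: walks_def b_def)
    qed auto
    also have "real N ^ b = ?r ^ (2 * b)" using r by (simp add: power_mult)
    also have "K * \<dots> \<le> K * ?r ^ Suc k"
      using K r by (intro mult_left_mono power_increasing) (auto simp: b_def)
    finally have "cmod (\<Sum>p\<in>?P. step_mean N (steps p)) \<le> K * ?r ^ Suc k" by simp
    then have "cmod (\<Sum>p\<in>?P. step_mean N (steps p)) / (?r * ?r * ?r ^ k) \<le> K * ?r ^ Suc k / (?r * ?r * ?r ^ k)"
      by (rule divide_right_mono) simp
    also have "\<dots> = K / ?r"
    proof -
      have "K * x ^ Suc k / (x * x * x ^ k) = K / x" if "x \<noteq> 0" for x :: real using that by simp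
      then show ?thesis using r by (metis not_one_le_zero)
    qed
    finally show ?thesis
      using r by (simp add: norm_mult norm_divide norm_power power_divide)
  qed
  then show ?thesis
    by (intro Lim_null_comparison[OF _ t]) (auto intro!: eventually_sequentiallyI[of 1])
qed

end

section \<open>Second moments of bilinear forms\<close>

lemma hd_walks_less: "p \<in> walks N k \<Longrightarrow> hd p < N"
  by (cases p) (auto simp: walks_def)

definition compat :: "nat option \<Rightarrow> nat \<Rightarrow> bool" where
  "compat r a \<longleftrightarrow> (\<forall>j. r = Some j \<longrightarrow> a = j)"

definition tweight :: "nat \<Rightarrow> nat option \<Rightarrow> real" where
  "tweight N r = (if r = None then 1 / sqrt (real N) else 1)"

lemma cmod_tvec: "cmod (tvec N r a) = (if compat r a then tweight N r else 0)"
  by (auto simp: tvec_def compat_def tweight_def norm_divide split: option.splits)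

lemma tvec_nonzero: "tvec N r a \<noteq> 0 \<Longrightarrow> compat r a"
  by (auto simp: tvec_def compat_def split: option.splits)

context wigner_ensemble begin

text \<open>The bilinear form of the vectors \<open>r\<close> and \<open>v\<close> for the
  \<open>k\<close>-th power of the Wigner matrix, expanded over walks; \<open>wform_wop\<close> is
  its operator version.\<close>

definition wform :: "nat \<Rightarrow> nat \<Rightarrow> nat option \<Rightarrow> nat option \<Rightarrow> 'w \<Rightarrow> complex" where
  "wform N k r v \<omega> = (rsqrt N) ^ k *
     (\<Sum>p\<in>walks N k. tvec_ends N r v p * step_prod N \<omega> (steps p))"

lemma finite_moments_wform:
  assumes "N \<ge> 1"
  shows "finite_moments (M N) (wform N k r v)"
proof -
  interpret prob_space "M N" by (rule prob) fact
  show ?thesis unfolding wform_def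
    by (intro finite_moments_cmult finite_moments_sum finite_moments_step_prod walks_steps assms)
qed

lemma mean_wform:
  assumes "N \<ge> 1"
  shows "(\<integral>\<omega>. wform N k r v \<omega> \<partial>M N) = (rsqrt N) ^ k *
     (\<Sum>p\<in>walks N k. tvec_ends N r v p * step_mean N (steps p))"
proof -
  interpret prob_space "M N" by (rule prob) fact
  have i: "integrable (M N) (\<lambda>\<omega>. step_prod N \<omega> (steps p))" if "p \<in> walks N k" for p
    using that assms by (intro finite_moments_integrable finite_moments_step_prod walks_steps)
  show ?thesis
    unfolding wform_def step_mean_def using i
    by (subst integral_mult_right_zero, subst Bochner_Integration.integral_sum)
      (auto intro!: sum.cong)
qed

lemma mean_wform_diag:
  assumes "N \<ge> 1"
  shows "(\<integral>\<omega>. wform N k (Some j) (Some j) \<omega> \<partial>M N) = closed_mean N k j"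
proof -
  have "(\<Sum>p\<in>walks N k. tvec_ends N (Some j) (Some j) p * step_mean N (steps p)) =
      (\<Sum>p\<in>walks N k. if hd p = j \<and> last p = j then step_mean N (steps p) else 0)"
    by (rule sum.cong) (auto simp: tvec_def)
  then show ?thesis
    unfolding mean_wform[OF assms] closed_mean_def by (simp add: sum.inter_filter)
qed

text \<open>The two end weights multiply to 1/N: closed walks give the average of the diagonal
  means, open walks a remainder that \<open>open_mean_tendsto\<close> controls.\<close>

lemma mean_wform_ones:
  assumes "N \<ge> 1"
  shows "(\<integral>\<omega>. wform N k None None \<omega> \<partial>M N) =
    closed_average N k + 1 / of_nat N * (rsqrt N) ^ k *
     (\<Sum>p\<in>{p \<in> walks N k. hd p \<noteq> last p}. step_mean N (steps p))"
proof -
  let ?c = "(rsqrt N) ^ k"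
  have sq: "tvec N None a * tvec N None b * x = 1 / of_nat N * x" for a b x
    by (simp add: tvec_def flip: of_real_mult)
  have "(\<Sum>p\<in>walks N k. step_mean N (steps p)) =
     (\<Sum>p\<in>{p \<in> walks N k. hd p = last p}. step_mean N (steps p)) +
     (\<Sum>p\<in>{p \<in> walks N k. hd p \<noteq> last p}. step_mean N (steps p))"
    by (subst sum.union_disjoint[symmetric]) (auto intro!: sum.cong)
  also have "(\<Sum>p\<in>{p \<in> walks N k. hd p = last p}. step_mean N (steps p)) =
      (\<Sum>j<N. \<Sum>p\<in>{p \<in> {p \<in> walks N k. hd p = last p}. hd p = j}. step_mean N (steps p))"
  proof (rule sum.group[symmetric])
    show "hd ` {p \<in> walks N k. hd p = last p} \<subseteq> {..<N}"
      using hd_walks_less by blast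
  qed auto
  also have "(\<lambda>j. {p \<in> {p \<in> walks N k. hd p = last p}. hd p = j}) = (\<lambda>j. {p \<in> walks N k. hd p = j \<and> last p = j})"
    by auto
  finally show ?thesis
    unfolding mean_wform[OF assms] sq closed_mean_def
    by (simp add: sum_distrib_left[symmetric] sum_divide_distrib[symmetric] distrib_left add_divide_distrib)
qed

lemma mean_wform_tendsto: "(\<lambda>N. \<integral>\<omega>. wform N k r r \<omega> \<partial>M N) \<longlonglongrightarrow> lim_moment k"
proof (cases r)
  case (Some j)
  show ?thesis unfolding Some
    by (rule Lim_transform_eventually[OF closed_mean_tendsto(1)], rule eventually_sequentiallyI[of 1])
      (simp add: mean_wform_diag)
next
  case None
  have "(\<lambda>N. closed_average N k + 1 / of_nat N * (rsqrt N) ^ k *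
     (\<Sum>p\<in>{p \<in> walks N k. hd p \<noteq> last p}. step_mean N (steps p))) \<longlonglongrightarrow> lim_moment k + 0"
    by (intro tendsto_add closed_mean_average_tendsto open_mean_tendsto)
  then have *: "(\<lambda>N. closed_average N k + 1 / of_nat N * (rsqrt N) ^ k *
     (\<Sum>p\<in>{p \<in> walks N k. hd p \<noteq> last p}. step_mean N (steps p))) \<longlonglongrightarrow> lim_moment k" by simp
  show ?thesis unfolding None
    by (rule Lim_transform_eventually[OF *], rule eventually_sequentiallyI[of 1])
      (simp only: mean_wform_ones)
qed

section \<open>Second moments and variances as sums over pairs of walks\<close>

lemma cnj_entry:
  assumes "\<omega> \<in> space (M N)" "fst s < N" "snd s < N"
  shows "cnj (entry N \<omega> s) = entry N \<omega> (prod.swap s)"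
proof (cases "fst s = snd s")
  case True
  then have "X N (fst s) (snd s) \<omega> \<in> \<real>" using diag_real[OF assms(2,1)] by simp
  then show ?thesis using True by (simp add: entry_def Reals_cnj_iff)
qed (auto simp: entry_def)

lemma cnj_step_prod:
  assumes "\<omega> \<in> space (M N)" "set S \<subseteq> {..<N} \<times> {..<N}"
  shows "cnj (step_prod N \<omega> S) = step_prod N \<omega> (map prod.swap S)"
  using assms(2) by (induction S) (auto simp: step_prod_def cnj_entry[OF assms(1)] simp del: swap_simp)

lemma cnj_step_mean:
  assumes "set S \<subseteq> {..<N} \<times> {..<N}"
  shows "cnj (step_mean N S) = step_mean N (map prod.swap S)"
  unfolding step_mean_def Bochner_Integration.integral_cnj[symmetric]
  by (rule Bochner_Integration.integral_cong) (auto simp: cnj_step_prod[OF _ assms])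

lemma step_prod_append: "step_prod N \<omega> (S @ T) = step_prod N \<omega> S * step_prod N \<omega> T"
  by (simp add: step_prod_def)

text \<open>The kernel \<open>K\<close> is left open so that one estimate serves both the second
  moment, with the joint mean, and the variance, with the covariance of the two walks.\<close>

definition pair_sum :: "nat \<Rightarrow> nat \<Rightarrow> nat option \<Rightarrow> nat option \<Rightarrow> (nat list \<Rightarrow> nat list \<Rightarrow> complex) \<Rightarrow> complex" where
  "pair_sum N k r v K = 1 / of_real (real N ^ k) * (\<Sum>p\<in>walks N k. \<Sum>q\<in>walks N k.
     tvec_ends N r v p * (tvec_ends N r v q) * K p q)"

lemma pair_sum_diff: "pair_sum N k r v (\<lambda>p q. K p q - L p q) = pair_sum N k r v K - pair_sum N k r v L"
  by (simp add: pair_sum_def right_diff_distrib sum_subtractf diff_divide_distrib)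

lemma pair_sum_product:
  fixes f g :: "nat list \<Rightarrow> complex"
  shows "(rsqrt N) ^ k * (\<Sum>p\<in>walks N k. tvec_ends N r v p * f p) *
    ((rsqrt N) ^ k * (\<Sum>q\<in>walks N k. tvec_ends N r v q * g q))
    = pair_sum N k r v (\<lambda>p q. f p * g q)"
proof -
  let ?c = "rsqrt N"
  have c: "?c ^ k * ?c ^ k = 1 / of_real (real N ^ k)"
    using inverse_sqrt_power_even[of N k] by (simp add: mult_2 power_add)
  let ?f = "\<lambda>p. tvec_ends N r v p * f p"
  let ?g = "\<lambda>q. tvec_ends N r v q * g q"
  have "?c ^ k * sum ?f (walks N k) * (?c ^ k * sum ?g (walks N k)) =
      (?c ^ k * ?c ^ k) * (sum ?f (walks N k) * sum ?g (walks N k))" by (simp only: mult_ac)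
  also have "sum ?f (walks N k) * sum ?g (walks N k) = (\<Sum>p\<in>walks N k. \<Sum>q\<in>walks N k. ?f p * ?g q)"
    by (rule sum_product)
  also have "\<dots> = (\<Sum>p\<in>walks N k. \<Sum>q\<in>walks N k.
     tvec_ends N r v p * (tvec_ends N r v q) * (f p * g q))"
    by (intro sum.cong refl) (simp only: mult_ac)
  finally show ?thesis unfolding c pair_sum_def .
qed

abbreviation pair_mean :: "nat \<Rightarrow> nat list \<Rightarrow> nat list \<Rightarrow> complex" where
  "pair_mean N p q \<equiv> step_mean N (steps p @ back_steps q)"

lemma second_moment_wform:
  assumes "N \<ge> 1"
  shows "(\<integral>\<omega>. of_real ((cmod (wform N k r v \<omega>))\<^sup>2) \<partial>M N) =
    pair_sum N k r v (\<lambda>p q. pair_mean N p q)"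
proof -
  interpret prob_space "M N" by (rule prob) fact
  have sw: "set (steps p @ back_steps q) \<subseteq> {..<N} \<times> {..<N}"
    if "p \<in> walks N k" "q \<in> walks N k" for p q
    using walks_steps[OF that(1)] walks_steps[OF that(2)] by auto
  have "of_real ((cmod (wform N k r v \<omega>))\<^sup>2) =
      pair_sum N k r v (\<lambda>p q. step_prod N \<omega> (steps p @ back_steps q))"
    if \<omega>: "\<omega> \<in> space (M N)" for \<omega>
  proof -
    have "cnj (wform N k r v \<omega>) = (rsqrt N) ^ k *
      (\<Sum>p\<in>walks N k. tvec_ends N r v p * step_prod N \<omega> (back_steps p))"
      unfolding wform_def using cnj_step_prod[OF \<omega> walks_steps] by (simp cong: sum.cong)
    then have "wform N k r v \<omega> * cnj (wform N k r v \<omega>) =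
      pair_sum N k r v (\<lambda>p q. step_prod N \<omega> (steps p) * step_prod N \<omega> (back_steps q))"
      by (simp only: pair_sum_product[symmetric] wform_def)
    then show ?thesis unfolding step_prod_append complex_norm_square .
  qed
  then have "(\<integral>\<omega>. of_real ((cmod (wform N k r v \<omega>))\<^sup>2) \<partial>M N) =
      (\<integral>\<omega>. pair_sum N k r v (\<lambda>p q. step_prod N \<omega> (steps p @ back_steps q)) \<partial>M N)"
    by (intro Bochner_Integration.integral_cong refl)
  also have "\<dots> = pair_sum N k r v (\<lambda>p q. pair_mean N p q)"
  proof -
    have i: "integrable (M N) (\<lambda>\<omega>. step_prod N \<omega> (steps p @ back_steps q))"
      if "p \<in> walks N k" "q \<in> walks N k" for p q
      using that assms by (intro finite_moments_integrable finite_moments_step_prod sw)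
    let ?w = "\<lambda>p q. tvec_ends N r v p * (tvec_ends N r v q)"
    let ?f = "\<lambda>p q \<omega>. step_prod N \<omega> (steps p @ back_steps q)"
    have "(\<integral>\<omega>. (\<Sum>p\<in>walks N k. \<Sum>q\<in>walks N k. ?w p q * ?f p q \<omega>) \<partial>M N) =
        (\<Sum>p\<in>walks N k. \<integral>\<omega>. (\<Sum>q\<in>walks N k. ?w p q * ?f p q \<omega>) \<partial>M N)"
      by (rule Bochner_Integration.integral_sum)
        (intro Bochner_Integration.integrable_sum integrable_mult_right i)
    also have "\<dots> = (\<Sum>p\<in>walks N k. \<Sum>q\<in>walks N k. \<integral>\<omega>. ?w p q * ?f p q \<omega> \<partial>M N)"
      by (intro sum.cong refl Bochner_Integration.integral_sum integrable_mult_right i)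
    also have "\<dots> = (\<Sum>p\<in>walks N k. \<Sum>q\<in>walks N k. ?w p q * (\<integral>\<omega>. ?f p q \<omega> \<partial>M N))"
      by (intro sum.cong refl integral_mult_right_zero)
    finally show ?thesis unfolding pair_sum_def step_mean_def integral_mult_right_zero
      by (rule arg_cong)
  qed
  finally show ?thesis .
qed

lemma variance_wform:
  assumes "N \<ge> 1"
  shows "(\<integral>\<omega>. of_real ((cmod (wform N k r v \<omega> - (\<integral>\<omega>. wform N k r v \<omega> \<partial>M N)))\<^sup>2) \<partial>M N) =
    pair_sum N k r v (\<lambda>p q. pair_mean N p q -
      step_mean N (steps p) * step_mean N (back_steps q))"
proof -
  interpret prob_space "M N" by (rule prob) fact
  let ?Y = "wform N k r v"
  let ?m = "\<integral>\<omega>. wform N k r v \<omega> \<partial>M N"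
  have fm: "finite_moments (M N) ?Y" by (rule finite_moments_wform) fact
  have i1: "integrable (M N) (\<lambda>\<omega>. complex_of_real ((cmod (?Y \<omega>))\<^sup>2))"
    using finite_moments_norm_power[OF fm] by (intro integrable_of_real)
  have i2: "integrable (M N) ?Y" "integrable (M N) (\<lambda>\<omega>. cnj (?Y \<omega>))"
    using finite_moments_integrable[OF fm] by auto
  have "(\<integral>\<omega>. of_real ((cmod (?Y \<omega> - ?m))\<^sup>2) \<partial>M N) =
      (\<integral>\<omega>. of_real ((cmod (?Y \<omega>))\<^sup>2) - cnj ?m * ?Y \<omega> - ?m * cnj (?Y \<omega>) + ?m * cnj ?m \<partial>M N)"
    by (rule Bochner_Integration.integral_cong[OF refl])
      (simp add: complex_norm_square algebra_simps del: of_real_power)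
  also have "\<dots> = (\<integral>\<omega>. of_real ((cmod (?Y \<omega>))\<^sup>2) \<partial>M N) - cnj ?m * ?m - ?m * cnj ?m + ?m * cnj ?m"
    using i1 i2 by (simp add: prob_space Bochner_Integration.integral_cnj del: of_real_power)
  also have "\<dots> = (\<integral>\<omega>. of_real ((cmod (?Y \<omega>))\<^sup>2) \<partial>M N) - ?m * cnj ?m" by simp
  also have "cnj ?m = (rsqrt N) ^ k *
     (\<Sum>p\<in>walks N k. tvec_ends N r v p * step_mean N (back_steps p))"
    unfolding mean_wform[OF assms] using cnj_step_mean[OF walks_steps] by (simp cong: sum.cong)
  finally show ?thesis
    by (simp only: pair_sum_diff second_moment_wform[OF assms] mean_wform[OF assms] pair_sum_product)
qed

text \<open>At most of order N^(b - card R) pairs contribute, and \<open>1 / N ^ k\<close> is the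
  scaling of two walks of length k. Each end vector is evaluated once per walk, whence the squares
  of \<open>tweight\<close>.\<close>

lemma pair_sum_le:
  assumes N: "N \<ge> 1" and C: "0 \<le> C"
    and K: "\<And>p q. p \<in> walks N k \<Longrightarrow> q \<in> walks N k \<Longrightarrow> cmod (K p q) \<le> C"
    and supp: "\<And>p q. p \<in> walks N k \<Longrightarrow> q \<in> walks N k \<Longrightarrow> compat r (hd p) \<Longrightarrow> compat r (hd q) \<Longrightarrow>
      compat v (last p) \<Longrightarrow> compat v (last q) \<Longrightarrow> K p q \<noteq> 0 \<Longrightarrow> card (set p \<union> set q) \<le> b"
    and R: "R = set_option r \<union> set_option v"
  shows "cmod (pair_sum N k r v K) \<le>
    C * real b ^ (2 * k + 2) * (tweight N r)\<^sup>2 * (tweight N v)\<^sup>2 * real N ^ b / (real N ^ k * real N ^ card R)"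
proof -
  let ?Q = "{l. length l = 2 * k + 2 \<and> set l \<subseteq> {..<N} \<and> R \<subseteq> set l \<and> card (set l) \<le> b}"
  let ?T = "{(p, q) \<in> walks N k \<times> walks N k. R \<subseteq> set p \<union> set q \<and> card (set p \<union> set q) \<le> b}"
  let ?w = "(tweight N r)\<^sup>2 * (tweight N v)\<^sup>2"
  have fin: "finite ?Q"
    by (rule finite_subset[OF _ finite_lists_length_eq[of "{..<N}" "2 * k + 2"]]) auto
  \<comment> \<open>A pair is counted as one word with \<open>2 * k + 2\<close> letters; the fixed
    lengths allow it to be cut again.\<close>
  have "inj_on (\<lambda>(p, q). p @ q) ?T"
    by (auto simp: inj_on_def walks_def)
  moreover have "(\<lambda>(p, q). p @ q) ` ?T \<subseteq> ?Q"
    by (auto simp: walks_def)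
  ultimately have "card ?T \<le> card ?Q" using fin by (rule card_inj_on_le)
  moreover have "real (card ?Q) * real N ^ card R \<le> real b ^ (2 * k + 2) * real N ^ b"
    using card_lists_few_values[OF N, of "2 * k + 2" R b]
    unfolding of_nat_mult[symmetric] of_nat_power[symmetric] of_nat_le_iff .
  ultimately have "real (card ?T) * real N ^ card R \<le> real b ^ (2 * k + 2) * real N ^ b"
    using mult_right_mono[of "real (card ?T)" "real (card ?Q)" "real N ^ card R"] by simp
  then have T: "real (card ?T) \<le> real b ^ (2 * k + 2) * real N ^ b / real N ^ card R"
    using N by (simp add: field_simps)
  let ?t = "\<lambda>p q. tvec_ends N r v p * (tvec_ends N r v q) * K p q"
  have "(\<Sum>p\<in>walks N k. \<Sum>q\<in>walks N k. ?t p q) = (\<Sum>(p, q)\<in>walks N k \<times> walks N k. ?t p q)"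
    by (rule sum.cartesian_product)
  also have "\<dots> = (\<Sum>(p, q)\<in>?T. ?t p q)"
  proof (rule sum.mono_neutral_right)
    show "\<forall>x\<in>walks N k \<times> walks N k - ?T. (case x of (p, q) \<Rightarrow> ?t p q) = 0"
    proof (intro ballI, rule ccontr)
      fix x assume x: "x \<in> walks N k \<times> walks N k - ?T" "(case x of (p, q) \<Rightarrow> ?t p q) \<noteq> 0"
      obtain p q where "x = (p, q)" by fastforce
      with x have pq: "p \<in> walks N k" "q \<in> walks N k" "(p, q) \<notin> ?T" and t0: "?t p q \<noteq> 0" by auto
      have nz: "K p q \<noteq> 0" "compat r (hd p)" "compat r (hd q)" "compat v (last p)" "compat v (last q)"
        using t0 tvec_nonzero unfolding mult_eq_0_iff de_Morgan_disj by blast+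
      moreover have "R \<subseteq> set p \<union> set q"
        using nz walks_nonempty[OF pq(1)] hd_in_set[of p] last_in_set[of p] unfolding R
        by (cases r; cases v) (auto simp: compat_def)
      ultimately show False using supp[OF pq(1,2)] pq by auto
    qed
  qed auto
  finally have eq: "(\<Sum>p\<in>walks N k. \<Sum>q\<in>walks N k. ?t p q) = (\<Sum>(p, q)\<in>?T. ?t p q)" .
  have "cmod (\<Sum>p\<in>walks N k. \<Sum>q\<in>walks N k. ?t p q) \<le> (\<Sum>(p, q)\<in>?T. ?w * C)"
    unfolding eq
  proof (rule sum_norm_le, clarify)
    fix p q assume "p \<in> walks N k" "q \<in> walks N k"
    then have Kp: "cmod (K p q) \<le> C" by (rule K)
    have t: "cmod (tvec N r a) \<le> tweight N r" for r a
      by (simp add: cmod_tvec tweight_def)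
    have "cmod (?t p q) \<le> tweight N r * tweight N v * (tweight N r * tweight N v) * C"
      unfolding norm_mult using t Kp by (intro mult_mono) (auto simp: tweight_def)
    then show "cmod (?t p q) \<le> ?w * C" by (simp add: power2_eq_square mult_ac)
  qed
  also have "\<dots> = real (card ?T) * (?w * C)" by (simp add: case_prod_unfold)
  also have "\<dots> \<le> real b ^ (2 * k + 2) * real N ^ b / real N ^ card R * (?w * C)"
    using C by (intro mult_right_mono[OF T]) auto
  finally have "cmod (\<Sum>p\<in>walks N k. \<Sum>q\<in>walks N k. ?t p q) / real N ^ k \<le>
      real b ^ (2 * k + 2) * real N ^ b / real N ^ card R * (?w * C) / real N ^ k"
    by (rule divide_right_mono) simp
  also have "\<dots> = C * real b ^ (2 * k + 2) * (tweight N r)\<^sup>2 * (tweight N v)\<^sup>2 * real N ^ b / (real N ^ k * real N ^ card R)"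
    by (simp add: mult_ac)
  finally show ?thesis
    by (simp add: pair_sum_def norm_divide norm_mult norm_power)
qed

lemma pair_step_mean_nonzero:
  assumes "N \<ge> 1" "p \<in> walks N k" "q \<in> walks N k"
    and "pair_mean N p q \<noteq> 0"
      "e \<in> edges (steps p @ back_steps q)"
  shows "edge_mult (steps p @ back_steps q) e \<noteq> 1"
proof -
  have "set (steps p @ back_steps q) \<subseteq> {..<N} \<times> {..<N}"
    using walks_steps[OF assms(2)] walks_steps[OF assms(3)] by auto
  then show ?thesis using step_mean_eq_0[OF assms(1)] assms(4,5) by blast
qed

text \<open>Without a common edge the joint mean factors and the covariance vanishes. An edge used
  once by the pair is used once by one of the walks, so both terms of the covariance vanish.\<close>

lemma covariance_nonzero:
  assumes N: "N \<ge> 1" and p: "p \<in> walks N k" and q: "q \<in> walks N k"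
    and nz: "pair_mean N p q -
      step_mean N (steps p) * step_mean N (back_steps q) \<noteq> 0"
  shows "edges (steps p) \<inter> edges (steps q) \<noteq> {}"
    and "e \<in> edges (steps p @ back_steps q) \<Longrightarrow>
      edge_mult (steps p @ back_steps q) e \<noteq> 1"
proof -
  let ?S = "steps p" and ?T = "back_steps q"
  have sub: "set ?S \<subseteq> {..<N} \<times> {..<N}" "set ?T \<subseteq> {..<N} \<times> {..<N}"
    using walks_steps[OF p] walks_steps[OF q] by auto
  show "edges (steps p) \<inter> edges (steps q) \<noteq> {}"
    using nz step_mean_append[OF N sub] by auto
  show "edge_mult (?S @ ?T) e \<noteq> 1" if e: "e \<in> edges (?S @ ?T)"
  proof
    assume m: "edge_mult (?S @ ?T) e = 1"
    then have "step_mean N (?S @ ?T) = 0"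
      using sub e by (intro step_mean_eq_0[OF N]) auto
    moreover have "(edge_mult ?S e = 1 \<and> e \<in> edges ?S) \<or> (edge_mult ?T e = 1 \<and> e \<in> edges ?T)"
      using m edge_mult_pos_iff[of ?S e] edge_mult_pos_iff[of ?T e] unfolding edge_mult_append by linarith
    then have "step_mean N ?S = 0 \<or> step_mean N ?T = 0"
      using step_mean_eq_0[OF N] sub by blast
    ultimately show False using nz by auto
  qed
qed

definition pair_bound :: "nat \<Rightarrow> real" where
  "pair_bound k = 1 + real (2 * k) * moment_bound (2 * k) + (1 + real k * moment_bound k)\<^sup>2"

lemma pair_bound_nonneg: "0 \<le> pair_bound k"
  unfolding pair_bound_def moment_bound_def by simp

lemma pair_step_mean_le:
  assumes N: "N \<ge> 1" and p: "p \<in> walks N k" and q: "q \<in> walks N k"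
  shows "cmod (pair_mean N p q) \<le> pair_bound k"
    and "cmod (pair_mean N p q -
      step_mean N (steps p) * step_mean N (back_steps q)) \<le> pair_bound k"
proof -
  let ?S = "steps p" and ?T = "back_steps q"
  have sub: "set ?S \<subseteq> {..<N} \<times> {..<N}" "set ?T \<subseteq> {..<N} \<times> {..<N}"
    using walks_steps[OF p] walks_steps[OF q] by auto
  have len: "length ?S = k" "length ?T = k" using p q by (auto simp: walks_def)
  have 1: "cmod (step_mean N (?S @ ?T)) \<le> 1 + real (2 * k) * moment_bound (2 * k)"
  proof -
    have "set (?S @ ?T) \<subseteq> {..<N} \<times> {..<N}" using sub by simp
    moreover have "length (?S @ ?T) = 2 * k" using len by simp
    ultimately show ?thesis using step_mean_bounded[OF N, of "?S @ ?T"] by (simp only:)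
  qed
  have 2: "cmod (step_mean N ?S) \<le> 1 + real k * moment_bound k"
    "cmod (step_mean N ?T) \<le> 1 + real k * moment_bound k"
    using step_mean_bounded[OF N, of ?S] step_mean_bounded[OF N, of ?T] sub len by auto
  show "cmod (step_mean N (?S @ ?T)) \<le> pair_bound k"
    using 1 by (simp add: pair_bound_def add_increasing2)
  have "cmod (step_mean N ?S * step_mean N ?T) \<le> (1 + real k * moment_bound k)\<^sup>2"
    unfolding norm_mult power2_eq_square
    by (intro mult_mono 2) (auto intro: order_trans[OF _ 2(1)])
  then show "cmod (step_mean N (?S @ ?T) - step_mean N ?S * step_mean N ?T) \<le> pair_bound k"
    using 1 norm_triangle_ineq4[of "step_mean N (?S @ ?T)" "step_mean N ?S * step_mean N ?T"]
    by (simp add: pair_bound_def)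
qed

text \<open>Since \<open>r\<close> and \<open>v\<close> differ, one of them is a basis vector; its
  vertex is an end of both walks, which makes their union connected and limits it to k + 1
  vertices.\<close>

lemma second_moment_off_diagonal:
  assumes "r \<noteq> v"
  shows "\<exists>C. \<forall>N\<ge>1. (\<integral>\<omega>. (cmod (wform N k r v \<omega>))\<^sup>2 \<partial>M N) \<le> C / real N"
proof -
  define C where "C = pair_bound k * real (k + 1) ^ (2 * k + 2)"
  let ?K = "\<lambda>N p q. pair_mean N p q"
  let ?R = "set_option r \<union> set_option v"
  have "(\<integral>\<omega>. (cmod (wform N k r v \<omega>))\<^sup>2 \<partial>M N) \<le> C / real N" if N: "N \<ge> 1" for N
  proof -
    have "cmod (pair_sum N k r v (?K N)) \<le> pair_bound k * real (k + 1) ^ (2 * k + 2) *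
        (tweight N r)\<^sup>2 * (tweight N v)\<^sup>2 * real N ^ (k + 1) / (real N ^ k * real N ^ card ?R)"
    proof (rule pair_sum_le[OF N pair_bound_nonneg])
      fix p q assume pq: "p \<in> walks N k" "q \<in> walks N k"
      show "cmod (?K N p q) \<le> pair_bound k" by (rule pair_step_mean_le[OF N pq])
      assume c: "compat r (hd p)" "compat r (hd q)" "compat v (last p)" "compat v (last q)" "?K N p q \<noteq> 0"
      have ne: "p \<noteq> []" "q \<noteq> []" using pq walks_nonempty by auto
      obtain i where "r = Some i \<or> v = Some i" using assms by (metis option.exhaust)
      then have "i \<in> set p" "i \<in> set q"
        using c hd_in_set[OF ne(1)] last_in_set[OF ne(1)] hd_in_set[OF ne(2)] last_in_set[OF ne(2)]
        by (auto simp: compat_def)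
      then show "card (set p \<union> set q) \<le> k + 1"
        using pq pair_step_mean_nonzero[OF N pq c(5)]
        by (intro walk_pair_card(1)[OF _ _ _ refl]) (auto simp: walks_def)
    qed (rule refl)
    also have "\<dots> = C / real N"
    proof -
      \<comment> \<open>Two different basis vectors fix two vertices; a basis vector and the
        all-ones vector fix one, with weight 1/N from the other end.\<close>
      have "(tweight N r)\<^sup>2 * (tweight N v)\<^sup>2 * real N ^ (k + 1) / (real N ^ k * real N ^ card ?R) = 1 / real N"
        using N assms by (cases r; cases v) (auto simp: tweight_def power_divide card_insert_if power2_eq_square)
      then show ?thesis unfolding C_def by (simp only: mult.assoc times_divide_eq_right[symmetric]) simp
    qed
    also have "cmod (pair_sum N k r v (?K N)) = \<bar>\<integral>\<omega>. (cmod (wform N k r v \<omega>))\<^sup>2 \<partial>M N\<bar>"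
      unfolding second_moment_wform[OF N, symmetric] integral_complex_of_real norm_of_real ..
    finally show ?thesis by linarith
  qed
  then show ?thesis by blast
qed

text \<open>A contributing pair shares an edge. At a basis vector both walks are closed, so the
  shared edge costs a further vertex: at most k, one of them fixed. For the all-ones vector the
  walks may be open and the bound is k + 1, but the four end weights give N^(-2). Either way 1/N
  remains.\<close>

lemma variance_diagonal:
  "\<exists>C. \<forall>N\<ge>1. (\<integral>\<omega>. (cmod (wform N k r r \<omega> - (\<integral>\<omega>. wform N k r r \<omega> \<partial>M N)))\<^sup>2 \<partial>M N) \<le> C / real N"
proof -
  define b where "b = (if r = None then k + 1 else k)"
  define C where "C = pair_bound k * real b ^ (2 * k + 2)"
  let ?K = "\<lambda>N p q. pair_mean N p q -
      step_mean N (steps p) * step_mean N (back_steps q)"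
  let ?R = "set_option r \<union> set_option r"
  have "(\<integral>\<omega>. (cmod (wform N k r r \<omega> - (\<integral>\<omega>. wform N k r r \<omega> \<partial>M N)))\<^sup>2 \<partial>M N) \<le> C / real N" if N: "N \<ge> 1" for N
  proof -
    have "cmod (pair_sum N k r r (?K N)) \<le> pair_bound k * real b ^ (2 * k + 2) *
        (tweight N r)\<^sup>2 * (tweight N r)\<^sup>2 * real N ^ b / (real N ^ k * real N ^ card ?R)"
    proof (rule pair_sum_le[OF N pair_bound_nonneg])
      fix p q assume pq: "p \<in> walks N k" "q \<in> walks N k"
      show "cmod (?K N p q) \<le> pair_bound k" by (rule pair_step_mean_le[OF N pq])
      assume c: "compat r (hd p)" "compat r (hd q)" "compat r (last p)" "compat r (last q)" "?K N p q \<noteq> 0"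
      note cov = covariance_nonzero[OF N pq c(5)]
      obtain u w where "ed (u, w) \<in> edges (steps p)" "ed (u, w) \<in> edges (steps q)"
        using cov(1) by (force simp: edges_def)
      then have "u \<in> set p" "u \<in> set q"
        by (auto simp: edges_def ed_eq_iff dest!: set_steps)
      then have int: "set p \<inter> set q \<noteq> {}" by auto
      have len: "length p = Suc k" "length q = Suc k" using pq by (auto simp: walks_def)
      note cards = walk_pair_card[OF len int refl cov(2)]
      show "card (set p \<union> set q) \<le> b"
      proof (cases r)
        case None
        then show ?thesis using cards(1) by (simp add: b_def)
      next
        case (Some i)
        then show ?thesis using c cards(2) cov(1) by (simp add: b_def compat_def)
      qed
    qed (rule refl)
    also have "\<dots> = C / real N"
    proof -
      have "(tweight N r)\<^sup>2 * (tweight N r)\<^sup>2 * real N ^ b / (real N ^ k * real N ^ card ?R) = 1 / real N"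
        using N by (cases r) (auto simp: b_def tweight_def power_divide power2_eq_square)
      then show ?thesis unfolding C_def by (simp only: mult.assoc times_divide_eq_right[symmetric]) simp
    qed
    also have "cmod (pair_sum N k r r (?K N)) =
        \<bar>\<integral>\<omega>. (cmod (wform N k r r \<omega> - (\<integral>\<omega>. wform N k r r \<omega> \<partial>M N)))\<^sup>2 \<partial>M N\<bar>"
      unfolding variance_wform[OF N, symmetric] integral_complex_of_real norm_of_real ..
    finally show ?thesis by linarith
  qed
  then show ?thesis by blast
qed

end

section \<open>Convergence of bilinear forms in all moments\<close>

context wigner_ensemble begin

definition wop :: "nat \<Rightarrow> 'w \<Rightarrow> (nat \<Rightarrow> complex) \<Rightarrow> nat \<Rightarrow> complex" where
  "wop N \<omega> x a = (\<Sum>b<N. entry N \<omega> (a, b) / of_real (sqrt (real N)) * x b)"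

text \<open>The vector \<open>x\<close> is general because the induction removes the first step,
  which replaces \<open>x\<close> by the row vector \<open>x\<close> times the matrix.\<close>

lemma sum_wop_walks:
  "(\<Sum>a<N. x a * (wop N \<omega> ^^ k) y a) = (rsqrt N) ^ k *
     (\<Sum>p\<in>walks N k. x (hd p) * y (last p) * step_prod N \<omega> (steps p))"
proof (induction k arbitrary: x)
  case 0
  show ?case by (simp add: sum_walks_0 step_prod_def)
next
  case (Suc k)
  let ?c = "rsqrt N"
  let ?x = "\<lambda>b. \<Sum>a<N. x a * (?c * entry N \<omega> (a, b))"
  have "(\<Sum>a<N. x a * (wop N \<omega> ^^ Suc k) y a) =
      (\<Sum>a<N. \<Sum>b<N. x a * (?c * entry N \<omega> (a, b)) * (wop N \<omega> ^^ k) y b)"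
    by (simp add: wop_def sum_distrib_left mult_ac)
  also have "\<dots> = (\<Sum>b<N. ?x b * (wop N \<omega> ^^ k) y b)"
    by (subst sum.swap) (simp add: sum_distrib_right)
  also have "\<dots> = ?c ^ k * (\<Sum>p\<in>walks N k. ?x (hd p) * y (last p) * step_prod N \<omega> (steps p))"
    by (rule Suc)
  also have "(\<Sum>p\<in>walks N k. ?x (hd p) * y (last p) * step_prod N \<omega> (steps p)) =
      (\<Sum>a<N. \<Sum>p\<in>walks N k. ?c * (x a * y (last p) * (entry N \<omega> (a, hd p) * step_prod N \<omega> (steps p))))"
    by (subst sum.swap, simp only: sum_distrib_right, intro sum.cong refl, simp only: mult_ac)
  also have "\<dots> = (\<Sum>a<N. \<Sum>p\<in>walks N k. ?c * (x (hd (a # p)) * y (last (a # p)) * step_prod N \<omega> (steps (a # p))))"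
  proof (intro sum.cong refl)
    fix a p assume "p \<in> walks N k"
    then obtain b q where "p = b # q" using walks_nonempty by (cases p) auto
    then show "?c * (x a * y (last p) * (entry N \<omega> (a, hd p) * step_prod N \<omega> (steps p))) =
        ?c * (x (hd (a # p)) * y (last (a # p)) * step_prod N \<omega> (steps (a # p)))"
      by (simp add: step_prod_def)
  qed
  also have "\<dots> = ?c * (\<Sum>p\<in>walks N (Suc k). x (hd p) * y (last p) * step_prod N \<omega> (steps p))"
    unfolding sum_walks_Suc by (simp only: sum_distrib_left)
  finally show ?case by simp
qed

lemma wform_wop: "wform N k r v \<omega> = (\<Sum>a<N. tvec N r a * (wop N \<omega> ^^ k) (tvec N v) a)"
  by (simp add: sum_wop_walks wform_def)

lemma wop_adjoint:
  assumes "\<omega> \<in> space (M N)"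
  shows "(\<Sum>a<N. cnj ((wop N \<omega> ^^ k) x a) * y a) = (\<Sum>a<N. cnj (x a) * (wop N \<omega> ^^ k) y a)"
proof (induction k arbitrary: y)
  case (Suc k)
  have "(\<Sum>a<N. cnj ((wop N \<omega> ^^ Suc k) x a) * y a) =
      (\<Sum>a<N. \<Sum>b<N. cnj (entry N \<omega> (a, b)) / of_real (sqrt (real N)) * cnj ((wop N \<omega> ^^ k) x b) * y a)"
    by (simp add: wop_def sum_distrib_right)
  also have "\<dots> = (\<Sum>b<N. \<Sum>a<N. cnj (entry N \<omega> (a, b)) / of_real (sqrt (real N)) * cnj ((wop N \<omega> ^^ k) x b) * y a)"
    by (rule sum.swap)
  also have "\<dots> = (\<Sum>b<N. cnj ((wop N \<omega> ^^ k) x b) * wop N \<omega> y b)"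
    by (intro sum.cong refl) (simp add: wop_def sum_distrib_left cnj_entry[OF assms] mult_ac)
  also have "\<dots> = (\<Sum>b<N. cnj (x b) * (wop N \<omega> ^^ k) (wop N \<omega> y) b)" by (rule Suc)
  finally show ?case by (simp add: funpow_swap1)
qed simp

lemma cmod_sum_square_le:
  fixes x y :: "nat \<Rightarrow> complex"
  shows "(cmod (\<Sum>a<N. x a * y a))\<^sup>2 \<le> (\<Sum>a<N. (cmod (x a))\<^sup>2) * (\<Sum>a<N. (cmod (y a))\<^sup>2)"
proof -
  have "cmod (\<Sum>a<N. x a * y a) \<le> (\<Sum>a<N. cmod (x a) * cmod (y a))"
    by (rule order_trans[OF norm_sum]) (simp add: norm_mult)
  then have "(cmod (\<Sum>a<N. x a * y a))\<^sup>2 \<le> (\<Sum>a<N. cmod (x a) * cmod (y a))\<^sup>2"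
    by (rule power_mono) simp
  also have "\<dots> \<le> (\<Sum>a<N. (cmod (x a))\<^sup>2) * (\<Sum>a<N. (cmod (y a))\<^sup>2)"
    by (rule Cauchy_Schwarz_ineq_sum)
  finally show ?thesis .
qed

text \<open>Cauchy--Schwarz: iterating it bounds all absolute moments of a form by the mean of a single form.\<close>

lemma wform_square_le:
  assumes "\<omega> \<in> space (M N)"
  shows "(cmod (wform N k r v \<omega>))\<^sup>2 \<le> Re (wform N (2 * k) r r \<omega>)"
proof -
  let ?x = "(wop N \<omega> ^^ k) (tvec N r)"
  have "wform N k r v \<omega> = (\<Sum>a<N. cnj (?x a) * tvec N v a)"
    unfolding wform_wop wop_adjoint[OF assms] by simp
  then have "(cmod (wform N k r v \<omega>))\<^sup>2 \<le> (\<Sum>a<N. (cmod (?x a))\<^sup>2) * (\<Sum>a<N. (cmod (tvec N v a))\<^sup>2)"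
    using cmod_sum_square_le[of "\<lambda>a. cnj (?x a)" "tvec N v" N] by simp
  also have "\<dots> \<le> (\<Sum>a<N. (cmod (?x a))\<^sup>2) * 1"
    by (intro mult_left_mono sum_tvec_square_le sum_nonneg) auto
  also have "complex_of_real (\<Sum>a<N. (cmod (?x a))\<^sup>2) = (\<Sum>a<N. cnj (?x a) * ?x a)"
    by (simp add: complex_norm_square mult.commute del: of_real_power)
  then have "(\<Sum>a<N. (cmod (?x a))\<^sup>2) = Re (\<Sum>a<N. cnj (?x a) * ?x a)"
    by (metis Re_complex_of_real)
  also have "(\<Sum>a<N. cnj (?x a) * ?x a) = wform N (2 * k) r r \<omega>"
    unfolding wop_adjoint[OF assms] wform_wop by (simp add: mult_2 funpow_add)
  finally show ?thesis by simp
qed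

lemma wform_power_le:
  assumes "\<omega> \<in> space (M N)"
  shows "cmod (wform N k r v \<omega>) ^ (2 ^ Suc n) \<le> Re (wform N (2 ^ Suc n * k) r r \<omega>)"
proof (induction n)
  case 0
  show ?case using wform_square_le[OF assms, of k r v] by simp
next
  case (Suc n)
  have "cmod (wform N k r v \<omega>) ^ (2 ^ Suc (Suc n)) = (cmod (wform N k r v \<omega>) ^ (2 ^ Suc n))\<^sup>2"
    by (simp add: power_mult[symmetric] mult.commute)
  also have "\<dots> \<le> (Re (wform N (2 ^ Suc n * k) r r \<omega>))\<^sup>2"
    using Suc by (rule power_mono) simp
  also have "\<dots> \<le> (cmod (wform N (2 ^ Suc n * k) r r \<omega>))\<^sup>2"
    by (simp add: cmod_power2)
  also have "\<dots> \<le> Re (wform N (2 * (2 ^ Suc n * k)) r r \<omega>)"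
    by (rule wform_square_le[OF assms])
  finally show ?case by (simp add: mult.assoc)
qed

text \<open>The exponent \<open>q\<close> is below the power of two \<open>2 ^ Suc q\<close>, for
  which \<open>wform_power_le\<close> leaves the mean of a single form; that mean converges and is
  therefore bounded.\<close>

lemma wform_moments_bounded:
  "\<exists>C. \<forall>N\<ge>1. (\<integral>\<omega>. cmod (wform N k r v \<omega>) ^ q \<partial>M N) \<le> C"
proof -
  let ?n = "2 ^ Suc q :: nat"
  have "Bseq (\<lambda>N. \<integral>\<omega>. wform N (?n * k) r r \<omega> \<partial>M N)"
    using mean_wform_tendsto convergentI convergent_imp_Bseq by blast
  then obtain C where C: "\<And>N. cmod (\<integral>\<omega>. wform N (?n * k) r r \<omega> \<partial>M N) \<le> C"
    by (auto simp: Bseq_def)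
  have "(\<integral>\<omega>. cmod (wform N k r v \<omega>) ^ q \<partial>M N) \<le> 1 + C" if N: "N \<ge> 1" for N
  proof -
    interpret prob_space "M N" by (rule prob) fact
    have fm: "finite_moments (M N) (wform N j a b)" for j a b by (rule finite_moments_wform) fact
    have i: "integrable (M N) (\<lambda>\<omega>. Re (wform N (?n * k) r r \<omega>))"
      using finite_moments_integrable[OF fm] by (intro integrable_Re)
    have "(\<integral>\<omega>. cmod (wform N k r v \<omega>) ^ q \<partial>M N) \<le> (\<integral>\<omega>. 1 + Re (wform N (?n * k) r r \<omega>) \<partial>M N)"
    proof (rule integral_mono)
      fix \<omega> assume \<omega>: "\<omega> \<in> space (M N)"
      let ?c = "cmod (wform N k r v \<omega>)"
      have "q \<le> ?n" using less_exp[of "Suc q"] by simp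
      then have "?c ^ q \<le> 1 + ?c ^ ?n"
        using power_increasing[of q ?n ?c] power_le_one[of ?c q]
        by (cases "1 \<le> ?c") (auto intro: add_increasing add_increasing2)
      then show "?c ^ q \<le> 1 + Re (wform N (?n * k) r r \<omega>)"
        using wform_power_le[OF \<omega>, of k r v q] by linarith
    qed (use i fm in \<open>auto intro: finite_moments_norm_power\<close>)
    also have "\<dots> = 1 + Re (\<integral>\<omega>. wform N (?n * k) r r \<omega> \<partial>M N)"
      using i finite_moments_integrable[OF fm] by (simp add: prob_space)
    also have "\<dots> \<le> 1 + C" using C[of N] complex_Re_le_cmod order_trans by auto
    finally show ?thesis .
  qed
  then show ?thesis by blast
qed

text \<open>Asking for all exponents makes the notion stable under products of dependent variables,
  which convergence for a single exponent is not.\<close>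

definition Lconv :: "(nat \<Rightarrow> 'w \<Rightarrow> complex) \<Rightarrow> complex \<Rightarrow> bool" where
  "Lconv Y c \<longleftrightarrow> (\<forall>N\<ge>1. finite_moments (M N) (Y N)) \<and>
     (\<forall>p\<ge>1. (\<lambda>N. \<integral>\<omega>. cmod (Y N \<omega> - c) ^ p \<partial>M N) \<longlonglongrightarrow> 0)"

text \<open>Interpolation between the L^2 error, which tends to 0, and the error moment of order
  \<open>2 * (p - 1)\<close>, which is only bounded.\<close>

lemma LconvI_square:
  assumes fm: "\<And>N. N \<ge> 1 \<Longrightarrow> finite_moments (M N) (Y N)"
    and L2: "(\<lambda>N. \<integral>\<omega>. (cmod (Y N \<omega> - c))\<^sup>2 \<partial>M N) \<longlonglongrightarrow> 0"
    and bound: "\<And>q. \<exists>C. \<forall>N\<ge>1. (\<integral>\<omega>. cmod (Y N \<omega>) ^ q \<partial>M N) \<le> C"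
  shows "Lconv Y c"
  unfolding Lconv_def
proof (intro conjI allI impI)
  fix p :: nat assume p: "p \<ge> 1"
  let ?q = "2 * (p - 1)"
  obtain C where C: "\<And>N. N \<ge> 1 \<Longrightarrow> (\<integral>\<omega>. cmod (Y N \<omega>) ^ ?q \<partial>M N) \<le> C"
    using bound by blast
  define B where "B = \<bar>2 ^ ?q * (C + cmod c ^ ?q)\<bar>"
  have fmc: "finite_moments (M N) (\<lambda>\<omega>. Y N \<omega> - c)" if "N \<ge> 1" for N
  proof -
    interpret prob_space "M N" by (rule prob) fact
    show ?thesis by (rule finite_moments_diff_const[OF fm[OF that]])
  qed
  have B: "(\<integral>\<omega>. cmod (Y N \<omega> - c) ^ ?q \<partial>M N) \<le> B" if N: "N \<ge> 1" for N
  proof -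
    interpret prob_space "M N" by (rule prob) fact
    have "(\<integral>\<omega>. cmod (Y N \<omega> - c) ^ ?q \<partial>M N) \<le> (\<integral>\<omega>. 2 ^ ?q * (cmod (Y N \<omega>) ^ ?q + cmod c ^ ?q) \<partial>M N)"
    proof (rule integral_mono)
      show "integrable (M N) (\<lambda>\<omega>. cmod (Y N \<omega> - c) ^ ?q)"
        by (rule finite_moments_norm_power[OF fmc[OF N]])
      show "integrable (M N) (\<lambda>\<omega>. 2 ^ ?q * (cmod (Y N \<omega>) ^ ?q + cmod c ^ ?q))"
        using finite_moments_norm_power[OF fm[OF N]] by simp
      fix \<omega>
      have "cmod (Y N \<omega> - c) ^ ?q \<le> (cmod (Y N \<omega>) + cmod c) ^ ?q"
        by (intro power_mono norm_triangle_ineq4) simp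
      then show "cmod (Y N \<omega> - c) ^ ?q \<le> 2 ^ ?q * (cmod (Y N \<omega>) ^ ?q + cmod c ^ ?q)"
        using add_power_le[of "cmod (Y N \<omega>)" "cmod c" ?q] by simp
    qed
    also have "\<dots> = 2 ^ ?q * ((\<integral>\<omega>. cmod (Y N \<omega>) ^ ?q \<partial>M N) + cmod c ^ ?q)"
      using finite_moments_norm_power[OF fm[OF N]] by (simp add: prob_space)
    also have "\<dots> \<le> 2 ^ ?q * (C + cmod c ^ ?q)" using C[OF N] by simp
    finally show ?thesis unfolding B_def by linarith
  qed
  show "(\<lambda>N. \<integral>\<omega>. cmod (Y N \<omega> - c) ^ p \<partial>M N) \<longlonglongrightarrow> 0"
  proof (rule LIMSEQ_I)
    fix e :: real assume e: "0 < e"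
    \<comment> \<open>With this \<open>t\<close> the bounded moment contributes at most e/2 times
      B/(B + 1); the second moment is then made smaller than e/t. The 1 in \<open>B + 1\<close>
      keeps \<open>t\<close> positive when \<open>B = 0\<close>.\<close>
    define t where "t = (B + 1) / e"
    have B0: "B \<ge> 0" unfolding B_def by simp
    have t: "t > 0" using e B0 by (simp add: t_def)
    have "e / t > 0" using e t by simp
    from LIMSEQ_D[OF L2 this] obtain n where n: "\<And>N. N \<ge> n \<Longrightarrow>
        (\<integral>\<omega>. (cmod (Y N \<omega> - c))\<^sup>2 \<partial>M N) < e / t" by force
    have "norm ((\<integral>\<omega>. cmod (Y N \<omega> - c) ^ p \<partial>M N) - 0) < e" if N: "N \<ge> max n 1" for N
    proof -
      have N1: "N \<ge> 1" using N by simp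
      note fmN = fmc[OF N1]
      have "(\<integral>\<omega>. cmod (Y N \<omega> - c) ^ p \<partial>M N) \<le>
          (\<integral>\<omega>. t / 2 * (cmod (Y N \<omega> - c))\<^sup>2 + 1 / (2 * t) * cmod (Y N \<omega> - c) ^ ?q \<partial>M N)"
      proof (rule integral_mono)
        show "integrable (M N) (\<lambda>\<omega>. cmod (Y N \<omega> - c) ^ p)"
          by (rule finite_moments_norm_power[OF fmN])
        show "integrable (M N) (\<lambda>\<omega>. t / 2 * (cmod (Y N \<omega> - c))\<^sup>2 + 1 / (2 * t) * cmod (Y N \<omega> - c) ^ ?q)"
          by (intro Bochner_Integration.integrable_add integrable_mult_right finite_moments_norm_power[OF fmN])
        fix \<omega>
        define z where "z = cmod (Y N \<omega> - c)"
        \<comment> \<open>AM-GM for the factors \<open>z\<close> and \<open>z ^ (p - 1)\<close> of \<open>z ^ p\<close>\<close>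
        have "0 \<le> (t * z - z ^ (p - 1))\<^sup>2 / (2 * t)" using t by simp
        also have "\<dots> = t / 2 * z\<^sup>2 + 1 / (2 * t) * z ^ ?q - z * z ^ (p - 1)"
          using t by (simp add: power2_diff field_simps power2_eq_square power_mult power_mult_distrib)
        also have "z * z ^ (p - 1) = z ^ p" using p by (cases p) auto
        finally show "z ^ p \<le> t / 2 * z\<^sup>2 + 1 / (2 * t) * z ^ ?q" by simp
      qed
      also have "\<dots> = t / 2 * (\<integral>\<omega>. (cmod (Y N \<omega> - c))\<^sup>2 \<partial>M N) + 1 / (2 * t) * (\<integral>\<omega>. cmod (Y N \<omega> - c) ^ ?q \<partial>M N)"
        using finite_moments_norm_power[OF fmN] by simp
      also have "\<dots> \<le> t / 2 * (e / t) + 1 / (2 * t) * B"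
        using n[of N] B[OF N1] N t by (intro add_mono mult_left_mono) auto
      also have "t / 2 * (e / t) = e / 2" using t by simp
      also have "1 / (2 * t) * B = e / 2 * (B / (B + 1))" using e by (simp add: t_def)
      also have "e / 2 + e / 2 * (B / (B + 1)) < e / 2 + e / 2 * 1"
        using e B0 by (intro add_strict_left_mono mult_strict_left_mono) (auto simp: field_simps)
      finally show ?thesis by (simp add: Bochner_Integration.integral_nonneg)
    qed
    then show "\<exists>no. \<forall>N\<ge>no. norm ((\<integral>\<omega>. cmod (Y N \<omega> - c) ^ p \<partial>M N) - 0) < e" by blast
  qed
qed (rule fm)

lemma Lconv_wform: "Lconv (\<lambda>N. wform N k r v) (if r = v then lim_moment k else 0)"
proof (rule LconvI_square)
  show "finite_moments (M N) (wform N k r v)" if "N \<ge> 1" for N by (rule finite_moments_wform[OF that])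
  show "\<exists>C. \<forall>N\<ge>1. (\<integral>\<omega>. cmod (wform N k r v \<omega>) ^ q \<partial>M N) \<le> C" for q
    by (rule wform_moments_bounded)
  have t: "(\<lambda>N. C / real N) \<longlonglongrightarrow> 0" for C :: real by (rule lim_const_over_n)
  show "(\<lambda>N. \<integral>\<omega>. (cmod (wform N k r v \<omega> - (if r = v then lim_moment k else 0)))\<^sup>2 \<partial>M N) \<longlonglongrightarrow> 0"
  proof (cases "r = v")
    case False
    obtain C where C: "\<And>N. N \<ge> 1 \<Longrightarrow> (\<integral>\<omega>. (cmod (wform N k r v \<omega>))\<^sup>2 \<partial>M N) \<le> C / real N"
      using second_moment_off_diagonal[OF False, of k] by blast
    show ?thesis
      by (rule Lim_null_comparison[OF _ t[of C]], rule eventually_sequentiallyI[of 1])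
        (use False C in \<open>simp add: Bochner_Integration.integral_nonneg\<close>)
  next
    case True
    let ?m = "\<lambda>N. \<integral>\<omega>. wform N k r r \<omega> \<partial>M N"
    obtain C where C: "\<And>N. N \<ge> 1 \<Longrightarrow> (\<integral>\<omega>. (cmod (wform N k r r \<omega> - ?m N))\<^sup>2 \<partial>M N) \<le> C / real N"
      using variance_diagonal[of k r] by blast
    have d: "(\<lambda>N. cmod (?m N - lim_moment k)) \<longlonglongrightarrow> 0"
      using mean_wform_tendsto[of k r] by (simp add: LIM_zero tendsto_norm_zero)
    \<comment> \<open>Twice the variance bound plus twice the squared bias.\<close>
    have t2: "(\<lambda>N. 2 * (C / real N) + 2 * (cmod (?m N - lim_moment k))\<^sup>2) \<longlonglongrightarrow> 0"
      using tendsto_add[OF tendsto_mult[OF tendsto_const[of 2] t[of C]]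
          tendsto_mult[OF tendsto_const[of 2] tendsto_power[OF d, of 2]]] by simp
    show ?thesis
    proof (rule Lim_null_comparison[OF _ t2], rule eventually_sequentiallyI[of 1])
      fix N :: nat assume N: "1 \<le> N"
      interpret prob_space "M N" by (rule prob) fact
      note fm = finite_moments_wform[OF N, of k r r]
      have i: "integrable (M N) (\<lambda>\<omega>. (cmod (wform N k r r \<omega> - d))\<^sup>2)" for d
        by (rule finite_moments_norm_power[OF finite_moments_diff_const[OF fm]])
      have "(\<integral>\<omega>. (cmod (wform N k r r \<omega> - lim_moment k))\<^sup>2 \<partial>M N) \<le>
          (\<integral>\<omega>. 2 * (cmod (wform N k r r \<omega> - ?m N))\<^sup>2 + 2 * (cmod (?m N - lim_moment k))\<^sup>2 \<partial>M N)"
      proof (rule integral_mono)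
        fix \<omega>
        let ?a = "cmod (wform N k r r \<omega> - ?m N)" and ?b = "cmod (?m N - lim_moment k)"
        have "cmod (wform N k r r \<omega> - lim_moment k) \<le> ?a + ?b"
          using norm_triangle_ineq[of "wform N k r r \<omega> - ?m N" "?m N - lim_moment k"] by simp
        then have "(cmod (wform N k r r \<omega> - lim_moment k))\<^sup>2 \<le> (?a + ?b)\<^sup>2" by (rule power_mono) simp
        also have "\<dots> \<le> 2 * ?a\<^sup>2 + 2 * ?b\<^sup>2"
          using sum_squares_bound[of ?a ?b] by (simp add: power2_sum)
        finally show "(cmod (wform N k r r \<omega> - lim_moment k))\<^sup>2 \<le> 2 * ?a\<^sup>2 + 2 * ?b\<^sup>2" .
      qed (use i in auto)
      also have "\<dots> = 2 * (\<integral>\<omega>. (cmod (wform N k r r \<omega> - ?m N))\<^sup>2 \<partial>M N) + 2 * (cmod (?m N - lim_moment k))\<^sup>2"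
        using i by (simp add: prob_space)
      also have "\<dots> \<le> 2 * (C / real N) + 2 * (cmod (?m N - lim_moment k))\<^sup>2" using C[OF N] by simp
      finally show "norm (\<integral>\<omega>. (cmod (wform N k r v \<omega> - (if r = v then lim_moment k else 0)))\<^sup>2 \<partial>M N) \<le>
          2 * (C / real N) + 2 * (cmod (?m N - lim_moment k))\<^sup>2"
        using True by (simp add: Bochner_Integration.integral_nonneg)
    qed
  qed
qed

text \<open>YZ - cd = (Y - c)(Z - d) + c(Z - d) + d(Y - c). The quadratic term is bounded by error
  moments of the doubled exponent \<open>p * 2\<close>.\<close>

lemma Lconv_mult:
  assumes Y: "Lconv Y c" and Z: "Lconv Z d"
  shows "Lconv (\<lambda>N \<omega>. Y N \<omega> * Z N \<omega>) (c * d)"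
  unfolding Lconv_def
proof (intro conjI allI impI)
  have fmY: "finite_moments (M N) (Y N)" and fmZ: "finite_moments (M N) (Z N)" if "N \<ge> 1" for N
    using Y Z that by (auto simp: Lconv_def)
  show "finite_moments (M N) (\<lambda>\<omega>. Y N \<omega> * Z N \<omega>)" if "N \<ge> 1" for N
    by (intro finite_moments_mult fmY fmZ that)
  fix p :: nat assume p: "p \<ge> 1"
  let ?y = "\<lambda>q N. \<integral>\<omega>. cmod (Y N \<omega> - c) ^ q \<partial>M N" and ?z = "\<lambda>q N. \<integral>\<omega>. cmod (Z N \<omega> - d) ^ q \<partial>M N"
  have ty: "(\<lambda>N. ?y q N) \<longlonglongrightarrow> 0" and tz: "(\<lambda>N. ?z q N) \<longlonglongrightarrow> 0" if "q \<ge> 1" for q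
    using Y Z that by (auto simp: Lconv_def)
  let ?B = "\<lambda>N. 2 ^ p * ((?y (p * 2) N + ?z (p * 2) N) + 2 ^ p * (cmod c ^ p * ?z p N + cmod d ^ p * ?y p N))"
  have tB: "?B \<longlonglongrightarrow> 0"
    using ty[of "p * 2"] tz[of "p * 2"] ty[of p] tz[of p] p by (auto intro!: tendsto_eq_intros)
  show "(\<lambda>N. \<integral>\<omega>. cmod (Y N \<omega> * Z N \<omega> - c * d) ^ p \<partial>M N) \<longlonglongrightarrow> 0"
  proof (rule Lim_null_comparison[OF _ tB], rule eventually_sequentiallyI[of 1])
    fix N :: nat assume N: "1 \<le> N"
    interpret prob_space "M N" by (rule prob) fact
    have i: "integrable (M N) (\<lambda>\<omega>. cmod (Y N \<omega> - c) ^ q)" "integrable (M N) (\<lambda>\<omega>. cmod (Z N \<omega> - d) ^ q)" for q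
      using fmY[OF N] fmZ[OF N] by (auto intro!: finite_moments_norm_power finite_moments_diff_const)
    have "(\<integral>\<omega>. cmod (Y N \<omega> * Z N \<omega> - c * d) ^ p \<partial>M N) \<le>
        (\<integral>\<omega>. 2 ^ p * ((cmod (Y N \<omega> - c) ^ (p * 2) + cmod (Z N \<omega> - d) ^ (p * 2)) +
          2 ^ p * (cmod c ^ p * cmod (Z N \<omega> - d) ^ p + cmod d ^ p * cmod (Y N \<omega> - c) ^ p)) \<partial>M N)"
    proof (rule integral_mono)
      show "integrable (M N) (\<lambda>\<omega>. cmod (Y N \<omega> * Z N \<omega> - c * d) ^ p)"
        by (intro finite_moments_norm_power finite_moments_diff_const finite_moments_mult fmY[OF N] fmZ[OF N])
      show "integrable (M N) (\<lambda>\<omega>. 2 ^ p * ((cmod (Y N \<omega> - c) ^ (p * 2) + cmod (Z N \<omega> - d) ^ (p * 2)) +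
          2 ^ p * (cmod c ^ p * cmod (Z N \<omega> - d) ^ p + cmod d ^ p * cmod (Y N \<omega> - c) ^ p)))"
        by (intro integrable_mult_right Bochner_Integration.integrable_add i)
      fix \<omega>
      define a where "a = cmod (Y N \<omega> - c)"
      define b where "b = cmod (Z N \<omega> - d)"
      have nn: "0 \<le> a" "0 \<le> b" by (auto simp: a_def b_def)
      have "Y N \<omega> * Z N \<omega> - c * d = (Y N \<omega> - c) * (Z N \<omega> - d) + (c * (Z N \<omega> - d) + d * (Y N \<omega> - c))"
        by (simp add: algebra_simps)
      then have "cmod (Y N \<omega> * Z N \<omega> - c * d) \<le> a * b + (cmod c * b + cmod d * a)"
        unfolding a_def b_def by (simp only:, intro norm_triangle_le add_mono order_refl) (auto simp: norm_mult)
      then have "cmod (Y N \<omega> * Z N \<omega> - c * d) ^ p \<le> (a * b + (cmod c * b + cmod d * a)) ^ p"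
        by (rule power_mono) simp
      also have "\<dots> \<le> 2 ^ p * ((a * b) ^ p + (cmod c * b + cmod d * a) ^ p)"
        using nn by (intro add_power_le) auto
      also have "\<dots> \<le> 2 ^ p * ((a ^ (p * 2) + b ^ (p * 2)) + 2 ^ p * (cmod c ^ p * b ^ p + cmod d ^ p * a ^ p))"
      proof (intro mult_left_mono add_mono)
        show "(a * b) ^ p \<le> a ^ (p * 2) + b ^ (p * 2)"
          using mult_le_sum_squares[of "a ^ p" "b ^ p"] by (simp add: power_mult_distrib power_mult)
        show "(cmod c * b + cmod d * a) ^ p \<le> 2 ^ p * (cmod c ^ p * b ^ p + cmod d ^ p * a ^ p)"
          using add_power_le[of "cmod c * b" "cmod d * a" p] nn by (simp add: power_mult_distrib)
      qed auto
      finally show "cmod (Y N \<omega> * Z N \<omega> - c * d) ^ p \<le> 2 ^ p * ((a ^ (p * 2) + b ^ (p * 2)) +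
        2 ^ p * (cmod c ^ p * b ^ p + cmod d ^ p * a ^ p))" .
    qed
    also have "\<dots> = ?B N"
      using i by (simp add: Bochner_Integration.integral_add)
    finally show "norm (\<integral>\<omega>. cmod (Y N \<omega> * Z N \<omega> - c * d) ^ p \<partial>M N) \<le> ?B N"
      by (simp add: Bochner_Integration.integral_nonneg)
  qed
qed

lemma Lconv_mean_tendsto:
  assumes "Lconv Y c"
  shows "(\<lambda>N. \<integral>\<omega>. Y N \<omega> \<partial>M N) \<longlonglongrightarrow> c"
proof -
  have t: "(\<lambda>N. \<integral>\<omega>. cmod (Y N \<omega> - c) ^ 1 \<partial>M N) \<longlonglongrightarrow> 0" using assms unfolding Lconv_def by blast
  have "(\<lambda>N. (\<integral>\<omega>. Y N \<omega> \<partial>M N) - c) \<longlonglongrightarrow> 0"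
  proof (rule Lim_null_comparison[OF _ t], rule eventually_sequentiallyI[of 1])
    fix N :: nat assume N: "1 \<le> N"
    interpret prob_space "M N" by (rule prob) fact
    have "integrable (M N) (Y N)" using assms N finite_moments_integrable by (auto simp: Lconv_def)
    then have "(\<integral>\<omega>. Y N \<omega> \<partial>M N) - c = (\<integral>\<omega>. Y N \<omega> - c \<partial>M N)" by (simp add: prob_space)
    then show "norm ((\<integral>\<omega>. Y N \<omega> \<partial>M N) - c) \<le> (\<integral>\<omega>. cmod (Y N \<omega> - c) ^ 1 \<partial>M N)" by simp
  qed
  then show ?thesis by (simp add: LIM_zero_iff)
qed

end

section \<open>Limits of words\<close>

text \<open>
  A letter other than \<open>Wigner\<close> stands for the rank one matrix \<open>x y\<^sup>T\<close>, with \<open>x\<close> its left and \<open>y\<close> its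
  right vector; the values at \<open>Wigner\<close> are junk.
\<close>

fun left_vec :: "ensemble_index \<Rightarrow> nat option" where
  "left_vec (MatUnit j k) = Some j"
| "left_vec _ = None"

fun right_vec :: "ensemble_index \<Rightarrow> nat option" where
  "right_vec (MatUnit j k) = Some k"
| "right_vec _ = None"

text \<open>
  The word is read cyclically: \<open>r\<close> is the right vector of the last rank one letter, \<open>k\<close> the number
  of letters \<open>Wigner\<close> read since, \<open>k0\<close> the number of letters \<open>Wigner\<close> at the very beginning of the
  word, and \<open>v\<close> the left vector of its first rank one letter.
\<close>

fun cyclic_weight :: "(nat \<Rightarrow> complex) \<Rightarrow> nat option \<Rightarrow> nat \<Rightarrow> nat \<Rightarrow> nat option \<Rightarrow> ensemble_index list \<Rightarrow> complex" where
  "cyclic_weight m r k k0 v [] = (if r = v then m (k + k0) else 0)"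
| "cyclic_weight m r k k0 v (Wigner # l) = cyclic_weight m r (Suc k) k0 v l"
| "cyclic_weight m r k k0 v (z # l) =
     (if r = left_vec z then m k else 0) * cyclic_weight m (right_vec z) 0 k0 v l"

text \<open>The limit of the trace without normalisation, after subtraction of N times the limit for
  words in \<open>Wigner\<close> alone. The first rank one letter opens the cycle: reading starts at
  its right vector and has to close at its left vector.\<close>

fun inf_weight :: "(nat \<Rightarrow> complex) \<Rightarrow> (nat \<Rightarrow> complex) \<Rightarrow> nat \<Rightarrow> ensemble_index list \<Rightarrow> complex" where
  "inf_weight m n k0 [] = n k0"
| "inf_weight m n k0 (Wigner # l) = inf_weight m n (Suc k0) l"
| "inf_weight m n k0 (z # l) = cyclic_weight m (right_vec z) 0 k0 (left_vec z) l"

text \<open>A rank one letter keeps the trace bounded in the limit, so division by N leaves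
  0.\<close>

definition lim_weight :: "(nat \<Rightarrow> complex) \<Rightarrow> ensemble_index list \<Rightarrow> complex" where
  "lim_weight m l = (if set l \<subseteq> {Wigner} then m (length l) else 0)"

abbreviation nc_words :: "'i ncpoly \<Rightarrow> 'i ncword set" where
  "nc_words \<equiv> Poly_Mapping.keys"

definition linear_ext :: "('i list \<Rightarrow> complex) \<Rightarrow> 'i ncpoly \<Rightarrow> complex" where
  "linear_ext f P = (\<Sum>w\<in>nc_words P. Poly_Mapping.lookup P w * f (letters w))"

lemma cyclic_weight_finite:
  "z \<noteq> Wigner \<Longrightarrow> cyclic_weight m r k k0 v (z # l) =
     (if r = left_vec z then m k else 0) * cyclic_weight m (right_vec z) 0 k0 v l"
  by (cases z) auto

lemma inf_weight_finite:
  "z \<noteq> Wigner \<Longrightarrow> inf_weight m n k0 (z # l) = cyclic_weight m (right_vec z) 0 k0 (left_vec z) l"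
  by (cases z) auto

lemma inf_weight_replicate:
  "inf_weight m n k0 (replicate k Wigner @ l) = inf_weight m n (k0 + k) l"
  by (induction k arbitrary: k0) auto

section \<open>Traces of words as products of bilinear forms\<close>

lemma eval_word_carrier:
  assumes "\<And>i. A i \<in> carrier_mat N N"
  shows "eval_word N A w \<in> carrier_mat N N"
proof -
  have "foldr (\<lambda>i B. A i * B) l (1\<^sub>m N) \<in> carrier_mat N N" for l
    by (induction l) (auto intro: mult_carrier_mat assms)
  then show ?thesis by (simp add: eval_word_def)
qed

lemma mat_trace_eval_nc:
  assumes "\<And>i. A i \<in> carrier_mat N N"
  shows "mat_trace (eval_nc N A P) =
    (\<Sum>w\<in>nc_words P. Poly_Mapping.lookup P w * mat_trace (eval_word N A w))"
proof -
  have "mat_trace (eval_nc N A P) =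
      (\<Sum>j<N. \<Sum>w\<in>nc_words P. Poly_Mapping.lookup P w * eval_word N A w $$ (j, j))"
    by (simp add: mat_trace_def eval_nc_def)
  also have "\<dots> = (\<Sum>w\<in>nc_words P. \<Sum>j<N. Poly_Mapping.lookup P w * eval_word N A w $$ (j, j))"
    by (rule sum.swap)
  also have "\<dots> = (\<Sum>w\<in>nc_words P. Poly_Mapping.lookup P w * mat_trace (eval_word N A w))"
    using carrier_matD(1)[OF eval_word_carrier[of A N, OF assms]]
    by (simp add: mat_trace_def sum_distrib_left)
  finally show ?thesis .
qed

context wigner_ensemble begin

definition letter_op :: "nat \<Rightarrow> 'w \<Rightarrow> ensemble_index \<Rightarrow> (nat \<Rightarrow> complex) \<Rightarrow> nat \<Rightarrow> complex" where
  "letter_op N \<omega> z x a = (if z = Wigner then wop N \<omega> x a else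
     tvec N (left_vec z) a * (\<Sum>b<N. tvec N (right_vec z) b * x b))"

lemma ensemble_carrier: "ensemble X i N \<omega> \<in> carrier_mat N N"
  by (cases i) (auto simp: wigner_matrix_def matrix_unit_def all_ones_def)

lemma ensemble_entry:
  assumes "a < N" "b < N"
  shows "ensemble X i N \<omega> $$ (a, b) = (if i = Wigner then entry N \<omega> (a, b) / of_real (sqrt (real N))
    else tvec N (left_vec i) a * tvec N (right_vec i) b)"
proof (cases i)
  case Ones
  have "1 / complex_of_nat N = rsqrt N * (rsqrt N)"
    by (simp flip: of_real_mult)
  then show ?thesis using assms by (simp add: Ones all_ones_def tvec_def)
qed (use assms in \<open>auto simp: wigner_matrix_def matrix_unit_def entry_def tvec_def\<close>)

lemma letter_op_ensemble:
  assumes "a < N"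
  shows "letter_op N \<omega> i x a = (\<Sum>b<N. ensemble X i N \<omega> $$ (a, b) * x b)"
  using assms by (simp add: letter_op_def wop_def ensemble_entry sum_distrib_left mult.assoc)

lemma eval_word_entry:
  assumes "a < N" "b < N"
  shows "eval_word N (\<lambda>i. ensemble X i N \<omega>) w $$ (a, b) =
    foldr (letter_op N \<omega>) (letters w) (tvec N (Some b)) a"
proof -
  let ?A = "\<lambda>i. ensemble X i N \<omega>"
  let ?B = "\<lambda>l. foldr (\<lambda>i B. ?A i * B) l (1\<^sub>m N)"
  have car: "?B l \<in> carrier_mat N N" for l
    using eval_word_carrier[of ?A N "NCWord l", OF ensemble_carrier] by (simp add: eval_word_def)
  have "?B l $$ (a, b) = foldr (letter_op N \<omega>) l (tvec N (Some b)) a" for l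
    using assms(1)
  proof (induction l arbitrary: a)
    case Nil
    then show ?case using assms by (simp add: tvec_def)
  next
    case (Cons i l)
    have "?B (i # l) $$ (a, b) = (\<Sum>c<N. ?A i $$ (a, c) * ?B l $$ (c, b))"
      using Cons.prems assms(2) car[of l] ensemble_carrier[of i N \<omega>]
      by (simp add: scalar_prod_def atLeast0LessThan)
    also have "\<dots> = (\<Sum>c<N. ?A i $$ (a, c) * foldr (letter_op N \<omega>) l (tvec N (Some b)) c)"
      using Cons.IH by simp
    finally show ?case using Cons.prems by (simp add: letter_op_ensemble)
  qed
  then show ?thesis by (simp add: eval_word_def)
qed

definition word_trace :: "nat \<Rightarrow> 'w \<Rightarrow> ensemble_index list \<Rightarrow> complex" where
  "word_trace N \<omega> l = (\<Sum>b<N. foldr (letter_op N \<omega>) l (tvec N (Some b)) b)"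

lemma mat_trace_word:
  "mat_trace (eval_word N (\<lambda>i. ensemble X i N \<omega>) w) = word_trace N \<omega> (letters w)"
  using eval_word_carrier[of "\<lambda>i. ensemble X i N \<omega>" N w, OF ensemble_carrier]
  by (auto simp: mat_trace_def word_trace_def eval_word_entry intro!: sum.cong)

lemma foldr_letter_op_linear:
  assumes "a < N"
  shows "foldr (letter_op N \<omega>) l x a = (\<Sum>b<N. x b * foldr (letter_op N \<omega>) l (tvec N (Some b)) a)"
  using assms
proof (induction l arbitrary: a)
  case Nil
  have "(\<Sum>b<N. x b * tvec N (Some b) a) = (\<Sum>b<N. if b = a then x b else 0)"
    by (rule sum.cong) (auto simp: tvec_def)
  then show ?case using Nil by simp
next
  case (Cons i l)
  let ?T = "\<lambda>x. foldr (letter_op N \<omega>) l x"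
  have "letter_op N \<omega> i (?T x) a = (\<Sum>c<N. \<Sum>b<N. ensemble X i N \<omega> $$ (a, c) * (x b * ?T (tvec N (Some b)) c))"
    using Cons by (simp add: letter_op_ensemble sum_distrib_left)
  also have "\<dots> = (\<Sum>b<N. x b * letter_op N \<omega> i (?T (tvec N (Some b))) a)"
    using Cons.prems by (subst sum.swap) (simp add: letter_op_ensemble sum_distrib_left mult_ac)
  finally show ?case by simp
qed

lemma wop_power_scale: "(wop N \<omega> ^^ k) (\<lambda>a. x a * c) = (\<lambda>a. (wop N \<omega> ^^ k) x a * c)"
  by (induction k) (simp_all add: wop_def sum_distrib_right mult.assoc fun_eq_iff)

text \<open>The random counterpart of \<open>cyclic_weight\<close>: the form of \<open>r\<close> and
  \<open>v\<close> for the product of \<open>k\<close> letters \<open>Wigner\<close>, the word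
  \<open>l\<close> and \<open>k0\<close> letters \<open>Wigner\<close>.\<close>

definition cyclic_form :: "nat \<Rightarrow> nat option \<Rightarrow> nat \<Rightarrow> nat \<Rightarrow> nat option \<Rightarrow> ensemble_index list \<Rightarrow> 'w \<Rightarrow> complex" where
  "cyclic_form N r k k0 v l \<omega> =
     (\<Sum>a<N. tvec N r a * (wop N \<omega> ^^ k) (foldr (letter_op N \<omega>) l ((wop N \<omega> ^^ k0) (tvec N v))) a)"

lemma cyclic_form_Nil: "cyclic_form N r k k0 v [] \<omega> = wform N (k + k0) r v \<omega>"
  by (simp add: cyclic_form_def wform_wop funpow_add)

lemma letter_op_Wigner: "letter_op N \<omega> Wigner = wop N \<omega>"
  by (simp add: letter_op_def fun_eq_iff)

lemma cyclic_form_Wigner: "cyclic_form N r k k0 v (Wigner # l) \<omega> = cyclic_form N r (Suc k) k0 v l \<omega>"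
  by (simp add: cyclic_form_def letter_op_Wigner funpow_swap1)

text \<open>A rank one letter cuts the product: what precedes it becomes a \<open>wform\<close>, and
  a new form starts at its right vector. The recursion of \<open>cyclic_weight\<close> mirrors
  this.\<close>

lemma cyclic_form_finite:
  assumes "z \<noteq> Wigner"
  shows "cyclic_form N r k k0 v (z # l) \<omega> =
    wform N k r (left_vec z) \<omega> * cyclic_form N (right_vec z) 0 k0 v l \<omega>"
proof -
  have "letter_op N \<omega> z x = (\<lambda>a. tvec N (left_vec z) a * (\<Sum>b<N. tvec N (right_vec z) b * x b))" for x
    using assms by (simp add: letter_op_def fun_eq_iff)
  then show ?thesis
    by (simp add: cyclic_form_def wop_power_scale wform_wop sum_distrib_right mult.assoc)
qed

lemma Lconv_cyclic_form: "Lconv (\<lambda>N. cyclic_form N r k k0 v l) (cyclic_weight lim_moment r k k0 v l)"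
proof (induction l arbitrary: r k)
  case Nil
  show ?case using Lconv_wform[of "k + k0" r v] by (simp add: cyclic_form_Nil[abs_def])
next
  case (Cons z l)
  show ?case
  proof (cases "z = Wigner")
    case True
    then show ?thesis using Cons by (simp add: cyclic_form_Wigner[abs_def])
  next
    case False
    show ?thesis
      unfolding cyclic_weight_finite[OF False] cyclic_form_finite[OF False, abs_def]
      by (intro Lconv_mult Lconv_wform Cons)
  qed
qed

text \<open>Cyclicity of the trace: for z = x y^T, the trace of W^k0 x y^T l is <y, l W^k0
  x>.\<close>

lemma word_trace_finite:
  assumes "z \<noteq> Wigner"
  shows "word_trace N \<omega> (replicate k0 Wigner @ z # l) = cyclic_form N (right_vec z) 0 k0 (left_vec z) l \<omega>"
proof -
  let ?T = "\<lambda>x. foldr (letter_op N \<omega>) l x"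
  let ?y = "(wop N \<omega> ^^ k0) (tvec N (left_vec z))"
  have z: "letter_op N \<omega> z x = (\<lambda>a. tvec N (left_vec z) a * (\<Sum>b<N. tvec N (right_vec z) b * x b))" for x
    using assms by (simp add: letter_op_def fun_eq_iff)
  have "word_trace N \<omega> (replicate k0 Wigner @ z # l) =
      (\<Sum>b<N. \<Sum>c<N. ?y b * (tvec N (right_vec z) c * ?T (tvec N (Some b)) c))"
    by (simp add: word_trace_def letter_op_Wigner z wop_power_scale) (simp add: sum_distrib_left)
  also have "\<dots> = (\<Sum>c<N. tvec N (right_vec z) c * (\<Sum>b<N. ?y b * ?T (tvec N (Some b)) c))"
    by (subst sum.swap) (simp add: sum_distrib_left mult_ac)
  also have "\<dots> = (\<Sum>c<N. tvec N (right_vec z) c * ?T ?y c)"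
    by (intro sum.cong refl) (simp add: foldr_letter_op_linear[of _ N \<omega> l ?y])
  finally show ?thesis by (simp add: cyclic_form_def)
qed

lemma word_trace_Wigner:
  "word_trace N \<omega> (replicate k Wigner) = (\<Sum>b<N. wform N k (Some b) (Some b) \<omega>)"
proof -
  have "wform N k (Some b) (Some b) \<omega> = (wop N \<omega> ^^ k) (tvec N (Some b)) b" if "b < N" for b
  proof -
    have "wform N k (Some b) (Some b) \<omega> = (\<Sum>a<N. if a = b then (wop N \<omega> ^^ k) (tvec N (Some b)) a else 0)"
      unfolding wform_wop by (rule sum.cong) (auto simp: tvec_def)
    then show ?thesis using that by simp
  qed
  then show ?thesis by (simp add: word_trace_def letter_op_Wigner)
qed

lemma word_cases:
  obtains (Wigner) "l = replicate (length l) Wigner"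
  | (finite) k z l' where "l = replicate k Wigner @ z # l'" "z \<noteq> Wigner"
proof (cases "set l \<subseteq> {Wigner}")
  case True
  then have "l = replicate (length l) Wigner" by (induction l) auto
  then show ?thesis using Wigner by blast
next
  case False
  let ?t = "takeWhile (\<lambda>z. z = Wigner) l" and ?d = "dropWhile (\<lambda>z. z = Wigner) l"
  have "?t = replicate (length ?t) Wigner"
    using set_takeWhileD[of _ "\<lambda>z. z = Wigner" l] by (intro replicate_eqI) auto
  moreover have "?d \<noteq> []" using False by (auto simp: dropWhile_eq_Nil_conv)
  then obtain z l' where d: "?d = z # l'" by (cases ?d) auto
  moreover have "z \<noteq> Wigner" using hd_dropWhile[of "\<lambda>z. z = Wigner" l] \<open>?d \<noteq> []\<close> d by auto
  moreover have "l = ?t @ ?d" by simp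
  ultimately show ?thesis using finite by metis
qed

abbreviation word_mean :: "nat \<Rightarrow> ensemble_index list \<Rightarrow> complex" where
  "word_mean N l \<equiv> 1 / of_nat N * (\<integral>\<omega>. word_trace N \<omega> l \<partial>M N)"

text \<open>Powers of \<open>Wigner\<close> alone use the expansion of the diagonal means. Any other
  word has a trace converging without normalisation, so its normalised mean tends to 0 and N times
  that mean is the mean of the trace itself.\<close>

lemma word_trace_limits:
  shows integrable_word_trace: "N \<ge> 1 \<Longrightarrow> integrable (M N) (\<lambda>\<omega>. word_trace N \<omega> l)" (is "_ \<Longrightarrow> ?I")
    and word_trace_tendsto: "(\<lambda>N. word_mean N l) \<longlonglongrightarrow> lim_weight lim_moment l" (is ?A)
    and word_trace_inf_tendsto: "(\<lambda>N. of_nat N * (word_mean N l - lim_weight lim_moment l))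
      \<longlonglongrightarrow> inf_weight lim_moment inf_moment 0 l" (is ?B)
proof -
  have "(N \<ge> 1 \<longrightarrow> ?I) \<and> ?A \<and> ?B"
  proof (cases l rule: word_cases)
    case Wigner
    define k where "k = length l"
    have l: "l = replicate k Wigner" using Wigner by (simp add: k_def)
    have i: "integrable (M N) (wform N k (Some b) (Some b))" if "N \<ge> 1" for N b
      using that by (intro finite_moments_integrable finite_moments_wform)
    have m: "(\<integral>\<omega>. word_trace N \<omega> l \<partial>M N) = (\<Sum>b<N. closed_mean N k b)" for N
    proof (cases "N = 0")
      case False
      then have N: "N \<ge> 1" by simp
      have "(\<integral>\<omega>. word_trace N \<omega> l \<partial>M N) = (\<Sum>b<N. \<integral>\<omega>. wform N k (Some b) (Some b) \<omega> \<partial>M N)"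
        unfolding l word_trace_Wigner using i[OF N] by (rule Bochner_Integration.integral_sum)
      then show ?thesis using mean_wform_diag[OF N] by simp
    qed (simp add: word_trace_def)
    have "lim_weight lim_moment l = lim_moment k"
      by (auto simp: l lim_weight_def)
    moreover have "inf_weight lim_moment inf_moment 0 l = inf_moment k"
      using inf_weight_replicate[of lim_moment inf_moment 0 k "[]"] by (simp add: l)
    ultimately show ?thesis
      using closed_mean_average_tendsto[of k] closed_mean_average_expansion[of k] i
      by (auto simp: m) (simp add: l word_trace_Wigner)
  next
    case (finite k0 z l')
    have L: "Lconv (\<lambda>N \<omega>. word_trace N \<omega> l) (inf_weight lim_moment inf_moment 0 l)"
      using Lconv_cyclic_form[of "right_vec z" 0 k0 "left_vec z" l'] finite(2)
      unfolding finite(1) inf_weight_replicate inf_weight_finite[OF finite(2)] word_trace_finite[OF finite(2)]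
      by simp
    have lw: "lim_weight lim_moment l = 0" using finite by (auto simp: lim_weight_def)
    have t: "(\<lambda>N. \<integral>\<omega>. word_trace N \<omega> l \<partial>M N) \<longlonglongrightarrow> inf_weight lim_moment inf_moment 0 l"
      by (rule Lconv_mean_tendsto[OF L])
    have "(\<lambda>N. word_mean N l) \<longlonglongrightarrow> 0 * inf_weight lim_moment inf_moment 0 l"
      by (intro tendsto_mult lim_const_over_n t)
    moreover have "(\<lambda>N. of_nat N * (word_mean N l - 0))
      \<longlonglongrightarrow> inf_weight lim_moment inf_moment 0 l"
      by (rule Lim_transform_eventually[OF t], rule eventually_sequentiallyI[of 1]) simp
    moreover have "N \<ge> 1 \<longrightarrow> integrable (M N) (\<lambda>\<omega>. word_trace N \<omega> l)"
      using L finite_moments_integrable by (auto simp: Lconv_def)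
    ultimately show ?thesis by (simp add: lw)
  qed
  then show "N \<ge> 1 \<Longrightarrow> ?I" ?A ?B by blast+
qed

lemma mean_distribution_word_trace:
  assumes "N \<ge> 1"
  shows "mean_distribution M (ensemble X) N P =
    (\<Sum>w\<in>nc_words P. Poly_Mapping.lookup P w * (word_mean N (letters w)))"
proof -
  have "(\<integral>\<omega>. mat_trace (eval_nc N (\<lambda>i. ensemble X i N \<omega>) P) \<partial>M N) =
      (\<integral>\<omega>. (\<Sum>w\<in>nc_words P. Poly_Mapping.lookup P w * word_trace N \<omega> (letters w)) \<partial>M N)"
    by (simp add: mat_trace_eval_nc[OF ensemble_carrier] mat_trace_word)
  also have "\<dots> = (\<Sum>w\<in>nc_words P. Poly_Mapping.lookup P w * (\<integral>\<omega>. word_trace N \<omega> (letters w) \<partial>M N))"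
    using integrable_word_trace[OF assms] by (subst Bochner_Integration.integral_sum) auto
  finally show ?thesis by (simp add: mean_distribution_def sum_distrib_left mult_ac sum_divide_distrib)
qed

lemma ensemble_infinitesimal_distribution:
  "has_infinitesimal_distribution M I (ensemble X)
     (linear_ext (lim_weight lim_moment)) (linear_ext (inf_weight lim_moment inf_moment 0))"
  unfolding has_infinitesimal_distribution_def
proof (intro ballI conjI)
  fix P :: "ensemble_index ncpoly"
  let ?t = "\<lambda>N w. word_mean N (letters w)"
  have "(\<lambda>N. \<Sum>w\<in>nc_words P. Poly_Mapping.lookup P w * ?t N w) \<longlonglongrightarrow> linear_ext (lim_weight lim_moment) P"
    unfolding linear_ext_def by (intro tendsto_sum tendsto_mult tendsto_const word_trace_tendsto)
  then show "(\<lambda>N. mean_distribution M (ensemble X) N P) \<longlonglongrightarrow> linear_ext (lim_weight lim_moment) P"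
    by (rule Lim_transform_eventually, intro eventually_sequentiallyI[of 1]) (simp only: mean_distribution_word_trace)
  have "(\<lambda>N. \<Sum>w\<in>nc_words P. Poly_Mapping.lookup P w *
      (of_nat N * (?t N w - lim_weight lim_moment (letters w)))) \<longlonglongrightarrow> linear_ext (inf_weight lim_moment inf_moment 0) P"
    unfolding linear_ext_def by (intro tendsto_sum tendsto_mult tendsto_const word_trace_inf_tendsto)
  then show "(\<lambda>N. of_nat N * (mean_distribution M (ensemble X) N P - linear_ext (lim_weight lim_moment) P))
      \<longlonglongrightarrow> linear_ext (inf_weight lim_moment inf_moment 0) P"
  proof (rule Lim_transform_eventually, intro eventually_sequentiallyI[of 1])
    fix N :: nat assume "1 \<le> N"
    then show "(\<Sum>w\<in>nc_words P. Poly_Mapping.lookup P w * (of_nat N * (?t N w - lim_weight lim_moment (letters w)))) =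
        of_nat N * (mean_distribution M (ensemble X) N P - linear_ext (lim_weight lim_moment) P)"
      unfolding mean_distribution_word_trace[OF \<open>1 \<le> N\<close>] linear_ext_def sum_subtractf[symmetric] sum_distrib_left
      by (intro sum.cong refl) (simp only: right_diff_distrib mult_ac)
  qed
qed

lemma ensemble_random_matrix:
  assumes "N \<ge> 1"
  shows "random_matrix (M N) N (ensemble X i N)"
proof -
  interpret prob_space "M N" by (rule prob) fact
  have "finite_moments (M N) (\<lambda>\<omega>. ensemble X i N \<omega> $$ (j, k))" if "j < N" "k < N" for j k
  proof (cases "i = Wigner")
    case True
    have "finite_moments (M N) (\<lambda>\<omega>. entry N \<omega> (j, k) * (rsqrt N))"
      using that by (intro finite_moments_mult finite_moments_const finite_moments_entry) auto
    moreover have "ensemble X i N \<omega> $$ (j, k) = entry N \<omega> (j, k) * (rsqrt N)" for \<omega>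
      unfolding ensemble_entry[OF that] using True by simp
    ultimately show ?thesis by (simp only:)
  next
    case False
    then show ?thesis unfolding ensemble_entry[OF that] by (simp add: finite_moments_const)
  qed
  then show ?thesis
    unfolding random_matrix_def finite_moments_def using ensemble_carrier by blast
qed

lemma lim_moment_0: "lim_moment 0 = 1" and inf_moment_0: "inf_moment 0 = 0"
proof -
  have c: "closed_mean N 0 j = 1" if "j < N" for N j
  proof -
    interpret prob_space "M N" by (rule prob) (use that in simp)
    have "{p \<in> walks N 0. hd p = j \<and> last p = j} = {[j]}"
      using that by (auto simp: walks_def length_Suc_conv)
    then show ?thesis by (simp add: closed_mean_def step_mean_def step_prod_def prob_space)
  qed
  have "(\<lambda>N. closed_mean N 0 0) \<longlonglongrightarrow> 1"
    by (rule Lim_transform_eventually[OF tendsto_const], rule eventually_sequentiallyI[of 1]) (simp add: c)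
  then show 1: "lim_moment 0 = 1" using LIMSEQ_unique closed_mean_tendsto by blast
  have "(\<lambda>N. of_nat N * (1 / of_nat N * (\<Sum>j<N. closed_mean N 0 j) - lim_moment 0)) \<longlonglongrightarrow> 0"
    by (rule Lim_transform_eventually[OF tendsto_const], rule eventually_sequentiallyI[of 1]) (simp add: c 1)
  then show "inf_moment 0 = 0" using LIMSEQ_unique closed_mean_average_expansion by blast
qed

end

section \<open>Infinitesimal freeness of the limit functionals\<close>

lemma linear_ext_superset:
  assumes "finite K" "nc_words P \<subseteq> K"
  shows "linear_ext f P = (\<Sum>w\<in>K. Poly_Mapping.lookup P w * f (letters w))"
  unfolding linear_ext_def
  by (rule sum.mono_neutral_left) (use assms in \<open>auto simp: in_keys_iff\<close>)

lemma linear_ext_zero [simp]: "linear_ext f 0 = 0"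
  by (simp add: linear_ext_def)

lemma linear_ext_add: "linear_ext f (P + Q) = linear_ext f P + linear_ext f Q"
proof -
  let ?K = "nc_words P \<union> nc_words Q"
  have "nc_words (P + Q) \<subseteq> ?K" by (rule Poly_Mapping.keys_add)
  then show ?thesis
    using linear_ext_superset[of ?K P f] linear_ext_superset[of ?K Q f] linear_ext_superset[of ?K "P + Q" f]
    by (simp add: lookup_add distrib_right sum.distrib)
qed

lemma linear_ext_scale: "linear_ext f (nc_scale c P) = c * linear_ext f P"
proof -
  have "nc_words (nc_scale c P) \<subseteq> nc_words P" by (auto simp: in_keys_iff)
  then show ?thesis
    using linear_ext_superset[of "nc_words P" "nc_scale c P" f]
    by (simp add: linear_ext_def sum_distrib_left mult.assoc)
qed

lemma linear_ext_single: "linear_ext f (Poly_Mapping.single w c) = c * f (letters w)"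
  using linear_ext_superset[of "{w}" "Poly_Mapping.single w c" f] by simp

lemma linear_ext_one: "linear_ext f 1 = f []"
  unfolding single_one[symmetric] linear_ext_single by (simp add: zero_ncword_def)

lemma linear_ext_cong:
  assumes "\<And>w. w \<in> nc_words P \<Longrightarrow> f (letters w) = g (letters w)"
  shows "linear_ext f P = linear_ext g P"
  unfolding linear_ext_def by (rule sum.cong) (simp_all add: assms)

lemma linear_ext_cmult: "linear_ext (\<lambda>w. c * f w) P = c * linear_ext f P"
  by (simp add: linear_ext_def sum_distrib_left mult.left_commute)

lemma linear_ext_mult_const: "linear_ext (\<lambda>w. f w * c) P = linear_ext f P * c"
  by (simp add: linear_ext_def sum_distrib_right mult.assoc)

lemma linear_ext_const_zero [simp]: "linear_ext (\<lambda>_. 0) P = 0"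
  by (simp add: linear_ext_def)

lemma letters_add: "letters (u + v) = letters u @ letters v"
  by (simp add: plus_ncword_def)

text \<open>Reduces identities for functionals of products to identities for concatenated
  words.\<close>

lemma linear_ext_mult:
  "linear_ext f (P * Q) = linear_ext (\<lambda>u. linear_ext (\<lambda>v. f (u @ v)) Q) P"
proof (induction P rule: nc_poly_induct)
  case (add w b P)
  have "linear_ext f (Poly_Mapping.single w b * Q) = b * linear_ext (\<lambda>v. f (letters w @ v)) Q"
    by (induction Q rule: nc_poly_induct)
      (simp_all add: distrib_left linear_ext_add linear_ext_single mult_single letters_add)
  then show ?case using add by (simp add: distrib_right linear_ext_add linear_ext_single)
qed simp

lemma keys_nc_mult:
  assumes "w \<in> nc_words (P * Q)"
  obtains u v where "u \<in> nc_words P" "v \<in> nc_words Q" "letters w = letters u @ letters v"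
  using assms Poly_Mapping.keys_mult[of P Q] by (auto simp: letters_add)

definition ends_in :: "'i set \<Rightarrow> 'i ncpoly \<Rightarrow> bool" where
  "ends_in T P \<longleftrightarrow> (\<forall>w\<in>nc_words P. letters w \<noteq> [] \<and> last (letters w) \<in> T)"

definition starts_in :: "'i set \<Rightarrow> 'i ncpoly \<Rightarrow> bool" where
  "starts_in T P \<longleftrightarrow> (\<forall>w\<in>nc_words P. letters w \<noteq> [] \<and> hd (letters w) \<in> T)"

definition meets :: "'i set \<Rightarrow> 'i ncpoly \<Rightarrow> bool" where
  "meets T P \<longleftrightarrow> (\<forall>w\<in>nc_words P. set (letters w) \<inter> T \<noteq> {})"

lemma ends_in_mult: "ends_in T Q \<Longrightarrow> ends_in T (P * Q)"
  unfolding ends_in_def by (metis append_is_Nil_conv keys_nc_mult last_appendR)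

lemma starts_in_mult: "starts_in T P \<Longrightarrow> starts_in T (P * Q)"
  unfolding starts_in_def by (metis append_is_Nil_conv keys_nc_mult hd_append2)

lemma ends_inE:
  assumes "ends_in T P" "w \<in> nc_words P"
  obtains u x where "letters w = u @ [x]" "x \<in> T"
proof
  show "letters w = butlast (letters w) @ [last (letters w)]" "last (letters w) \<in> T"
    using assms by (auto simp: ends_in_def)
qed

lemma starts_inE:
  assumes "starts_in T P" "w \<in> nc_words P"
  obtains y u where "letters w = y # u" "y \<in> T"
proof
  show "letters w = hd (letters w) # tl (letters w)" "hd (letters w) \<in> T"
    using assms by (auto simp: starts_in_def)
qed

lemma meets_mult:
  assumes "meets T P \<or> meets T Q" shows "meets T (P * Q)"
  unfolding meets_def
proof
  fix w assume "w \<in> nc_words (P * Q)"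
  then obtain u v where "u \<in> nc_words P" "v \<in> nc_words Q" "letters w = letters u @ letters v"
    by (rule keys_nc_mult)
  then show "set (letters w) \<inter> T \<noteq> {}" using assms by (fastforce simp: meets_def)
qed

lemma meets_prod_list: "x \<in> set xs \<Longrightarrow> meets T x \<Longrightarrow> meets T (prod_list xs)"
  by (induction xs) (auto intro: meets_mult)

lemma linear_ext_lim_weight_meets:
  assumes "meets (- {Wigner}) P"
  shows "linear_ext (lim_weight m) P = 0"
proof -
  have "linear_ext (lim_weight m) P = linear_ext (\<lambda>_. 0) P"
    by (rule linear_ext_cong) (use assms in \<open>auto simp: meets_def lim_weight_def\<close>)
  then show ?thesis by simp
qed

text \<open>A word without \<open>Wigner\<close> has \<open>lim_weight\<close> 0 unless it is empty,
  so the functional reads off the constant coefficient, and centring makes that coefficient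
  0.\<close>

lemma nonconstant_if_centered:
  assumes "m 0 = 1" "P \<in> nc_polys T" "Wigner \<notin> T" "linear_ext (lim_weight m) P = 0"
    "w \<in> nc_words P"
  shows "letters w \<noteq> []"
proof
  assume "letters w = []"
  then have w: "w = 0" by (cases w) (simp add: zero_ncword_def)
  have "lim_weight m (letters u) = (if u = 0 then 1 else 0)" if "u \<in> nc_words P" for u
  proof (cases "letters u")
    case Nil
    then show ?thesis using assms(1) by (cases u) (simp add: zero_ncword_def lim_weight_def)
  next
    case (Cons z l)
    then have "z \<in> T" using assms(2) that by (force simp: nc_polys_def)
    then have "\<not> set (letters u) \<subseteq> {Wigner}" using assms(3) Cons by auto
    moreover have "u \<noteq> 0" using Cons by (auto simp: zero_ncword_def)
    ultimately show ?thesis by (simp add: lim_weight_def)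
  qed
  then have "linear_ext (lim_weight m) P =
      (\<Sum>u\<in>nc_words P. if u = 0 then Poly_Mapping.lookup P u else 0)"
    unfolding linear_ext_def by (intro sum.cong refl) simp
  then have "Poly_Mapping.lookup P 0 = 0" using assms(4,5) w by simp
  then show False using assms(5) w by (simp add: in_keys_iff)
qed

section \<open>Effect of the powers of \<open>Wigner\<close> on the weights\<close>

lemma cyclic_weight_replicate:
  "cyclic_weight m r k k0 v (replicate j Wigner @ l) = cyclic_weight m r (k + j) k0 v l"
  by (induction j arbitrary: k) auto

text \<open>The factor of a block depends only on its length. Deleting the block leaves the matching
  of the vectors around it unchanged, with \<open>m 0 = 1\<close> as its neutral factor.\<close>

lemma cyclic_weight_interior:
  assumes "m 0 = 1" "x \<noteq> Wigner" "y \<noteq> Wigner"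
  shows "cyclic_weight m r k k0 v (A @ x # replicate j Wigner @ y # B) =
    m j * cyclic_weight m r k k0 v (A @ x # y # B)"
proof (induction A arbitrary: r k)
  case Nil
  show ?case using assms
    by (simp add: cyclic_weight_finite cyclic_weight_replicate)
next
  case (Cons z A)
  then show ?case by (cases "z = Wigner") (simp_all add: cyclic_weight_finite)
qed

lemma inf_weight_interior:
  assumes "m 0 = 1" "x \<noteq> Wigner" "y \<noteq> Wigner"
  shows "inf_weight m n k0 (A @ x # replicate j Wigner @ y # B) = m j * inf_weight m n k0 (A @ x # y # B)"
proof (induction A arbitrary: k0)
  case Nil
  show ?case using assms
    by (simp add: inf_weight_finite cyclic_weight_finite cyclic_weight_replicate)
next
  case (Cons z A)
  then show ?case
    by (cases "z = Wigner") (simp_all add: inf_weight_finite cyclic_weight_interior[where m = m, OF assms])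
qed

text \<open>Different vectors are asymptotically orthogonal, so the form between two adjacent rank
  one letters tends to 0.\<close>

lemma cyclic_weight_mismatch:
  assumes "x \<noteq> Wigner" "y \<noteq> Wigner" "right_vec x \<noteq> left_vec y"
  shows "cyclic_weight m r k k0 v (A @ x # y # B) = 0"
proof (induction A arbitrary: r k)
  case (Cons z A)
  then show ?case by (cases "z = Wigner") (simp_all add: cyclic_weight_finite)
qed (use assms in \<open>simp add: cyclic_weight_finite\<close>)

lemma inf_weight_mismatch:
  assumes "x \<noteq> Wigner" "y \<noteq> Wigner" "right_vec x \<noteq> left_vec y"
  shows "inf_weight m n k0 (A @ x # y # B) = 0"
proof (induction A arbitrary: k0)
  case (Cons z A)
  then show ?case
    by (cases "z = Wigner") (simp_all add: inf_weight_finite cyclic_weight_mismatch[OF assms])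
qed (use assms in \<open>simp add: inf_weight_finite cyclic_weight_finite\<close>)

lemma cyclic_weight_finite_word:
  assumes "m 0 = 1" "Wigner \<notin> set e"
  shows "cyclic_weight m r 0 k0 v (e @ replicate b Wigner) = m (k0 + b) * cyclic_weight m r 0 0 v e"
  using assms(2)
proof (induction e arbitrary: r)
  case Nil
  show ?case using assms(1) cyclic_weight_replicate[of m r 0 k0 v b "[]"] by (simp add: add.commute)
next
  case (Cons z e)
  then have "z \<noteq> Wigner" by auto
  then show ?case using Cons by (simp add: cyclic_weight_finite)
qed

text \<open>Read cyclically, the powers at both ends merge into one block of length
  \<open>a + b\<close>.\<close>

lemma inf_weight_conjugate:
  assumes "m 0 = 1" "Wigner \<notin> set e" "e \<noteq> []"
  shows "inf_weight m n 0 (replicate a Wigner @ e @ replicate b Wigner) = m (a + b) * inf_weight m n 0 e"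
proof -
  obtain z e' where e: "e = z # e'" using assms by (cases e) auto
  then have "z \<noteq> Wigner" using assms by auto
  then show ?thesis using e
    using assms by (simp add: inf_weight_replicate inf_weight_finite cyclic_weight_finite_word[of m])
qed

lemma wigner_word: "set l \<subseteq> {Wigner} \<Longrightarrow> l = replicate (length l) Wigner"
  by (induction l) auto

text \<open>Between rank one letters a polynomial in \<open>Wigner\<close> enters only through its
  mean; a centred one makes the product vanish.\<close>

lemma inf_functional_interior:
  assumes m: "m 0 = 1" and A: "ends_in (- {Wigner}) A" and a: "a \<in> nc_polys {Wigner}"
    and B: "starts_in (- {Wigner}) B"
  shows "linear_ext (inf_weight m n 0) (A * a * B) =
    linear_ext (lim_weight m) a * linear_ext (inf_weight m n 0) (A * B)"
proof -
  let ?f = "inf_weight m n 0"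
  have *: "?f (letters u @ letters w @ letters v) = lim_weight m (letters w) * ?f (letters u @ letters v)"
    if keys: "u \<in> nc_words A" "w \<in> nc_words a" "v \<in> nc_words B" for u w v
  proof -
    obtain u' x where u: "letters u = u' @ [x]" "x \<noteq> Wigner"
      using ends_inE[OF A keys(1)] by auto
    obtain y v' where v: "letters v = y # v'" "y \<noteq> Wigner"
      using starts_inE[OF B keys(3)] by auto
    have sub: "set (letters w) \<subseteq> {Wigner}" using a that(2) by (auto simp: nc_polys_def)
    obtain j where w: "letters w = replicate j Wigner" using wigner_word[OF sub] by blast
    show ?thesis
      using inf_weight_interior[where m = m, OF m u(2) v(2), of n 0 u' j v']
      by (auto simp: u v w lim_weight_def)
  qed
  have "linear_ext ?f (A * a * B) = linear_ext (\<lambda>u. linear_ext (\<lambda>w. linear_ext (\<lambda>v. ?f (u @ w @ v)) B) a) A"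
    by (simp add: linear_ext_mult mult.assoc)
  also have "\<dots> = linear_ext (\<lambda>u. linear_ext (\<lambda>w. lim_weight m w * linear_ext (\<lambda>v. ?f (u @ v)) B) a) A"
    unfolding linear_ext_cmult[symmetric] by (intro linear_ext_cong *)
  also have "\<dots> = linear_ext (lim_weight m) a * linear_ext ?f (A * B)"
    by (simp add: linear_ext_mult linear_ext_mult_const linear_ext_cmult)
  finally show ?thesis .
qed

lemma inf_functional_mismatch:
  assumes A: "ends_in S A" and B: "starts_in T B"
    and ST: "Wigner \<notin> S" "Wigner \<notin> T" "\<And>x y. x \<in> S \<Longrightarrow> y \<in> T \<Longrightarrow> right_vec x \<noteq> left_vec y"
  shows "linear_ext (inf_weight m n 0) (A * B) = 0"
proof -
  let ?f = "inf_weight m n 0"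
  have *: "?f (letters u @ letters v) = 0"
    if keys: "u \<in> nc_words A" "v \<in> nc_words B" for u v
  proof -
    obtain u' x where u: "letters u = u' @ [x]" "x \<in> S" using A keys(1) by (rule ends_inE)
    obtain y v' where v: "letters v = y # v'" "y \<in> T" using B keys(2) by (rule starts_inE)
    have "x \<noteq> Wigner" "y \<noteq> Wigner" "right_vec x \<noteq> left_vec y" using u v ST by auto
    from inf_weight_mismatch[OF this, of m n 0 u' v'] show ?thesis by (simp add: u v)
  qed
  have "linear_ext ?f (A * B) = linear_ext (\<lambda>u. linear_ext (\<lambda>v. 0) B) A"
    unfolding linear_ext_mult by (intro linear_ext_cong *)
  then show ?thesis by simp
qed

lemma inf_functional_conjugate:
  assumes m: "m 0 = 1" and a: "a \<in> nc_polys {Wigner}" and b: "b \<in> nc_polys {Wigner}"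
    and E: "E \<in> nc_polys T" "Wigner \<notin> T" "\<And>w. w \<in> nc_words E \<Longrightarrow> letters w \<noteq> []"
  shows "linear_ext (inf_weight m n 0) (a * E * b) =
    linear_ext (lim_weight m) (a * b) * linear_ext (inf_weight m n 0) E"
proof -
  let ?f = "inf_weight m n 0"
  have *: "?f (letters u @ letters w @ letters v) = lim_weight m (letters u @ letters v) * ?f (letters w)"
    if "u \<in> nc_words a" "w \<in> nc_words E" "v \<in> nc_words b" for u w v
  proof -
    have "set (letters u) \<subseteq> {Wigner}" "set (letters v) \<subseteq> {Wigner}"
      using a b that by (auto simp: nc_polys_def)
    then obtain i j where u: "letters u = replicate i Wigner" and v: "letters v = replicate j Wigner"
      using wigner_word by metis
    have "Wigner \<notin> set (letters w)" using E that by (auto simp: nc_polys_def)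
    then show ?thesis
      using inf_weight_conjugate[where m = m, OF m _ E(3)[OF that(2)], of n i j]
      by (auto simp: u v lim_weight_def)
  qed
  have "linear_ext ?f (a * E * b) = linear_ext (\<lambda>u. linear_ext (\<lambda>w. linear_ext (\<lambda>v. ?f (u @ w @ v)) b) E) a"
    by (simp add: linear_ext_mult mult.assoc)
  also have "\<dots> = linear_ext (\<lambda>u. linear_ext (\<lambda>w. linear_ext (\<lambda>v. lim_weight m (u @ v)) b * ?f w) E) a"
    unfolding linear_ext_mult_const[symmetric] by (intro linear_ext_cong *)
  also have "\<dots> = linear_ext (lim_weight m) (a * b) * linear_ext ?f E"
    by (simp add: linear_ext_mult linear_ext_mult_const linear_ext_cmult)
  finally show ?thesis .
qed

lemma (in complex_algebra_1) unital_subalgebra_generated: "unital_subalgebra (generated S)"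
  unfolding generated_def
  by (rule hull_in) (auto simp: unital_subalgebra_def intro: subspace_Inter)

lemma unital_subalgebra_nc_polys: "nc.unital_subalgebra (nc_polys I)"
proof -
  have "P * Q \<in> nc_polys I" if "P \<in> nc_polys I" "Q \<in> nc_polys I" for P Q
    using that by (fastforce simp: nc_polys_def elim!: keys_nc_mult)
  moreover have "P + Q \<in> nc_polys I" if "P \<in> nc_polys I" "Q \<in> nc_polys I" for P Q
    using that Poly_Mapping.keys_add[of P Q] by (auto simp: nc_polys_def)
  moreover have "nc_scale c P \<in> nc_polys I" if "P \<in> nc_polys I" for c P
    using that by (auto simp: nc_polys_def in_keys_iff)
  moreover have "1 \<in> nc_polys I"
    unfolding single_one[symmetric] by (simp add: nc_polys_def zero_ncword_def)
  moreover have "0 \<in> nc_polys I" by (simp add: nc_polys_def)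
  ultimately show ?thesis
    by (simp add: nc.unital_subalgebra_def nc.subspace_def)
qed

text \<open>Lets freeness be checked for all polynomials in the variables of a family, among which
  are the elements of the generated subalgebra.\<close>

lemma generated_vars_subset: "nc.generated (nc_var ` S) \<subseteq> nc_polys S"
  unfolding nc.generated_def
  by (rule hull_minimal[where S = nc.unital_subalgebra, OF _ unital_subalgebra_nc_polys])
    (auto simp: nc_var_def nc_polys_def)

lemma nc_polys_mono: "S \<subseteq> T \<Longrightarrow> nc_polys S \<subseteq> nc_polys T"
  by (auto simp: nc_polys_def)

lemma infinitesimal_nc_space_weights:
  assumes "m 0 = 1" "n 0 = 0"
  shows "infinitesimal_nc_space nc_scale (nc_polys I)
    (linear_ext (lim_weight m)) (linear_ext (inf_weight m n 0))"
proof
  show "nc.unital_subalgebra (nc_polys I)" by (rule unital_subalgebra_nc_polys)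
  show "nc.linear_functional_on (nc_polys I) (linear_ext (lim_weight m))"
    "nc.linear_functional_on (nc_polys I) (linear_ext (inf_weight m n 0))"
    by (simp_all add: nc.linear_functional_on_def linear_ext_add linear_ext_scale)
  show "linear_ext (lim_weight m) 1 = 1" "linear_ext (inf_weight m n 0) 1 = 0"
    using assms by (simp_all add: linear_ext_one lim_weight_def)
qed

lemma prod_list_upt_split:
  "j \<le> k \<Longrightarrow> prod_list (map a [0..<k]) = prod_list (map a [0..<j]) * prod_list (map a [j..<k])"
  by (metis le_add_diff_inverse map_append prod_list.append upt_add_eq_append zero_le)

lemma prod_list_upt_Cons: "j < k \<Longrightarrow> prod_list (map a [j..<k]) = a j * prod_list (map a [Suc j..<k])"
  by (simp add: upt_conv_Cons)

text \<open>Family 0 is the Wigner matrix; \<open>SS\<close> expresses that the rank one families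
  are mutually orthogonal in the limit. \<open>\<phi>\<close> vanishes because a centred factor
  outside family 0 has a rank one letter in every monomial. \<open>\<phi>'\<close> vanishes on
  adjacent factors of different rank one families and on a centred Wigner factor between two rank
  one factors. Wigner factors at the two ends merge cyclically, and this produces the only surviving
  term of the right-hand side.\<close>

lemma weights_free:
  fixes m n :: "nat \<Rightarrow> complex" and S :: "nat \<Rightarrow> ensemble_index set" and i :: "nat \<Rightarrow> nat" and a :: "nat \<Rightarrow> ensemble_index ncpoly"
  defines "\<phi> \<equiv> linear_ext (lim_weight m)" and "\<phi>' \<equiv> linear_ext (inf_weight m n 0)"
  assumes m: "m 0 = 1"
    and S0: "S 0 = {Wigner}"
    and SW: "\<And>l. l \<in> L \<Longrightarrow> l \<noteq> 0 \<Longrightarrow> Wigner \<notin> S l"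
    and SS: "\<And>l l' x y. l \<in> L \<Longrightarrow> l' \<in> L \<Longrightarrow> l \<noteq> 0 \<Longrightarrow> l' \<noteq> 0 \<Longrightarrow> l \<noteq> l' \<Longrightarrow>
      x \<in> S l \<Longrightarrow> y \<in> S l' \<Longrightarrow> right_vec x \<noteq> left_vec y"
    and k: "k \<ge> 2"
    and L: "\<And>j. j < k \<Longrightarrow> i j \<in> L"
    and a: "\<And>j. j < k \<Longrightarrow> a j \<in> nc_polys (S (i j))"
    and centered: "\<And>j. j < k \<Longrightarrow> \<phi> (a j) = 0"
    and alt: "\<And>j. Suc j < k \<Longrightarrow> i j \<noteq> i (Suc j)"
  shows "\<phi> (prod_list (map a [0..<k])) = 0"
    and "\<phi>' (prod_list (map a [0..<k])) =
      (\<Sum>j<k. \<phi>' (a j) * \<phi> (prod_list (map a ([0..<j] @ [Suc j..<k]))))"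
proof -
  have ne: "letters w \<noteq> []" if "j < k" "i j \<noteq> 0" "w \<in> nc_words (a j)" for j w
    using nonconstant_if_centered[where m = m, OF m a[OF that(1)] SW[OF L[OF that(1)] that(2)]] centered that
    by (auto simp: \<phi>_def)
  have st: "starts_in (S (i j)) (a j)" "ends_in (S (i j)) (a j)" if "j < k" "i j \<noteq> 0" for j
    using a[OF that(1)] ne[OF that] hd_in_set last_in_set
    unfolding starts_in_def ends_in_def nc_polys_def by blast+
  have mono: "starts_in T P \<Longrightarrow> T \<subseteq> T' \<Longrightarrow> starts_in T' P" "ends_in T P \<Longrightarrow> T \<subseteq> T' \<Longrightarrow> ends_in T' P"
    for T T' and P :: "ensemble_index ncpoly"
    by (auto simp: starts_in_def ends_in_def)
  have SC: "S (i j) \<subseteq> - {Wigner}" if "j < k" "i j \<noteq> 0" for j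
    using SW L that by auto
  have stW: "starts_in (- {Wigner}) (a j)" "ends_in (- {Wigner}) (a j)" if "j < k" "i j \<noteq> 0" for j
    using st[OF that] SC[OF that] mono by blast+
  have meets: "meets (- {Wigner}) (a j)" if "j < k" "i j \<noteq> 0" for j
    using stW(1)[OF that] hd_in_set unfolding meets_def starts_in_def by blast
  have aW: "a j \<in> nc_polys {Wigner}" if "j < k" "i j = 0" for j
    using a[OF that(1)] that(2) S0 by simp
  have zero: "\<phi> (prod_list (map a js)) = 0" if "j \<in> set js" "j < k" "i j \<noteq> 0" for j js
    unfolding \<phi>_def by (intro linear_ext_lim_weight_meets meets_prod_list[of "a j"]) (use that meets in auto)
  have "i 0 \<noteq> 0 \<or> i 1 \<noteq> 0" using alt[of 0] k by auto
  then show "\<phi> (prod_list (map a [0..<k])) = 0"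
    using zero[of 0 "[0..<k]"] zero[of 1 "[0..<k]"] k by auto
  \<comment> \<open>With two rank one factors, one of them survives the omission of any single
    factor, and \<open>\<phi>\<close> of the remaining product is 0.\<close>
  have rhs: "(\<Sum>j<k. \<phi>' (a j) * \<phi> (prod_list (map a ([0..<j] @ [Suc j..<k])))) = 0"
    if "j1 < k" "j2 < k" "j1 \<noteq> j2" "i j1 \<noteq> 0" "i j2 \<noteq> 0" for j1 j2
  proof (rule sum.neutral, rule ballI)
    fix j assume j: "j \<in> {..<k}"
    have "\<exists>j'. j' \<noteq> j \<and> j' < k \<and> i j' \<noteq> 0" using that by metis
    then obtain j' where "j' \<noteq> j" "j' < k" "i j' \<noteq> 0" by blast
    then have "\<phi> (prod_list (map a ([0..<j] @ [Suc j..<k]))) = 0"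
      by (intro zero[of j']) auto
    then show "\<phi>' (a j) * \<phi> (prod_list (map a ([0..<j] @ [Suc j..<k]))) = 0" by simp
  qed
  have mismatch: "\<phi>' (prod_list (map a [0..<k])) = 0" if "Suc j < k" "i j \<noteq> 0" "i (Suc j) \<noteq> 0" for j
  proof -
    have "ends_in (S (i j)) (prod_list (map a [0..<Suc j]))"
      using st(2)[of j] that by (simp add: ends_in_mult)
    moreover have "starts_in (S (i (Suc j))) (prod_list (map a [Suc j..<k]))"
      unfolding prod_list_upt_Cons[OF that(1)] using st(1)[of "Suc j"] that by (simp add: starts_in_mult)
    moreover have iL: "i j \<in> L" "i (Suc j) \<in> L" using L that(1) by auto
    moreover have "right_vec x \<noteq> left_vec y" if "x \<in> S (i j)" "y \<in> S (i (Suc j))" for x y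
      using SS[OF iL _ _ alt that] \<open>Suc j < k\<close> \<open>i j \<noteq> 0\<close> \<open>i (Suc j) \<noteq> 0\<close> by blast
    ultimately show ?thesis
      unfolding \<phi>'_def prod_list_upt_split[OF less_imp_le[OF that(1)]]
      using that SW by (intro inf_functional_mismatch) auto
  qed
  have interior: "\<phi>' (prod_list (map a [0..<k])) = 0"
    if "Suc (Suc j) < k" "i j \<noteq> 0" "i (Suc j) = 0" for j
  proof -
    have i2: "i (Suc (Suc j)) \<noteq> 0" using alt[of "Suc j"] that by simp
    have "ends_in (- {Wigner}) (prod_list (map a [0..<Suc j]))"
      using stW(2)[of j] that by (simp add: ends_in_mult)
    moreover have "starts_in (- {Wigner}) (prod_list (map a [Suc (Suc j)..<k]))"
      unfolding prod_list_upt_Cons[OF that(1)] using stW(1)[of "Suc (Suc j)"] that i2 by (simp add: starts_in_mult)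
    moreover have "prod_list (map a [0..<k]) =
        prod_list (map a [0..<Suc j]) * a (Suc j) * prod_list (map a [Suc (Suc j)..<k])"
      using that(1) prod_list_upt_split[of "Suc j" k a] prod_list_upt_Cons[of "Suc j" k a]
      by (simp add: mult.assoc)
    ultimately show ?thesis
      using centered[of "Suc j"] aW[of "Suc j"] that m
      by (simp add: inf_functional_interior \<phi>_def \<phi>'_def)
  qed
  \<comment> \<open>Both sides vanish unless exactly one factor is not a polynomial in \<open>Wigner\<close>, that is,
    except for \<open>W E\<close>, \<open>E W\<close> and \<open>W E W\<close>.\<close>
  show "\<phi>' (prod_list (map a [0..<k])) =
      (\<Sum>j<k. \<phi>' (a j) * \<phi> (prod_list (map a ([0..<j] @ [Suc j..<k]))))"
  proof -
    \<comment> \<open>The first four positions suffice: either two rank one factors occur there,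
      adjacent or around one Wigner factor, or the product is exhausted.\<close>
    consider (ends) "i 0 \<noteq> 0" "i 1 \<noteq> 0" | (adjacent) "k \<ge> 3" "i 1 \<noteq> 0" "i 2 \<noteq> 0"
      | (first) "k \<ge> 3" "i 1 = 0" | (second) "k \<ge> 4" "i 1 \<noteq> 0" "i 2 = 0"
      | (two) "k = 2" "i 0 = 0 \<or> i 1 = 0" | (three) "k = 3" "i 0 = 0" "i 1 \<noteq> 0" "i 2 = 0"
      using k by force
    then show ?thesis
    proof cases
      case ends
      then show ?thesis using mismatch[of 0] rhs[of 0 1] k by simp
    next
      case adjacent
      then show ?thesis using mismatch[of 1] rhs[of 1 2] by (simp add: numeral_2_eq_2)
    next
      case first
      have "i 0 \<noteq> 0" "i 2 \<noteq> 0" using alt[of 0] alt[of 1] first by (auto simp: numeral_2_eq_2)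
      then show ?thesis using interior[of 0] rhs[of 0 2] first by simp
    next
      case second
      have "i 3 \<noteq> 0" using alt[of 2] second by (auto simp: numeral_3_eq_3 numeral_2_eq_2)
      then show ?thesis using interior[of 1] rhs[of 1 3] second by (simp add: numeral_2_eq_2)
    next
      case two
      have *: "\<phi>' (a 0 * a 1) = 0"
      proof (cases "i 0 = 0")
        case True
        then have "i 1 \<noteq> 0" using alt[of 0] two by auto
        \<comment> \<open>The factor 1 stands for the missing polynomial in \<open>Wigner\<close> on
          the right.\<close>
        have "\<phi>' (a 0 * a 1 * 1) = \<phi> (a 0 * 1) * \<phi>' (a 1)"
          unfolding \<phi>_def \<phi>'_def
          by (rule inf_functional_conjugate[where T = "S (i 1)"])
            (use m aW[of 0] a[of 1] ne[of 1] SW L two True \<open>i 1 \<noteq> 0\<close> unital_subalgebra_nc_polys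
              in \<open>auto simp: nc.unital_subalgebra_def\<close>)
        then show ?thesis using centered[of 0] two by simp
      next
        case False
        then have "i 1 = 0" using two by auto
        have "\<phi>' (1 * a 0 * a 1) = \<phi> (1 * a 1) * \<phi>' (a 0)"
          unfolding \<phi>_def \<phi>'_def
          by (rule inf_functional_conjugate[where T = "S (i 0)"])
            (use m aW[of 1] a[of 0] ne[of 0] SW L two False \<open>i 1 = 0\<close> unital_subalgebra_nc_polys
              in \<open>auto simp: nc.unital_subalgebra_def\<close>)
        then show ?thesis using centered[of 1] two by simp
      qed
      have "{..<k} = {0, 1}" "[0..<k] = [0, 1]" using two by (auto simp: upt_rec)
      then show ?thesis using * centered[of 0] centered[of 1] two by (simp add: upt_rec)
    next
      case three
      have "\<phi>' (a 0 * a 1 * a 2) = \<phi> (a 0 * a 2) * \<phi>' (a 1)"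
        unfolding \<phi>_def \<phi>'_def
        by (rule inf_functional_conjugate[where T = "S (i 1)"])
          (use m aW[of 0] aW[of 2] a[of 1] ne[of 1] SW L three in auto)
      moreover have "\<phi> (a 1 * a 2) = 0" "\<phi> (a 0 * a 1) = 0"
        using zero[of 1 "[1, 2]"] zero[of 1 "[0, 1]"] three by auto
      moreover have "{..<k} = {0, 1, 2}" "[0..<k] = [0, 1, 2]" using three by (auto simp: upt_rec)
      ultimately show ?thesis using three by (simp add: upt_rec mult.assoc mult.commute numeral_2_eq_2)
    qed
  qed
qed

theorem theorem1p13:
  fixes M :: "nat \<Rightarrow> 'w measure"
    and X :: "nat \<Rightarrow> nat \<Rightarrow> nat \<Rightarrow> 'w \<Rightarrow> complex"
    and s \<sigma> \<alpha> :: real and \<beta> N\<^sub>0 :: nat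
  assumes prob: "\<And>N. N \<ge> 1 \<Longrightarrow> prob_space (M N)"
    and indep: "\<And>N. N \<ge> 1 \<Longrightarrow>
      prob_space.indep_vars (M N) (\<lambda>_. borel) (\<lambda>(j, k). X N j k) {(j, k). j \<le> k \<and> k < N}"
    and diag_real: "\<And>N j \<omega>. j < N \<Longrightarrow> \<omega> \<in> space (M N) \<Longrightarrow> X N j j \<omega> \<in> \<real>"
    and beta: "\<beta> \<in> {1, 2}"
    and off_diag_real: "\<And>N j k \<omega>. \<beta> = 1 \<Longrightarrow> j < k \<Longrightarrow> k < N \<Longrightarrow> \<omega> \<in> space (M N) \<Longrightarrow> X N j k \<omega> \<in> \<real>"
    and constants: "s\<^sup>2 \<ge> 0" "\<sigma>\<^sup>2 > 0"
    and diag_mean: "\<And>N j. j < N \<Longrightarrow> (\<integral>\<omega>. X N j j \<omega> \<partial>M N) = 0"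
    and diag_var: "\<And>N j. j < N \<Longrightarrow> (\<integral>\<omega>. (cmod (X N j j \<omega>))\<^sup>2 \<partial>M N) = s\<^sup>2"
    and off_diag_mean: "\<And>N j k. j < k \<Longrightarrow> k < N \<Longrightarrow> (\<integral>\<omega>. X N j k \<omega> \<partial>M N) = 0"
    and off_diag_var: "\<And>N j k. j < k \<Longrightarrow> k < N \<Longrightarrow> (\<integral>\<omega>. (cmod (X N j k \<omega>))\<^sup>2 \<partial>M N) = \<sigma>\<^sup>2"
    and off_diag_fourth: "\<And>N j k. j < k \<Longrightarrow> k < N \<Longrightarrow> (\<integral>\<omega>. cmod (X N j k \<omega>) ^ 4 \<partial>M N) = \<alpha>"
    and off_diag_square: "\<And>N j k. \<beta> = 2 \<Longrightarrow> j < k \<Longrightarrow> k < N \<Longrightarrow> (\<integral>\<omega>. (X N j k \<omega>)\<^sup>2 \<partial>M N) = 0"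
    and moments: "\<And>l::nat.
      (SUP N\<in>{1..}. SUP (j, k)\<in>{(j, k). j \<le> k \<and> k < N}.
         \<integral>\<^sup>+\<omega>. ennreal (cmod (X N j k \<omega>) ^ l) \<partial>M N) < \<infinity>"
  shows "asymptotically_infinitesimally_free M {..<3::nat}
    ((!) [{Wigner}, {MatUnit j k | j k. j < N\<^sub>0 \<and> k < N\<^sub>0}, {Ones}]) (ensemble X)"
proof -
  interpret W: wigner_ensemble M X s \<sigma> \<alpha> \<beta>
    by (rule wigner_ensemble.intro) fact+
  let ?S = "(!) [{Wigner}, {MatUnit j k | j k. j < N\<^sub>0 \<and> k < N\<^sub>0}, {Ones}]"
  let ?U = "\<Union>l\<in>{..<3::nat}. ?S l"
  let ?\<mu> = "linear_ext (lim_weight W.lim_moment)"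
  let ?\<nu> = "linear_ext (inf_weight W.lim_moment W.inf_moment 0)"
  interpret F: infinitesimal_nc_space nc_scale "nc_polys ?U" ?\<mu> ?\<nu>
    by (rule infinitesimal_nc_space_weights[where m = W.lim_moment and n = W.inf_moment, OF W.lim_moment_0 W.inf_moment_0])
  have L3: "l = 0 \<or> l = 1 \<or> l = 2" if "l < 3" for l :: nat using that by auto
  have SW: "Wigner \<notin> ?S l" if "l \<in> {..<3}" "l \<noteq> 0" for l
    using L3[of l] that by auto
  \<comment> \<open>Matrix units have vectors \<open>Some j\<close>, whereas both vectors of
    \<open>Ones\<close> are \<open>None\<close>.\<close>
  have SS: "right_vec x \<noteq> left_vec y"
    if "l \<in> {..<3}" "l' \<in> {..<3}" "l \<noteq> 0" "l' \<noteq> 0" "l \<noteq> l'" "x \<in> ?S l" "y \<in> ?S l'" for l l' x y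
    using L3[of l] L3[of l'] that by auto
  have gen: "nc.generated (nc_var ` ?S l) \<subseteq> nc_polys (?S l)" for l
    by (rule generated_vars_subset)
  have "F.infinitesimally_free_collections {..<3} (\<lambda>l. nc_var ` ?S l)"
    unfolding F.infinitesimally_free_collections_def F.infinitesimally_free_def
  proof (intro conjI ballI allI impI; (elim conjE)?)
    fix l :: nat assume l: "l \<in> {..<3}"
    show "nc.unital_subalgebra (nc.generated (nc_var ` ?S l))"
      by (rule nc.unital_subalgebra_generated)
    show "nc.generated (nc_var ` ?S l) \<subseteq> nc_polys ?U"
      using gen[of l] nc_polys_mono[of "?S l" ?U] l by blast
  next
    fix k and i :: "nat \<Rightarrow> nat" and a :: "nat \<Rightarrow> ensemble_index ncpoly"
    assume k: "2 \<le> k"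
      and *: "\<forall>j<k. i j \<in> {..<3} \<and> a j \<in> nc.generated (nc_var ` ?S (i j)) \<and> ?\<mu> (a j) = 0"
      and alt: "\<forall>j. Suc j < k \<longrightarrow> i j \<noteq> i (Suc j)"
    have a: "a j \<in> nc_polys (?S (i j))" if "j < k" for j using * that gen by blast
    have free: "?\<mu> (prod_list (map a [0..<k])) = 0 \<and> ?\<nu> (prod_list (map a [0..<k])) =
        (\<Sum>j<k. ?\<nu> (a j) * ?\<mu> (prod_list (map a ([0..<j] @ [Suc j..<k]))))"
      by (intro conjI weights_free[where S = ?S and L = "{..<3}" and i = i and m = W.lim_moment, OF W.lim_moment_0 _ SW SS k _ a])
        (use * alt in auto)
    show "?\<mu> (prod_list (map a [0..<k])) = 0" using free by blast
    show "?\<nu> (prod_list (map a [0..<k])) =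
        (\<Sum>j<k. ?\<nu> (a j) * ?\<mu> (prod_list (map a ([0..<j] @ [Suc j..<k]))))" using free by blast
  qed
  then show ?thesis
    unfolding asymptotically_infinitesimally_free_def
    using W.ensemble_random_matrix W.ensemble_infinitesimal_distribution[of ?U] F.infinitesimal_nc_space_axioms
    by blast
qed

end
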